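(* Let $G$ be a Polish group and $\Pi(G)$ its universal minimal proximal flow. Then $P(\Pi(G))$ is a proximally irreducible affine $G$-flow.
   Context: A $G$-flow is a (nonempty) compact Hausdorff space with a continuous left action of $G$. A flow is minimal if every orbit is dense, and proximal if for all $x,y$ there is a net $(g_\lambda)$ in $G$ with $\lim g_\lambda x=\lim g_\lambda y$. $\Pi(G)$ is the unique up to isomorphism minimal proximal $G$-flow mapping continuously and equivariantly onto every minimal proximal $G$-flow. For a compact space $X$, $P(X)$ is the space of regular Borel probability measures with the weak$^*$ topology. An affine $G$-flow is a (nonempty) compact convex set (in a Hausdorff locally convex topological vector space) with a continuous action of $G$ by affine homeomorphisms; $P(X)$ is one when $X$ is a $G$-flow. An affine subflow is a nonempty closed convex $G$-invariant subset. An affine extension is a surjective continuous affine $G$-equivariant map. $\overline{\mathrm{ext}}(K)$ is the closure of the set of extreme points, $\mathrm{conv}(A)$ the set of (finite) convex combinations. An affine extension $\phi\colon L\to K$ is a proximally irreducible extension if every affine subflow $C\subseteq L$ with $C\cap\mathrm{conv}(\overline{\mathrm{ext}}(L)\cap\phi^{-1}(\{y\}))\neq\emptyset$ for all $y\in\overline{\mathrm{ext}}(K)$ equals $L$. An affine $G$-flow $K$ is proximally irreducible if every proximally irreducible extension $L\to K$ is an isomorphism. *)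

theory Defs
  imports
    "HOL-Probability.Probability"
    "HOL-Algebra.Group"
    "HOL-Library.Function_Algebras"
begin

(* HOL-Algebra uses the notation of Abstract_Topology.closure_of for a notion of its own. *)
no_notation eq_closure_of (\<open>closure'_of\<index>\<close>)

section \<open>Hausdorff locally convex topological vector spaces\<close>

class hausdorff_lctvs = real_vector + topological_ab_group_add + t2_space +
  assumes tendsto_scaleR_Pair:
      "LIM p (nhds r \<times>\<^sub>F nhds a). fst p *\<^sub>R snd p :> nhds (r *\<^sub>R a)"
    and locally_convex:
      "open U \<Longrightarrow> a \<in> U \<Longrightarrow>
       \<exists>W. open W \<and> a \<in> W \<and> W \<subseteq> U \<and>
           (\<forall>x\<in>W. \<forall>y\<in>W. \<forall>s\<ge>0. \<forall>t\<ge>0. s + t = 1 \<longrightarrow> s *\<^sub>R x + t *\<^sub>R y \<in> W)"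

lemma locally_convex_nhd:
  fixes a :: "'a::hausdorff_lctvs"
  assumes "open U" "a \<in> U"
  shows "\<exists>W. open W \<and> convex W \<and> a \<in> W \<and> W \<subseteq> U"
  using locally_convex[OF assms] unfolding convex_def by blast

lemma locally_convex_classI:
  fixes a :: "'a::real_vector"
  assumes "\<exists>W. P W \<and> convex W \<and> a \<in> W \<and> W \<subseteq> U"
  shows "\<exists>W. P W \<and> a \<in> W \<and> W \<subseteq> U \<and>
           (\<forall>x\<in>W. \<forall>y\<in>W. \<forall>s\<ge>0. \<forall>t\<ge>0. s + t = 1 \<longrightarrow> s *\<^sub>R x + t *\<^sub>R y \<in> W)"
  using assms unfolding convex_def by blast

text \<open>Functions into the reals, with pointwise operations and the product topology (the topology of
  pointwise convergence). The measures on a space will be embedded into such a function space.\<close>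

instantiation "fun" :: (type, real_vector) real_vector
begin

definition scaleR_fun_def: "r *\<^sub>R f = (\<lambda>x. r *\<^sub>R f x)"

instance
  by standard (simp_all add: scaleR_fun_def fun_eq_iff scaleR_add_right scaleR_add_left)

end

lemma scaleR_fun_apply [simp]: "(r *\<^sub>R f) x = r *\<^sub>R f x"
  by (simp add: scaleR_fun_def)

lemma tendsto_fun_iff:
  fixes f :: "'i \<Rightarrow> 'a \<Rightarrow> 'b::topological_space"
  shows "(f \<longlongrightarrow> l) F \<longleftrightarrow> (\<forall>a. ((\<lambda>i. f i a) \<longlongrightarrow> l a) F)"
  using limitin_componentwise[of "\<lambda>_. euclidean :: 'b topology" "UNIV :: 'a set" f l F]
  by (simp add: euclidean_product_topology)

lemma tendsto_fun_apply:
  fixes f :: "'i \<Rightarrow> 'a \<Rightarrow> 'b::topological_space"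
  shows "(f \<longlongrightarrow> l) F \<Longrightarrow> ((\<lambda>i. f i a) \<longlongrightarrow> l a) F"
  by (simp add: tendsto_fun_iff)

instance "fun" :: (type, topological_ab_group_add) topological_ab_group_add
proof
  fix a b :: "'a \<Rightarrow> 'b"
  have 1: "((\<lambda>p. fst p) \<longlongrightarrow> a) (nhds a \<times>\<^sub>F nhds b)"
    by (rule filterlim_fst)
  have 2: "((\<lambda>p. snd p) \<longlongrightarrow> b) (nhds a \<times>\<^sub>F nhds b)"
    by (rule filterlim_snd)
  show "LIM p nhds a \<times>\<^sub>F nhds b. fst p + snd p :> nhds (a + b)"
    unfolding tendsto_fun_iff plus_fun_apply
    by (intro allI tendsto_add tendsto_fun_apply[OF 1] tendsto_fun_apply[OF 2])
next
  fix a :: "'a \<Rightarrow> 'b"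
  have 1: "((\<lambda>p. p) \<longlongrightarrow> a) (nhds a)"
    by (rule filterlim_ident)
  show "(uminus \<longlongrightarrow> - a) (nhds a)"
    unfolding tendsto_fun_iff fun_Compl_def
    by (intro allI tendsto_minus tendsto_fun_apply[OF 1])
qed

lemma open_vimage_coordinate:
  fixes U :: "'b::topological_space set"
  assumes "open U"
  shows "open ((\<lambda>h::'a \<Rightarrow> 'b. h x) -` U)"
  by (rule open_vimage[OF assms continuous_on_product_coordinates])

instance "fun" :: (type, t0_space) t0_space
proof
  fix f g :: "'a \<Rightarrow> 'b"
  assume "f \<noteq> g"
  then obtain x where "f x \<noteq> g x" by auto
  then obtain U where "open U" "\<not> (f x \<in> U \<longleftrightarrow> g x \<in> U)"
    using t0_space_class.t0_space[OF \<open>f x \<noteq> g x\<close>] by auto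
  then show "\<exists>U. open U \<and> \<not> (f \<in> U \<longleftrightarrow> g \<in> U)"
    by (intro exI[of _ "(\<lambda>h. h x) -` U"]) (auto intro: open_vimage_coordinate)
qed

instance "fun" :: (type, t1_space) t1_space
proof
  fix f g :: "'a \<Rightarrow> 'b"
  assume "f \<noteq> g"
  then obtain x where "f x \<noteq> g x" by auto
  then obtain U where "open U" "f x \<in> U" "g x \<notin> U"
    by (meson t1_space)
  then show "\<exists>U. open U \<and> f \<in> U \<and> g \<notin> U"
    by (intro exI[of _ "(\<lambda>h. h x) -` U"]) (auto intro: open_vimage_coordinate)
qed

instance "fun" :: (type, t2_space) t2_space
proof
  fix f g :: "'a \<Rightarrow> 'b"
  assume "f \<noteq> g"
  then obtain x where "f x \<noteq> g x" by auto
  then obtain U V where UV: "open U" "open V" "f x \<in> U" "g x \<in> V" "U \<inter> V = {}"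
    by (meson hausdorff)
  then show "\<exists>U V. open U \<and> open V \<and> f \<in> U \<and> g \<in> V \<and> U \<inter> V = {}"
    using UV by (intro exI[of _ "(\<lambda>h. h x) -` U"] exI[of _ "(\<lambda>h. h x) -` V"])
       (auto intro: open_vimage_coordinate)
qed

instance "fun" :: (type, hausdorff_lctvs) hausdorff_lctvs
proof
  fix r :: real and a :: "'a \<Rightarrow> 'b"
  have 1: "((\<lambda>p. fst p) \<longlongrightarrow> r) (nhds r \<times>\<^sub>F nhds a)"
    by (rule filterlim_fst)
  have 2: "((\<lambda>p. snd p) \<longlongrightarrow> a) (nhds r \<times>\<^sub>F nhds a)"
    by (rule filterlim_snd)
  show "LIM p nhds r \<times>\<^sub>F nhds a. fst p *\<^sub>R snd p :> nhds (r *\<^sub>R a)"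
    unfolding tendsto_fun_iff scaleR_fun_apply
  proof
    fix x
    have "((\<lambda>p. (fst p, snd p x)) \<longlongrightarrow> (r, a x)) (nhds r \<times>\<^sub>F nhds a)"
      by (intro tendsto_Pair 1 tendsto_fun_apply[OF 2])
    then have "LIM p nhds r \<times>\<^sub>F nhds a. (fst p, snd p x) :> nhds r \<times>\<^sub>F nhds (a x)"
      by (simp add: nhds_prod)
    from filterlim_compose[OF tendsto_scaleR_Pair this]
    show "((\<lambda>p. fst p *\<^sub>R snd p x) \<longlongrightarrow> r *\<^sub>R a x) (nhds r \<times>\<^sub>F nhds a)" by simp
  qed
next
  fix U :: "('a \<Rightarrow> 'b) set" and a
  assume "open U" "a \<in> U"
  then obtain B where B: "a \<in> Pi\<^sub>E UNIV B" "\<And>i. open (B i)" "finite {i. B i \<noteq> UNIV}"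
      "Pi\<^sub>E UNIV B \<subseteq> U"
    using product_topology_open_contains_basis[of "\<lambda>_. euclidean :: 'b topology" "UNIV :: 'a set" U a]
    unfolding open_fun_def by auto
  have "\<forall>i. \<exists>W. open W \<and> convex W \<and> a i \<in> W \<and> W \<subseteq> B i"
    using B by (intro allI locally_convex_nhd) auto
  then obtain W where W: "\<And>i. open (W i)" "\<And>i. convex (W i)" "\<And>i. a i \<in> W i" "\<And>i. W i \<subseteq> B i"
    by metis
  define V where "V = (\<lambda>i. if B i = UNIV then UNIV else W i)"
  have V: "\<And>i. open (V i)" "\<And>i. convex (V i)" "\<And>i. a i \<in> V i" "\<And>i. V i \<subseteq> B i"
    using W by (auto simp: V_def)
  have fin: "finite {i. V i \<noteq> UNIV}"
    by (rule finite_subset[OF _ B(3)]) (auto simp: V_def)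
  have "open (Pi\<^sub>E UNIV V)"
    by (rule open_PiE) (use V fin in auto)
  moreover have "convex (Pi\<^sub>E UNIV V)"
    using V(2) by (auto simp: convex_def PiE_UNIV_domain Pi_iff)
  moreover have "a \<in> Pi\<^sub>E UNIV V" "Pi\<^sub>E UNIV V \<subseteq> U"
    using V(3,4) B(4) by (fastforce simp: PiE_UNIV_domain Pi_iff subset_iff)+
  ultimately have "\<exists>W. open W \<and> convex W \<and> a \<in> W \<and> W \<subseteq> U" by blast
  then show "\<exists>W. open W \<and> a \<in> W \<and> W \<subseteq> U \<and>
           (\<forall>x\<in>W. \<forall>y\<in>W. \<forall>s\<ge>0. \<forall>t\<ge>0. s + t = 1 \<longrightarrow> s *\<^sub>R x + t *\<^sub>R y \<in> W)"
    by (rule locally_convex_classI)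
qed

instance real :: hausdorff_lctvs
proof
  fix r a :: real
  show "LIM p nhds r \<times>\<^sub>F nhds a. fst p *\<^sub>R snd p :> nhds (r *\<^sub>R a)"
    by (intro tendsto_scaleR filterlim_fst filterlim_snd)
next
  fix U :: "real set" and a :: real
  assume "open U" "a \<in> U"
  then obtain e where "e > 0" "ball a e \<subseteq> U" by (meson openE)
  then have "\<exists>W. open W \<and> convex W \<and> a \<in> W \<and> W \<subseteq> U"
    by (intro exI[of _ "ball a e"]) auto
  then show "\<exists>W. open W \<and> a \<in> W \<and> W \<subseteq> U \<and>
           (\<forall>x\<in>W. \<forall>y\<in>W. \<forall>s\<ge>0. \<forall>t\<ge>0. s + t = 1 \<longrightarrow> s *\<^sub>R x + t *\<^sub>R y \<in> W)"
    by (rule locally_convex_classI)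
qed


section \<open>Polish groups and their flows\<close>

definition topological_group :: "('g, 'm) monoid_scheme \<Rightarrow> 'g topology \<Rightarrow> bool" where
  "topological_group G T \<longleftrightarrow>
     group G \<and> topspace T = carrier G \<and>
     continuous_map (prod_topology T T) T (\<lambda>(g, h). g \<otimes>\<^bsub>G\<^esub> h) \<and>
     continuous_map T T (\<lambda>g. inv\<^bsub>G\<^esub> g)"

definition polish_group :: "('g, 'm) monoid_scheme \<Rightarrow> 'g topology \<Rightarrow> bool" where
  "polish_group G T \<longleftrightarrow>
     topological_group G T \<and> separable_space T \<and> completely_metrizable_space T"

definition flow ::
  "('g, 'm) monoid_scheme \<Rightarrow> 'g topology \<Rightarrow> 'x topology \<Rightarrow> ('g \<Rightarrow> 'x \<Rightarrow> 'x) \<Rightarrow> bool" where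
  "flow G T X \<alpha> \<longleftrightarrow>
     topspace X \<noteq> {} \<and> compact_space X \<and> Hausdorff_space X \<and>
     continuous_map (prod_topology T X) X (\<lambda>(g, x). \<alpha> g x) \<and>
     (\<forall>x\<in>topspace X. \<alpha> \<one>\<^bsub>G\<^esub> x = x) \<and>
     (\<forall>g\<in>carrier G. \<forall>h\<in>carrier G. \<forall>x\<in>topspace X. \<alpha> (g \<otimes>\<^bsub>G\<^esub> h) x = \<alpha> g (\<alpha> h x))"

definition minimal_flow ::
  "('g, 'm) monoid_scheme \<Rightarrow> 'g topology \<Rightarrow> 'x topology \<Rightarrow> ('g \<Rightarrow> 'x \<Rightarrow> 'x) \<Rightarrow> bool" where
  "minimal_flow G T X \<alpha> \<longleftrightarrow>
     flow G T X \<alpha> \<and>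
     (\<forall>x\<in>topspace X. X closure_of ((\<lambda>g. \<alpha> g x) ` carrier G) = topspace X)"

text \<open>A net in the group is represented by the filter on the group that it generates;
  every proper filter that contains the carrier arises from a net in this way.\<close>

definition proximal_flow ::
  "('g, 'm) monoid_scheme \<Rightarrow> 'g topology \<Rightarrow> 'x topology \<Rightarrow> ('g \<Rightarrow> 'x \<Rightarrow> 'x) \<Rightarrow> bool" where
  "proximal_flow G T X \<alpha> \<longleftrightarrow>
     flow G T X \<alpha> \<and>
     (\<forall>x\<in>topspace X. \<forall>y\<in>topspace X. \<exists>F z.
        F \<noteq> bot \<and> F \<le> principal (carrier G) \<and>
        limitin X (\<lambda>g. \<alpha> g x) z F \<and> limitin X (\<lambda>g. \<alpha> g y) z F)"

definition factor_map ::
  "('g, 'm) monoid_scheme \<Rightarrow> 'x topology \<Rightarrow> ('g \<Rightarrow> 'x \<Rightarrow> 'x) \<Rightarrow>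
     'y topology \<Rightarrow> ('g \<Rightarrow> 'y \<Rightarrow> 'y) \<Rightarrow> ('x \<Rightarrow> 'y) \<Rightarrow> bool" where
  "factor_map G X \<alpha> Y \<beta> f \<longleftrightarrow>
     continuous_map X Y f \<and> f ` topspace X = topspace Y \<and>
     (\<forall>g\<in>carrier G. \<forall>x\<in>topspace X. f (\<alpha> g x) = \<beta> g (f x))"

text \<open>A quantifier over flows has to fix the type of their points. A minimal flow has a dense orbit,
  hence at most as many points as there are families of subsets of the group, so it is no
  restriction to take points of type \<^typ>\<open>'g set set\<close>; see \<open>universal_minimal_proximal_factor\<close>
  below.\<close>

definition universal_minimal_proximal_flow ::
  "('g, 'm) monoid_scheme \<Rightarrow> 'g topology \<Rightarrow> 'x topology \<Rightarrow> ('g \<Rightarrow> 'x \<Rightarrow> 'x) \<Rightarrow> bool" where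
  "universal_minimal_proximal_flow G T X \<alpha> \<longleftrightarrow>
     minimal_flow G T X \<alpha> \<and> proximal_flow G T X \<alpha> \<and>
     (\<forall>(Y :: 'g set set topology) \<beta>. minimal_flow G T Y \<beta> \<and> proximal_flow G T Y \<beta> \<longrightarrow>
        (\<exists>f. factor_map G X \<alpha> Y \<beta> f))"


section \<open>Affine flows\<close>

definition affine_map_on :: "'a::real_vector set \<Rightarrow> ('a \<Rightarrow> 'b::real_vector) \<Rightarrow> bool" where
  "affine_map_on K f \<longleftrightarrow>
     (\<forall>x\<in>K. \<forall>y\<in>K. \<forall>t. 0 \<le> t \<and> t \<le> 1 \<longrightarrow>
        f ((1 - t) *\<^sub>R x + t *\<^sub>R y) = (1 - t) *\<^sub>R f x + t *\<^sub>R f y)"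

definition affine_flow ::
  "('g, 'm) monoid_scheme \<Rightarrow> 'g topology \<Rightarrow> 'v::hausdorff_lctvs set \<Rightarrow> ('g \<Rightarrow> 'v \<Rightarrow> 'v) \<Rightarrow> bool" where
  "affine_flow G T K \<alpha> \<longleftrightarrow>
     convex K \<and> flow G T (top_of_set K) \<alpha> \<and> (\<forall>g\<in>carrier G. affine_map_on K (\<alpha> g))"

definition affine_subflow ::
  "('g, 'm) monoid_scheme \<Rightarrow> ('g \<Rightarrow> 'v \<Rightarrow> 'v) \<Rightarrow> 'v::hausdorff_lctvs set \<Rightarrow> 'v set \<Rightarrow> bool" where
  "affine_subflow G \<alpha> K C \<longleftrightarrow>
     C \<subseteq> K \<and> C \<noteq> {} \<and> closed C \<and> convex C \<and> (\<forall>g\<in>carrier G. \<forall>x\<in>C. \<alpha> g x \<in> C)"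

definition affine_extension ::
  "('g, 'm) monoid_scheme \<Rightarrow> 'v::hausdorff_lctvs set \<Rightarrow> ('g \<Rightarrow> 'v \<Rightarrow> 'v) \<Rightarrow>
     'w::hausdorff_lctvs set \<Rightarrow> ('g \<Rightarrow> 'w \<Rightarrow> 'w) \<Rightarrow> ('v \<Rightarrow> 'w) \<Rightarrow> bool" where
  "affine_extension G L \<sigma> K \<tau> \<phi> \<longleftrightarrow>
     factor_map G (top_of_set L) \<sigma> (top_of_set K) \<tau> \<phi> \<and> affine_map_on L \<phi>"

definition affine_flow_isomorphism ::
  "('g, 'm) monoid_scheme \<Rightarrow> 'v::hausdorff_lctvs set \<Rightarrow> ('g \<Rightarrow> 'v \<Rightarrow> 'v) \<Rightarrow>
     'w::hausdorff_lctvs set \<Rightarrow> ('g \<Rightarrow> 'w \<Rightarrow> 'w) \<Rightarrow> ('v \<Rightarrow> 'w) \<Rightarrow> bool" where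
  "affine_flow_isomorphism G L \<sigma> K \<tau> \<phi> \<longleftrightarrow>
     affine_extension G L \<sigma> K \<tau> \<phi> \<and> homeomorphic_map (top_of_set L) (top_of_set K) \<phi>"

abbreviation ext_closure :: "'v::hausdorff_lctvs set \<Rightarrow> 'v set" where
  "ext_closure K \<equiv> closure {x. x extreme_point_of K}"

definition proximally_irreducible_extension ::
  "('g, 'm) monoid_scheme \<Rightarrow> 'v::hausdorff_lctvs set \<Rightarrow> ('g \<Rightarrow> 'v \<Rightarrow> 'v) \<Rightarrow>
     'w::hausdorff_lctvs set \<Rightarrow> ('g \<Rightarrow> 'w \<Rightarrow> 'w) \<Rightarrow> ('v \<Rightarrow> 'w) \<Rightarrow> bool" where
  "proximally_irreducible_extension G L \<sigma> K \<tau> \<phi> \<longleftrightarrow>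
     affine_extension G L \<sigma> K \<tau> \<phi> \<and>
     (\<forall>C. affine_subflow G \<sigma> L C \<and>
          (\<forall>y\<in>ext_closure K. C \<inter> convex hull (ext_closure L \<inter> {x\<in>L. \<phi> x = y}) \<noteq> {}) \<longrightarrow>
          C = L)"

text \<open>The argument of type \<^typ>\<open>'v itself\<close> names the ambient space of the extensions. A statement
  in which the type variable \<^typ>\<open>'v\<close> is left free speaks about all Hausdorff locally convex spaces.\<close>

definition proximally_irreducible ::
  "'v::hausdorff_lctvs itself \<Rightarrow> ('g, 'm) monoid_scheme \<Rightarrow> 'g topology \<Rightarrow>
     'w::hausdorff_lctvs set \<Rightarrow> ('g \<Rightarrow> 'w \<Rightarrow> 'w) \<Rightarrow> bool" where
  "proximally_irreducible _ G T K \<alpha> \<longleftrightarrow>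
     affine_flow G T K \<alpha> \<and>
     (\<forall>(L :: 'v set) \<sigma> \<phi>.
        affine_flow G T L \<sigma> \<and> proximally_irreducible_extension G L \<sigma> K \<alpha> \<phi> \<longrightarrow>
        affine_flow_isomorphism G L \<sigma> K \<alpha> \<phi>)"


section \<open>The space of regular Borel probability measures\<close>

definition borel_of :: "'x topology \<Rightarrow> 'x measure" where
  "borel_of X = sigma (topspace X) {U. openin X U}"

definition regular_borel_probability :: "'x topology \<Rightarrow> 'x measure \<Rightarrow> bool" where
  "regular_borel_probability X M \<longleftrightarrow>
     prob_space M \<and> space M = topspace X \<and> sets M = sets (borel_of X) \<and>
     (\<forall>A\<in>sets M. emeasure M A = (INF U\<in>{U. openin X U \<and> A \<subseteq> U}. emeasure M U) \<and>
                 emeasure M A = (SUP C\<in>{C. compactin X C \<and> C \<subseteq> A}. emeasure M C))"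

text \<open>To have the convex set of measures sit in a topological vector space, a measure is identified
  with the functional it induces on the continuous functions (the map is injective, see
  \<open>inj_on_measure_functional\<close> below). As \<^typ>\<open>'x \<Rightarrow> real\<close> also contains functions that are
  not continuous on \<open>X\<close>, the functional is made \<open>0\<close> there. The weak* topology then is
  the one induced by the product topology of \<^typ>\<open>('x \<Rightarrow> real) \<Rightarrow> real\<close>.\<close>

definition measure_functional :: "'x topology \<Rightarrow> 'x measure \<Rightarrow> ('x \<Rightarrow> real) \<Rightarrow> real" where
  "measure_functional X M = (\<lambda>f. if continuous_map X euclideanreal f then \<integral>x. f x \<partial>M else 0)"

definition probability_measures :: "'x topology \<Rightarrow> (('x \<Rightarrow> real) \<Rightarrow> real) set" where
  "probability_measures X = measure_functional X ` {M. regular_borel_probability X M}"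

text \<open>The push-forward action, in terms of functionals; see \<open>measure_functional_distr\<close> below.\<close>

definition push_forward ::
  "('g \<Rightarrow> 'x \<Rightarrow> 'x) \<Rightarrow> 'g \<Rightarrow> (('x \<Rightarrow> real) \<Rightarrow> real) \<Rightarrow> ('x \<Rightarrow> real) \<Rightarrow> real" where
  "push_forward \<alpha> g \<Lambda> = (\<lambda>f. \<Lambda> (\<lambda>x. f (\<alpha> g x)))"


section \<open>Adequacy of the encodings\<close>

lemma space_borel_of [simp]: "space (borel_of X) = topspace X"
  by (simp add: borel_of_def space_measure_of_conv)

lemma sets_borel_of: "sets (borel_of X) = sigma_sets (topspace X) {U. openin X U}"
  unfolding borel_of_def by (rule sets_measure_of) (auto dest: openin_subset)

lemma openin_borel_of: "openin X U \<Longrightarrow> U \<in> sets (borel_of X)"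
  by (simp add: sets_borel_of)

lemma closedin_borel_of: "closedin X C \<Longrightarrow> C \<in> sets (borel_of X)"
  by (metis closedin_def openin_borel_of sets.compl_sets space_borel_of double_diff order_refl)

lemma continuous_map_measurable_borel_of:
  assumes "continuous_map X Y f"
  shows "f \<in> borel_of X \<rightarrow>\<^sub>M borel_of Y"
  unfolding borel_of_def[of Y]
proof (rule measurable_sigma_sets)
  show "sets (sigma (topspace Y) {U. openin Y U}) = sigma_sets (topspace Y) {U. openin Y U}"
    using sets_borel_of[of Y] by (simp add: borel_of_def)
  show "{U. openin Y U} \<subseteq> Pow (topspace Y)"
    by (auto dest: openin_subset)
  show "f \<in> space (borel_of X) \<rightarrow> topspace Y"
    using assms by (auto simp: continuous_map_def)
  fix U assume "U \<in> {U. openin Y U}"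
  then have "openin X {x \<in> topspace X. f x \<in> U}"
    using assms by (auto simp: continuous_map_def)
  moreover have "f -` U \<inter> space (borel_of X) = {x \<in> topspace X. f x \<in> U}" by auto
  ultimately show "f -` U \<inter> space (borel_of X) \<in> sets (borel_of X)"
    by (simp add: openin_borel_of)
qed

lemma borel_of_euclidean: "borel_of euclidean = borel"
  by (simp add: borel_of_def borel_def)

lemma continuous_map_borel_measurable:
  "continuous_map X euclideanreal f \<Longrightarrow> f \<in> borel_measurable (borel_of X)"
  using continuous_map_measurable_borel_of[of X euclideanreal f] by (simp add: borel_of_euclidean)

lemma measure_functional_eq_imp_le:
  assumes X: "compact_space X" "Hausdorff_space X"
    and M: "regular_borel_probability X M" and N: "regular_borel_probability X N"
    and eq: "measure_functional X M = measure_functional X N"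
    and C: "compactin X C"
  shows "emeasure M C \<le> emeasure N C"
proof -
  interpret M: prob_space M using M by (simp add: regular_borel_probability_def)
  interpret N: prob_space N using N by (simp add: regular_borel_probability_def)
  have spM [simp]: "space M = topspace X" and stM: "sets M = sets (borel_of X)"
    using M by (auto simp: regular_borel_probability_def)
  have spN [simp]: "space N = topspace X" and stN: "sets N = sets (borel_of X)"
    using N by (auto simp: regular_borel_probability_def)
  have clC: "closedin X C"
    using C X by (simp add: compactin_imp_closedin)
  then have CM: "C \<in> sets M" and CN: "C \<in> sets N"
    by (auto simp: stM stN closedin_borel_of)
  have *: "emeasure M C \<le> emeasure N U" if U: "openin X U" "C \<subseteq> U" for U
  proof -
    have UN: "U \<in> sets N" using U by (simp add: stN openin_borel_of)
    have "normal_space X"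
      using X by (simp add: compact_Hausdorff_or_regular_imp_normal_space)
    moreover have "closedin X (topspace X - U)" using U by auto
    moreover have "disjnt (topspace X - U) C" using U by (auto simp: disjnt_def)
    ultimately obtain f where
      f: "continuous_map X (top_of_set {0..1::real}) f"
         "f ` (topspace X - U) \<subseteq> {0}" "f ` C \<subseteq> {1}"
      using Urysohn_lemma[of X "topspace X - U" C 0 1] clC by auto
    have cf: "continuous_map X euclideanreal f"
      using f(1) by (simp add: continuous_map_in_subtopology)
    have f01: "0 \<le> f x" "f x \<le> 1" if "x \<in> topspace X" for x
      using f(1) that by (auto simp: continuous_map_def Pi_iff)
    have fM: "f \<in> borel_measurable M" and fN: "f \<in> borel_measurable N"
      using continuous_map_borel_measurable[OF cf]
      by (simp_all add: measurable_cong_sets[OF stM refl] measurable_cong_sets[OF stN refl])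
    have iM: "integrable M f"
      by (rule M.integrable_const_bound[where B = 1]) (use f01 fM in auto)
    have iN: "integrable N f"
      by (rule N.integrable_const_bound[where B = 1]) (use f01 fN in auto)
    have "measure M C = (\<integral>x. indicator C x \<partial>M)"
      using CM sets.sets_into_space[OF CM] by (simp add: Int_absorb2)
    also have "\<dots> \<le> (\<integral>x. f x \<partial>M)"
    proof (rule integral_mono[OF _ iM])
      show "integrable M (indicator C :: _ \<Rightarrow> real)"
        using CM by (simp add: less_top[symmetric])
      show "indicator C x \<le> f x" if "x \<in> space M" for x
        using f(3) f01[of x] that by (auto simp: indicator_def)
    qed
    also have "\<dots> = (\<integral>x. f x \<partial>N)"
      using fun_cong[OF eq, of f] cf by (simp add: measure_functional_def)
    also have "\<dots> \<le> (\<integral>x. indicator U x \<partial>N)"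
    proof (rule integral_mono[OF iN])
      show "integrable N (indicator U :: _ \<Rightarrow> real)"
        using UN by (simp add: less_top[symmetric])
      show "f x \<le> indicator U x" if "x \<in> space N" for x
        using f(2) f01[of x] that by (auto simp: indicator_def)
    qed
    also have "\<dots> = measure N U"
      using UN sets.sets_into_space[OF UN] by (simp add: Int_absorb2)
    finally show ?thesis
      by (simp add: M.emeasure_eq_measure N.emeasure_eq_measure)
  qed
  have "emeasure N C = (INF U\<in>{U. openin X U \<and> C \<subseteq> U}. emeasure N U)"
    using N CN unfolding regular_borel_probability_def by blast
  then show ?thesis using * by (auto intro!: INF_greatest)
qed

lemma inj_on_measure_functional:
  assumes X: "compact_space X" "Hausdorff_space X"
  shows "inj_on (measure_functional X) {M. regular_borel_probability X M}"
proof (rule inj_onI, clarify)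
  fix M N
  assume M: "regular_borel_probability X M" and N: "regular_borel_probability X N"
    and eq: "measure_functional X M = measure_functional X N"
  have C: "emeasure M C = emeasure N C" if "compactin X C" for C
    using measure_functional_eq_imp_le[OF X M N eq that]
      measure_functional_eq_imp_le[OF X N M eq[symmetric] that] by (rule antisym)
  show "M = N"
  proof (rule measure_eqI)
    show st: "sets M = sets N"
      using M N by (simp add: regular_borel_probability_def)
    fix A assume A: "A \<in> sets M"
    have "emeasure M A = (SUP C\<in>{C. compactin X C \<and> C \<subseteq> A}. emeasure M C)"
      using M A unfolding regular_borel_probability_def by blast
    also have "\<dots> = (SUP C\<in>{C. compactin X C \<and> C \<subseteq> A}. emeasure N C)"
      by (intro SUP_cong) (auto simp: C)
    also have "\<dots> = emeasure N A"
    proof (rule sym)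
      have "A \<in> sets N" using A st by simp
      then show "emeasure N A = (SUP C\<in>{C. compactin X C \<and> C \<subseteq> A}. emeasure N C)"
        using N unfolding regular_borel_probability_def by blast
    qed
    finally show "emeasure M A = emeasure N A" .
  qed
qed

lemma flow_continuous_map:
  assumes G: "topological_group G T" and X: "flow G T X \<alpha>" and g: "g \<in> carrier G"
  shows "continuous_map X X (\<alpha> g)"
proof -
  have "continuous_map X (prod_topology T X) (\<lambda>x. (g, x))"
    using G g by (auto simp: topological_group_def intro: continuous_map_pairedI)
  moreover have "continuous_map (prod_topology T X) X (\<lambda>(g, x). \<alpha> g x)"
    using X by (simp add: flow_def)
  ultimately have "continuous_map X X ((\<lambda>(g, x). \<alpha> g x) \<circ> (\<lambda>x. (g, x)))"
    by (rule continuous_map_compose)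
  then show ?thesis by (simp add: o_def)
qed

lemma measure_functional_distr:
  assumes G: "topological_group G T" and X: "flow G T X \<alpha>" and g: "g \<in> carrier G"
    and M: "regular_borel_probability X M"
  shows "measure_functional X (distr M (borel_of X) (\<alpha> g)) =
         push_forward \<alpha> g (measure_functional X M)"
proof
  fix f
  interpret group G using G by (simp add: topological_group_def)
  have c: "continuous_map X X (\<alpha> h)" if "h \<in> carrier G" for h
    by (rule flow_continuous_map[OF G X that])
  have stM: "sets M = sets (borel_of X)"
    using M by (auto simp: regular_borel_probability_def)
  have m: "\<alpha> g \<in> M \<rightarrow>\<^sub>M borel_of X"
    using continuous_map_measurable_borel_of[OF c[OF g]]
    by (simp add: measurable_cong_sets[OF stM refl])
  have gi: "\<alpha> g (\<alpha> (inv\<^bsub>G\<^esub> g) x) = x" if "x \<in> topspace X" for x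
    using X g that unfolding flow_def by (metis inv_closed r_inv)
  have iff: "continuous_map X euclideanreal (\<lambda>x. f (\<alpha> g x)) \<longleftrightarrow> continuous_map X euclideanreal f"
  proof
    assume "continuous_map X euclideanreal (\<lambda>x. f (\<alpha> g x))"
    then have "continuous_map X euclideanreal ((\<lambda>x. f (\<alpha> g x)) \<circ> \<alpha> (inv\<^bsub>G\<^esub> g))"
      using c[of "inv\<^bsub>G\<^esub> g"] g by (intro continuous_map_compose) auto
    then show "continuous_map X euclideanreal f"
      by (rule continuous_map_eq) (simp add: gi)
  next
    assume "continuous_map X euclideanreal f"
    from continuous_map_compose[OF c[OF g] this]
    show "continuous_map X euclideanreal (\<lambda>x. f (\<alpha> g x))" by (simp add: o_def)
  qed
  show "measure_functional X (distr M (borel_of X) (\<alpha> g)) f =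
        push_forward \<alpha> g (measure_functional X M) f"
    using integral_distr[OF m continuous_map_borel_measurable, of f]
    by (auto simp: measure_functional_def push_forward_def iff)
qed

theorem universal_minimal_proximal_factor:
  fixes Y :: "'y topology" and G :: "('g, 'm) monoid_scheme"
  assumes G: "topological_group G T" and univ: "universal_minimal_proximal_flow G T X \<alpha>"
    and min: "minimal_flow G T Y \<beta>" and prox: "proximal_flow G T Y \<beta>"
  shows "\<exists>f. factor_map G X \<alpha> Y \<beta> f"
proof -
  interpret group G using G by (simp add: topological_group_def)
  have flow: "flow G T Y \<beta>" and H: "Hausdorff_space Y"
    using min by (auto simp: minimal_flow_def flow_def)
  then obtain y0 where y0: "y0 \<in> topspace Y" unfolding flow_def by blast
  have dense: "\<exists>g\<in>carrier G. \<beta> g y0 \<in> U" if U: "openin Y U" "U \<noteq> {}" for U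
  proof -
    have "Y closure_of ((\<lambda>g. \<beta> g y0) ` carrier G) = topspace Y"
      using min y0 by (auto simp: minimal_flow_def)
    moreover obtain y where "y \<in> U" "y \<in> topspace Y"
      using U openin_subset[OF U(1)] by auto
    ultimately have "y \<in> Y closure_of ((\<lambda>g. \<beta> g y0) ` carrier G)"
      by simp
    with \<open>y \<in> U\<close> have "\<exists>z. z \<in> (\<lambda>g. \<beta> g y0) ` carrier G \<and> z \<in> U"
      using U(1) unfolding in_closure_of by blast
    then show ?thesis by blast
  qed
  have act: "\<beta> g y \<in> topspace Y" if "g \<in> carrier G" "y \<in> topspace Y" for g y
    using flow_continuous_map[OF G flow that(1)] that(2) by (auto simp: continuous_map_def)
  have act_one: "\<beta> \<one>\<^bsub>G\<^esub> y = y" if "y \<in> topspace Y" for y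
    using flow that unfolding flow_def by blast
  have act_mult: "\<beta> (g \<otimes>\<^bsub>G\<^esub> h) y = \<beta> g (\<beta> h y)"
    if "g \<in> carrier G" "h \<in> carrier G" "y \<in> topspace Y" for g h y
    using flow that unfolding flow_def by blast
  define e :: "'y \<Rightarrow> 'g set set" where
    "e = (\<lambda>y. (\<lambda>U. {g \<in> carrier G. \<beta> g y0 \<in> U}) ` {U. openin Y U \<and> y \<in> U})"
  have inj: "inj_on e (topspace Y)"
  proof (rule inj_onI, rule ccontr)
    fix x y assume xy: "x \<in> topspace Y" "y \<in> topspace Y" "e x = e y" "x \<noteq> y"
    then obtain U V where UV: "openin Y U" "openin Y V" "x \<in> U" "y \<in> V" "disjnt U V"
      by (metis H Hausdorff_space_def)
    have "{g \<in> carrier G. \<beta> g y0 \<in> U} \<in> e x"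
      using UV by (auto simp: e_def)
    then have "{g \<in> carrier G. \<beta> g y0 \<in> U} \<in> e y"
      by (simp only: xy(3))
    then obtain W where W: "openin Y W" "y \<in> W"
      "{g \<in> carrier G. \<beta> g y0 \<in> U} = {g \<in> carrier G. \<beta> g y0 \<in> W}"
      by (auto simp: e_def)
    obtain g where "g \<in> carrier G" "\<beta> g y0 \<in> V \<inter> W"
      using dense[of "V \<inter> W"] W UV by auto
    then show False using W(3) UV(5) by (auto simp: disjnt_def)
  qed
  define d where "d = inv_into (topspace Y) e"
  have de [simp]: "d (e y) = y" if "y \<in> topspace Y" for y
    using inj that by (simp add: d_def)
  define Z where "Z = pullback_topology (e ` topspace Y) d Y"
  have tZ: "topspace Z = e ` topspace Y"
    by (auto simp: Z_def topspace_pullback_topology)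
  have cd: "continuous_map Z Y d"
    unfolding Z_def by (metis continuous_map_id continuous_map_pullback id_comp)
  have ce: "continuous_map Y Z e"
    unfolding Z_def
  proof (rule continuous_map_pullback')
    show "continuous_map Y Y (d \<circ> e)"
      by (rule continuous_map_eq[OF continuous_map_id]) auto
  qed auto
  have ed [simp]: "e (d z) = z" if "z \<in> topspace Z" for z
    using that by (auto simp: tZ)
  have dtop: "d z \<in> topspace Y" if "z \<in> topspace Z" for z
    using that by (auto simp: tZ)
  have hom: "homeomorphic_maps Y Z e d"
    using ce cd by (simp add: homeomorphic_maps_def)
  then have hs: "Y homeomorphic_space Z"
    by (auto simp: homeomorphic_space_def)
  define \<gamma> where "\<gamma> = (\<lambda>g z. e (\<beta> g (d z)))"
  have flowZ: "flow G T Z \<gamma>"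
    unfolding flow_def
  proof (intro conjI ballI)
    show "topspace Z \<noteq> {}" using y0 by (auto simp: tZ)
    show "compact_space Z"
      using flow hs homeomorphic_compact_space by (auto simp: flow_def)
    show "Hausdorff_space Z"
      using H hs homeomorphic_Hausdorff_space by auto
    have "continuous_map (prod_topology T Z) (prod_topology T Y) (\<lambda>(g, z). (g, d z))"
      using cd by (simp add: continuous_map_prod_top)
    moreover have "continuous_map (prod_topology T Y) Y (\<lambda>(g, x). \<beta> g x)"
      using flow by (simp add: flow_def)
    ultimately have "continuous_map (prod_topology T Z) Z (e \<circ> ((\<lambda>(g, x). \<beta> g x) \<circ> (\<lambda>(g, z). (g, d z))))"
      using ce by (intro continuous_map_compose)
    moreover have "e \<circ> ((\<lambda>(g, x). \<beta> g x) \<circ> (\<lambda>(g, z). (g, d z))) = (\<lambda>(g, x). \<gamma> g x)"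
      by (auto simp: fun_eq_iff \<gamma>_def)
    ultimately show "continuous_map (prod_topology T Z) Z (\<lambda>(g, x). \<gamma> g x)"
      by simp
    show "\<gamma> \<one>\<^bsub>G\<^esub> z = z" if "z \<in> topspace Z" for z
      using that dtop[OF that] by (simp add: \<gamma>_def act_one)
    show "\<gamma> (g \<otimes>\<^bsub>G\<^esub> h) z = \<gamma> g (\<gamma> h z)"
      if "g \<in> carrier G" "h \<in> carrier G" "z \<in> topspace Z" for g h z
      using that dtop[OF that(3)] act by (simp add: \<gamma>_def act_mult)
  qed
  have minZ: "minimal_flow G T Z \<gamma>"
    unfolding minimal_flow_def
  proof (intro conjI ballI)
    fix z assume z: "z \<in> topspace Z"
    have "Z closure_of (e ` ((\<lambda>g. \<beta> g (d z)) ` carrier G)) =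
          e ` (Y closure_of ((\<lambda>g. \<beta> g (d z)) ` carrier G))"
      using hom dtop[OF z] act
      by (intro homeomorphic_map_closure_of homeomorphic_maps_imp_map) auto
    also have "\<dots> = topspace Z"
      using min dtop[OF z] by (simp add: minimal_flow_def tZ)
    finally show "Z closure_of ((\<lambda>g. \<gamma> g z) ` carrier G) = topspace Z"
      by (simp add: \<gamma>_def image_image)
  qed (rule flowZ)
  have proxZ: "proximal_flow G T Z \<gamma>"
    unfolding proximal_flow_def
  proof (intro conjI ballI)
    fix x y assume xy: "x \<in> topspace Z" "y \<in> topspace Z"
    then obtain F l where F: "F \<noteq> bot" "F \<le> principal (carrier G)"
      "limitin Y (\<lambda>g. \<beta> g (d x)) l F" "limitin Y (\<lambda>g. \<beta> g (d y)) l F"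
      using prox dtop unfolding proximal_flow_def by meson
    have "limitin Z (e \<circ> (\<lambda>g. \<beta> g (d x))) (e l) F" "limitin Z (e \<circ> (\<lambda>g. \<beta> g (d y))) (e l) F"
      using continuous_map_limit[OF ce F(3)] continuous_map_limit[OF ce F(4)] by auto
    then show "\<exists>F z. F \<noteq> bot \<and> F \<le> principal (carrier G) \<and>
        limitin Z (\<lambda>g. \<gamma> g x) z F \<and> limitin Z (\<lambda>g. \<gamma> g y) z F"
      using F by (auto simp: \<gamma>_def o_def)
  qed (rule flowZ)
  obtain f where f: "factor_map G X \<alpha> Z \<gamma> f"
    using univ minZ proxZ unfolding universal_minimal_proximal_flow_def by blast
  have "factor_map G X \<alpha> Y \<beta> (d \<circ> f)"
    unfolding factor_map_def
  proof (intro conjI ballI)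
    show "continuous_map X Y (d \<circ> f)"
      using f cd by (auto simp: factor_map_def intro: continuous_map_compose)
    have "(d \<circ> f) ` topspace X = d ` topspace Z"
      using f by (metis factor_map_def image_comp)
    also have "\<dots> = topspace Y"
      by (simp add: tZ image_image)
    finally show "(d \<circ> f) ` topspace X = topspace Y" .
    fix g x assume gx: "g \<in> carrier G" "x \<in> topspace X"
    then have "f x \<in> topspace Z" "f (\<alpha> g x) = \<gamma> g (f x)"
      using f by (auto simp: factor_map_def)
    then show "(d \<circ> f) (\<alpha> g x) = \<beta> g ((d \<circ> f) x)"
      using gx act dtop by (simp add: \<gamma>_def)
  qed
  then show ?thesis by blast
qed

end

theory Submission
  imports Defs
begin

text \<open>
Let \<open>X\<close> be the universal minimal proximal flow, \<open>\<phi>\<close> a proximally irreducible extension from \<open>L\<close> to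
the flow of measures on \<open>X\<close>, and \<open>Y\<close> the closure of the set of extreme points of \<open>L\<close>. The extreme
points of the base are the point masses, and they form a copy of \<open>X\<close>. The theorem holds because \<open>Y\<close>
turns out to be a minimal proximal flow that lies over this copy; universality of \<open>X\<close> then forces
\<open>Y\<close> to be a copy of \<open>X\<close> as well, and the points of \<open>L\<close>, being barycentres of measures on \<open>Y\<close>, are
determined by their images.

In detail, let \<open>a\<close> and \<open>b\<close> be points of \<open>Y\<close> over the same point mass. As \<open>X\<close> is minimal, the closure
of the orbit of \<open>(a, b)\<close> contains, over every point of \<open>X\<close>, a pair in \<open>Y \<times> Y\<close> with both components
over that point. So the closed convex hull of the orbit of the midpoint of \<open>a\<close> and \<open>b\<close> meets all the
sets named in the definition of irreducibility, and it is \<open>L\<close> (\<open>L_generated_by_midpoint\<close>). By Milman's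
theorem every extreme point \<open>e\<close> of \<open>L\<close> is a limit of translates of this midpoint. A midpoint is
extreme only if its end points coincide with it, so \<open>a\<close> and \<open>b\<close> are moved simultaneously to \<open>e\<close>
(\<open>extreme_in_pair_orbit_closure\<close>). For \<open>a = b\<close> this makes \<open>Y\<close> minimal; for two points, together with
proximality of \<open>X\<close>, it makes \<open>Y\<close> proximal.

By universality there is a factor map \<open>f\<close> from \<open>X\<close> to \<open>Y\<close>. Its composition with \<open>\<phi>\<close> is an
endomorphism of the minimal proximal flow \<open>X\<close>, hence the identity (\<open>factor_is_section\<close>). With a
partition of unity on \<open>X\<close>, each \<open>l\<close> in \<open>L\<close> is approximated by combinations of values of \<open>f\<close> with
coefficients computed from \<open>\<phi> l\<close> alone (\<open>barycenter_approximation\<close>); so \<open>\<phi>\<close> is injective, and by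
compactness it is an isomorphism.

Three pieces of general theory are developed for this. Existence of extreme points and Milman's
theorem are proved for compact convex sets in locally convex spaces, by means of Minkowski gauges.
The Riesz--Markov theorem identifies the measures with the states, that is the normalised positive
linear functionals (\<open>probability_measures_eq_states\<close>); it gives compactness of the space of measures
and so the flow structure (\<open>affine_flow_states\<close>). Finally, extreme states are shown to be point masses
by way of their multiplicativity (\<open>extreme_imp_dirac\<close>).
\<close>

section \<open>Extreme points in compact convex sets\<close>

lemma continuous_on_scaleR_lctvs [continuous_intros]:
  fixes g :: "'b::topological_space \<Rightarrow> 'a::hausdorff_lctvs"
  assumes "continuous_on S f" "continuous_on S g"
  shows "continuous_on S (\<lambda>x. f x *\<^sub>R g x)"
  unfolding continuous_on_def
proof
  fix x assume "x \<in> S"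
  then have "(f \<longlongrightarrow> f x) (at x within S)" "(g \<longlongrightarrow> g x) (at x within S)"
    using assms by (auto simp: continuous_on_def)
  from filterlim_compose[OF tendsto_scaleR_Pair filterlim_Pair[OF this]]
  show "((\<lambda>x. f x *\<^sub>R g x) \<longlongrightarrow> f x *\<^sub>R g x) (at x within S)"
    by simp
qed

lemma convex_closure_lctvs:
  fixes S :: "'a::hausdorff_lctvs set"
  assumes "convex S"
  shows "convex (closure S)"
proof (rule convexI)
  fix x y and u v :: real
  assume xy: "x \<in> closure S" "y \<in> closure S" and uv: "0 \<le> u" "0 \<le> v" "u + v = 1"
  have "(\<lambda>p. u *\<^sub>R fst p + v *\<^sub>R snd p) ` closure (S \<times> S) \<subseteq> closure S"
  proof (rule image_closure_subset)
    show "continuous_on (closure (S \<times> S)) (\<lambda>p. u *\<^sub>R fst p + v *\<^sub>R snd p)"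
      by (intro continuous_intros)
    show "(\<lambda>p. u *\<^sub>R fst p + v *\<^sub>R snd p) ` (S \<times> S) \<subseteq> closure S"
    proof clarify
      fix a b assume "a \<in> S" "b \<in> S"
      then have "u *\<^sub>R a + v *\<^sub>R b \<in> S"
        using assms uv by (intro convexD)
      then show "u *\<^sub>R fst (a, b) + v *\<^sub>R snd (a, b) \<in> closure S"
        by (simp add: closure_subset[THEN subsetD])
    qed
  qed simp
  moreover have "(x, y) \<in> closure (S \<times> S)"
    using xy by (simp add: closure_Times)
  ultimately have "u *\<^sub>R fst (x, y) + v *\<^sub>R snd (x, y) \<in> closure S"
    by blast
  then show "u *\<^sub>R x + v *\<^sub>R y \<in> closure S" by simp
qed

text \<open>The closed convex neighbourhoods of \<open>0\<close> separate points, in the form in which injectivity of a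
map is read off from approximations: two points that agree with a common third one up to
\<open>closure W\<close>, for every such \<open>W\<close>, are equal.\<close>

lemma separating_neighbourhood:
  fixes d :: "'a::hausdorff_lctvs"
  assumes "d \<noteq> 0"
  shows "\<exists>W. open W \<and> convex W \<and> 0 \<in> W \<and> (\<forall>w\<in>closure W. \<forall>w'\<in>closure W. w - w' \<noteq> d)"
proof -
  obtain A B where AB: "open A" "open B" "0 \<in> A" "d \<in> B" "A \<inter> B = {}"
    using hausdorff[OF assms] by (metis inf_commute)
  have dA: "d \<notin> closure A"
    using AB unfolding closure_iff_nhds_not_empty by blast
  have "open ((\<lambda>p::'a \<times> 'a. fst p - snd p) -` A)"
    by (intro open_vimage AB continuous_intros)
  moreover have "(0, 0) \<in> (\<lambda>p::'a \<times> 'a. fst p - snd p) -` A" using AB by simp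
  ultimately obtain A1 A2 where A: "open A1" "open A2" "(0, 0) \<in> A1 \<times> A2"
      "A1 \<times> A2 \<subseteq> (\<lambda>p::'a \<times> 'a. fst p - snd p) -` A"
    by (rule open_prod_elim)
  then obtain W where W: "open W" "convex W" "0 \<in> W" "W \<subseteq> A1 \<inter> A2"
    using locally_convex_nhd[of "A1 \<inter> A2" 0] by auto
  have "(\<lambda>p::'a \<times> 'a. fst p - snd p) ` closure (W \<times> W) \<subseteq> closure A"
  proof (rule image_closure_subset)
    show "(\<lambda>p::'a \<times> 'a. fst p - snd p) ` (W \<times> W) \<subseteq> closure A"
      using W(4) A(4) closure_subset[of A] by blast
  qed (auto intro!: continuous_intros)
  then have "w - w' \<in> closure A" if "w \<in> closure W" "w' \<in> closure W" for w w'
    using that by (force simp: closure_Times)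
  then show ?thesis using W dA by blast
qed

text \<open>The midpoint is taken as a function of the pair, so that it can be applied to orbit closures in the
product.\<close>

definition pair_midpoint :: "'a::hausdorff_lctvs \<times> 'a \<Rightarrow> 'a" where
  "pair_midpoint p = (1 / 2) *\<^sub>R fst p + (1 / 2) *\<^sub>R snd p"

lemma continuous_on_pair_midpoint: "continuous_on S pair_midpoint"
  unfolding pair_midpoint_def by (intro continuous_intros)

lemma pair_midpoint_in: "convex C \<Longrightarrow> a \<in> C \<Longrightarrow> b \<in> C \<Longrightarrow> pair_midpoint (a, b) \<in> C"
  unfolding pair_midpoint_def fst_conv snd_conv by (rule convexD) auto

text \<open>Gauges of convex neighbourhoods of \<open>0\<close> are continuous and convex, and they separate points. These
three properties replace the continuous linear functionals in the existence proof for extreme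
points below.\<close>

definition minkowski_gauge :: "'a::real_vector set \<Rightarrow> 'a \<Rightarrow> real" where
  "minkowski_gauge W x = Inf {t. 0 < t \<and> (1 / t) *\<^sub>R x \<in> W}"

context
  fixes W :: "'a::hausdorff_lctvs set"
  assumes W: "open W" "convex W" "0 \<in> W"
begin

lemma gauge_absorbing: "\<exists>t>0. (1 / t) *\<^sub>R x \<in> W"
proof -
  have "open ((\<lambda>r::real. r *\<^sub>R x) -` W)"
    by (rule open_vimage[OF W(1)]) (intro continuous_intros)
  moreover have "0 \<in> (\<lambda>r::real. r *\<^sub>R x) -` W"
    using W by simp
  ultimately obtain e where e: "e > 0" "ball 0 e \<subseteq> (\<lambda>r::real. r *\<^sub>R x) -` W"
    by (meson openE)
  then have "(e / 2) *\<^sub>R x \<in> W"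
    by (auto simp: subset_iff)
  then show ?thesis
    using e by (intro exI[of _ "2 / e"]) auto
qed

lemma gauge_bdd: "bdd_below {t. 0 < t \<and> (1 / t) *\<^sub>R x \<in> W}"
  by (rule bdd_belowI[of _ 0]) auto

lemma gauge_nonneg: "0 \<le> minkowski_gauge W x"
  unfolding minkowski_gauge_def using gauge_absorbing by (intro cInf_greatest) auto

lemma gauge_less_iff: "minkowski_gauge W x < c \<longleftrightarrow> (\<exists>t. 0 < t \<and> t < c \<and> (1 / t) *\<^sub>R x \<in> W)"
  unfolding minkowski_gauge_def using gauge_absorbing[of x]
  by (subst cInf_less_iff[OF _ gauge_bdd]) auto

lemma gauge_zero: "minkowski_gauge W 0 = 0"
proof (rule antisym[OF _ gauge_nonneg], rule field_le_epsilon)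
  fix e :: real assume "0 < e"
  then have "minkowski_gauge W 0 < e"
    unfolding gauge_less_iff by (intro exI[of _ "e / 2"]) (use W in auto)
  then show "minkowski_gauge W 0 \<le> 0 + e" by simp
qed

lemma gauge_ge_1: assumes "x \<notin> W" shows "1 \<le> minkowski_gauge W x"
proof (rule ccontr)
  assume "\<not> 1 \<le> minkowski_gauge W x"
  then obtain t where t: "0 < t" "t < 1" "(1 / t) *\<^sub>R x \<in> W"
    using gauge_less_iff[of x 1] by auto
  have "t *\<^sub>R ((1 / t) *\<^sub>R x) + (1 - t) *\<^sub>R 0 \<in> W"
    using t W by (intro convexD) auto
  then show False using t assms by simp
qed

lemma gauge_scaleR: assumes "0 < s" shows "minkowski_gauge W (s *\<^sub>R x) = s * minkowski_gauge W x"
proof -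
  have le: "minkowski_gauge W (s *\<^sub>R x) \<le> s * minkowski_gauge W x" if s: "0 < s" for s x
  proof (rule ccontr)
    assume "\<not> ?thesis"
    then have "minkowski_gauge W x < minkowski_gauge W (s *\<^sub>R x) / s"
      using s by (simp add: field_simps)
    then obtain t where t: "0 < t" "t < minkowski_gauge W (s *\<^sub>R x) / s" "(1 / t) *\<^sub>R x \<in> W"
      unfolding gauge_less_iff by blast
    then have "minkowski_gauge W (s *\<^sub>R x) < minkowski_gauge W (s *\<^sub>R x)"
      unfolding gauge_less_iff[of "s *\<^sub>R x"]
      using s by (intro exI[of _ "s * t"]) (auto simp: field_simps)
    then show False by simp
  qed
  have "minkowski_gauge W ((1 / s) *\<^sub>R (s *\<^sub>R x)) \<le> (1 / s) * minkowski_gauge W (s *\<^sub>R x)"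
    using assms by (intro le) auto
  then have "s * minkowski_gauge W x \<le> minkowski_gauge W (s *\<^sub>R x)"
    using assms by (simp add: field_simps)
  with le[OF assms, of x] show ?thesis by simp
qed

lemma gauge_add: "minkowski_gauge W (x + y) \<le> minkowski_gauge W x + minkowski_gauge W y"
proof (rule field_le_epsilon)
  fix e :: real assume e: "0 < e"
  obtain s where s: "0 < s" "s < minkowski_gauge W x + e / 2" "(1 / s) *\<^sub>R x \<in> W"
    using gauge_less_iff[of x "minkowski_gauge W x + e / 2"] e by auto
  obtain t where t: "0 < t" "t < minkowski_gauge W y + e / 2" "(1 / t) *\<^sub>R y \<in> W"
    using gauge_less_iff[of y "minkowski_gauge W y + e / 2"] e by auto
  have "(s / (s + t)) *\<^sub>R ((1 / s) *\<^sub>R x) + (t / (s + t)) *\<^sub>R ((1 / t) *\<^sub>R y) \<in> W"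
    using s t W by (intro convexD) (auto simp: add_divide_distrib[symmetric])
  moreover have "(s / (s + t)) *\<^sub>R ((1 / s) *\<^sub>R x) + (t / (s + t)) *\<^sub>R ((1 / t) *\<^sub>R y) =
      (1 / (s + t)) *\<^sub>R (x + y)"
    using s t by (simp add: scaleR_add_right)
  ultimately have "minkowski_gauge W (x + y) < minkowski_gauge W x + minkowski_gauge W y + e"
    unfolding gauge_less_iff[of "x + y"] using s t by (intro exI[of _ "s + t"]) auto
  then show "minkowski_gauge W (x + y) \<le> minkowski_gauge W x + minkowski_gauge W y + e" by simp
qed

lemma open_gauge_less: "open {x. minkowski_gauge W x < c}"
proof -
  have "{x. minkowski_gauge W x < c} = (\<Union>t\<in>{0<..<c}. (\<lambda>x. (1 / t) *\<^sub>R x) -` W)"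
    by (auto simp: gauge_less_iff)
  also have "open \<dots>"
    by (intro open_UN ballI open_vimage[OF W(1)] continuous_intros)
  finally show ?thesis .
qed

lemma continuous_on_gauge: "continuous_on S (minkowski_gauge W)"
proof (rule continuous_on_subset[OF _ subset_UNIV], unfold continuous_on_def, safe)
  fix a
  show "(minkowski_gauge W \<longlongrightarrow> minkowski_gauge W a) (at a)"
  proof (rule tendstoI)
    fix e :: real assume e: "0 < e"
    define N where "N = (\<lambda>x. x - a) -` {x. minkowski_gauge W x < e} \<inter> (\<lambda>x. a - x) -` {x. minkowski_gauge W x < e}"
    have "open N"
      unfolding N_def by (intro open_Int open_vimage[OF open_gauge_less] continuous_intros)
    moreover have "a \<in> N"
      using e by (simp add: N_def gauge_zero)
    moreover have "dist (minkowski_gauge W x) (minkowski_gauge W a) < e" if "x \<in> N" for x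
      using gauge_add[of "x - a" a] gauge_add[of "a - x" x] that
      by (auto simp: N_def dist_real_def)
    ultimately show "\<forall>\<^sub>F x in at a. dist (minkowski_gauge W x) (minkowski_gauge W a) < e"
      unfolding eventually_at_topological by blast
  qed
qed

lemma gauge_convex:
  assumes "0 < u" "u < 1"
  shows "minkowski_gauge W ((1 - u) *\<^sub>R x + u *\<^sub>R y - b) \<le> (1 - u) * minkowski_gauge W (x - b) + u * minkowski_gauge W (y - b)"
proof -
  have "(1 - u) *\<^sub>R x + u *\<^sub>R y - b = (1 - u) *\<^sub>R (x - b) + u *\<^sub>R (y - b)"
    by (simp add: algebra_simps)
  then show ?thesis
    using gauge_add[of "(1 - u) *\<^sub>R (x - b)" "u *\<^sub>R (y - b)"] assms by (simp add: gauge_scaleR)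
qed

end

text \<open>An extremal subset satisfies the defining condition of a face except that it may fail to be convex.
Dropping convexity is what permits the maximum set of a convex function, and not only of an affine
one, to be used for making an extremal set smaller.\<close>

definition extremal_subset :: "'a::real_vector set \<Rightarrow> 'a set \<Rightarrow> bool" where
  "extremal_subset A S \<longleftrightarrow>
     A \<subseteq> S \<and> (\<forall>x\<in>S. \<forall>y\<in>S. \<forall>z\<in>A. z \<in> open_segment x y \<longrightarrow> x \<in> A \<and> y \<in> A)"

text \<open>If a maximum point of \<open>h\<close> on \<open>A\<close> lies inside a segment, extremality puts the end points into \<open>A\<close>,
and by convexity of \<open>h\<close> neither of them can have a smaller value than the maximum.\<close>

lemma extremal_subset_argmax:
  fixes h :: "'a::real_vector \<Rightarrow> real"
  assumes A: "extremal_subset A S"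
    and h: "\<And>x y u. 0 < u \<Longrightarrow> u < 1 \<Longrightarrow> h ((1 - u) *\<^sub>R x + u *\<^sub>R y) \<le> (1 - u) * h x + u * h y"
    and m: "\<And>x. x \<in> A \<Longrightarrow> h x \<le> m"
  shows "extremal_subset {x \<in> A. h x = m} S"
  unfolding extremal_subset_def
proof (intro conjI ballI impI)
  show "{x \<in> A. h x = m} \<subseteq> S"
    using A by (auto simp: extremal_subset_def)
next
  fix x y z
  assume xy: "x \<in> S" "y \<in> S" and z: "z \<in> {x \<in> A. h x = m}"
    and seg: "z \<in> open_segment x y"
  have xyA: "x \<in> A" "y \<in> A"
    using A xy z seg unfolding extremal_subset_def by blast+
  obtain u where u: "0 < u" "u < 1" "z = (1 - u) *\<^sub>R x + u *\<^sub>R y"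
    using seg by (auto simp: in_segment)
  have *: "m \<le> (1 - u) * h x + u * h y"
    using h[OF u(1,2), of x y] z u(3) by simp
  have x: "(1 - u) * h x \<le> (1 - u) * m" and y: "u * h y \<le> u * m"
    using m[OF xyA(1)] m[OF xyA(2)] u by (auto intro: mult_left_mono)
  have "(1 - u) * m + u * m = m" by (simp add: algebra_simps)
  with * x y have "(1 - u) * h x = (1 - u) * m" "u * h y = u * m"
    by linarith+
  then have "h x = m" "h y = m" using u by auto
  then show "x \<in> {x \<in> A. h x = m}" "y \<in> {x \<in> A. h x = m}"
    using xyA by auto
qed

text \<open>This contains the existence part of the Krein--Milman theorem (for \<open>A = S\<close>). By compactness and
Zorn's lemma there is a minimal closed nonempty extremal set \<open>B\<close> inside \<open>A\<close>. If \<open>B\<close> had two points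
\<open>a\<close> and \<open>b\<close>, a gauge \<open>p\<close> with \<open>p (a - b) \<ge> 1\<close> would be nonconstant on \<open>B\<close> after translation by
\<open>b\<close>, and its maximum set would be a smaller extremal set.\<close>

theorem extremal_subset_contains_extreme_point:
  fixes A :: "'a::hausdorff_lctvs set"
  assumes A: "extremal_subset A S" "compact A" "A \<noteq> {}"
  shows "\<exists>e\<in>A. e extreme_point_of S"
proof -
  define \<F> where "\<F> = {B. extremal_subset B S \<and> closed B \<and> B \<subseteq> A \<and> B \<noteq> {}}"
  have AF: "A \<in> \<F>"
    using A by (simp add: \<F>_def compact_imp_closed)
  have "\<exists>M\<in>uminus ` \<F>. \<forall>X\<in>uminus ` \<F>. M \<subseteq> X \<longrightarrow> X = M"
  proof (rule subset_Zorn_nonempty)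
    show "uminus ` \<F> \<noteq> {}" using AF by auto
    fix \<C> assume C: "\<C> \<noteq> {}" "subset.chain (uminus ` \<F>) \<C>"
    define \<D> where "\<D> = uminus ` \<C>"
    have DF: "\<D> \<subseteq> \<F>" and D: "\<D> \<noteq> {}"
      using C by (auto simp: \<D>_def subset_chain_def)
    have chain: "B \<subseteq> B' \<or> B' \<subseteq> B" if "B \<in> \<D>" "B' \<in> \<D>" for B B'
    proof -
      have "- B \<in> \<C>" "- B' \<in> \<C>" using that by (auto simp: \<D>_def)
      then have "- B \<subseteq> - B' \<or> - B' \<subseteq> - B" using C(2) unfolding subset_chain_def by blast
      then show ?thesis by auto
    qed
    have min: "\<exists>B\<in>\<E>. B \<subseteq> \<Inter>\<E>" if "finite \<E>" "\<E> \<noteq> {}" "\<E> \<subseteq> \<D>" for \<E>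
      using that
    proof (induction rule: finite_ne_induct)
      case (insert B \<E>)
      then obtain B' where "B' \<in> \<E>" "B' \<subseteq> \<Inter>\<E>" by auto
      then show ?case using chain[of B B'] insert.prems by auto
    qed auto
    have "A \<inter> \<Inter>\<D> \<noteq> {}"
    proof (rule compact_imp_fip[OF A(2)])
      fix \<E> assume E: "finite \<E>" "\<E> \<subseteq> \<D>"
      show "A \<inter> \<Inter>\<E> \<noteq> {}"
      proof (cases "\<E> = {}")
        case False
        then obtain B where "B \<in> \<E>" "B \<subseteq> \<Inter>\<E>" using min E by blast
        moreover from this have "B \<noteq> {}" "B \<subseteq> A" using E DF by (auto simp: \<F>_def)
        ultimately show ?thesis by blast
      qed (use A in auto)
    qed (use DF in \<open>auto simp: \<F>_def\<close>)
    moreover have "extremal_subset (\<Inter>\<D>) S"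
      unfolding extremal_subset_def
    proof (intro conjI ballI impI)
      obtain B where "B \<in> \<D>" using D by blast
      then show "\<Inter>\<D> \<subseteq> S" using DF unfolding \<F>_def extremal_subset_def by blast
      fix x y z assume "x \<in> S" "y \<in> S" "z \<in> \<Inter>\<D>" "z \<in> open_segment x y"
      then have "x \<in> B \<and> y \<in> B" if "B \<in> \<D>" for B
        using that DF unfolding \<F>_def extremal_subset_def by blast
      then show "x \<in> \<Inter>\<D>" "y \<in> \<Inter>\<D>" by auto
    qed
    moreover have "closed (\<Inter>\<D>)" using DF by (auto simp: \<F>_def)
    moreover have "\<Inter>\<D> \<subseteq> A" using D DF by (auto simp: \<F>_def)
    ultimately have "\<Inter>\<D> \<in> \<F>" by (auto simp: \<F>_def)
    moreover have "\<Union>\<C> = - \<Inter>\<D>" by (auto simp: \<D>_def)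
    ultimately show "\<Union>\<C> \<in> uminus ` \<F>" by blast
  qed
  then obtain B where B: "B \<in> \<F>" and Bmin: "\<And>B'. B' \<in> \<F> \<Longrightarrow> B' \<subseteq> B \<Longrightarrow> B' = B"
    by auto
  have cB: "compact B"
    using B closed_Int_compact[of B A] A(2) by (simp add: \<F>_def Int_absorb2)
  have uniq: "a = b" if ab: "a \<in> B" "b \<in> B" for a b
  proof (rule ccontr)
    assume "a \<noteq> b"
    then obtain U where U: "open U" "0 \<in> U" "a - b \<notin> U"
      using t1_space[of 0 "a - b"] by auto
    then obtain W where W: "open W" "convex W" "0 \<in> W" "W \<subseteq> U"
      using locally_convex_nhd by metis
    have "continuous_on B (\<lambda>x. minkowski_gauge W (x - b))"
      by (rule continuous_on_compose2[OF continuous_on_gauge[OF W(1-3), of UNIV]])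
        (auto intro!: continuous_intros)
    then obtain c where c: "c \<in> B" "\<And>x. x \<in> B \<Longrightarrow> minkowski_gauge W (x - b) \<le> minkowski_gauge W (c - b)"
      using continuous_attains_sup[OF cB] ab by blast
    define B' where "B' = {x \<in> B. minkowski_gauge W (x - b) = minkowski_gauge W (c - b)}"
    have "extremal_subset B' S"
      unfolding B'_def using B c(2) gauge_convex[OF W(1-3)]
      by (intro extremal_subset_argmax) (auto simp: \<F>_def)
    moreover have "closed B'"
      unfolding B'_def using B \<open>continuous_on B (\<lambda>x. minkowski_gauge W (x - b))\<close>
      by (intro continuous_closed_preimage_constant) (auto simp: \<F>_def)
    ultimately have "B' \<in> \<F>"
      using B c(1) by (auto simp: \<F>_def B'_def)
    then have "B' = B" by (rule Bmin) (auto simp: B'_def)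
    then have "b \<in> B'" using ab(2) by simp
    then have "minkowski_gauge W (c - b) = 0"
      using gauge_zero[OF W(1-3)] by (simp add: B'_def)
    moreover have "1 \<le> minkowski_gauge W (a - b)"
      using U W by (intro gauge_ge_1) auto
    ultimately show False using c(2)[OF ab(1)] by simp
  qed
  obtain e where e: "e \<in> B" using B by (auto simp: \<F>_def)
  have "e extreme_point_of S"
    unfolding extreme_point_of_def
  proof (intro conjI ballI notI)
    show "e \<in> S" using e B by (auto simp: \<F>_def extremal_subset_def)
    fix x y assume "x \<in> S" "y \<in> S" "e \<in> open_segment x y"
    then have "x \<in> B" "y \<in> B" using e B unfolding \<F>_def extremal_subset_def by blast+
    then have "x = y" by (rule uniq)
    then show False using \<open>e \<in> open_segment x y\<close> by simp
  qed
  moreover have "e \<in> A" using e B by (auto simp: \<F>_def)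
  ultimately show ?thesis by blast
qed

text \<open>The hull of two compact convex sets \<open>C\<close> and \<open>K\<close> is the continuous image of \<open>[0,1] \<times> C \<times> K\<close>, hence
compact, and a point of it that is extreme in the larger set \<open>L\<close> cannot be a proper convex
combination, so it was in \<open>C\<close> or \<open>K\<close> already.\<close>

lemma compact_convex_hull_finite_Union:
  fixes \<K> :: "'a::hausdorff_lctvs set set"
  assumes "finite \<K>" "convex L" "\<And>K. K \<in> \<K> \<Longrightarrow> compact K \<and> convex K \<and> K \<subseteq> L"
  shows "\<exists>C. compact C \<and> convex C \<and> \<Union>\<K> \<subseteq> C \<and>
             (\<forall>e. e extreme_point_of L \<and> e \<in> C \<longrightarrow> e \<in> \<Union>\<K>) \<and> C \<subseteq> L"
  using assms(1,3)
proof (induction rule: finite_induct)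
  case empty
  then show ?case by auto
next
  case (insert K \<K>)
  then obtain C where C: "compact C" "convex C" "\<Union>\<K> \<subseteq> C" "C \<subseteq> L"
      "\<And>e. e extreme_point_of L \<Longrightarrow> e \<in> C \<Longrightarrow> e \<in> \<Union>\<K>"
    by (smt (verit) insert_iff)
  have K: "compact K" "convex K" "K \<subseteq> L" using insert.prems by auto
  show ?case
  proof (cases "C = {} \<or> K = {}")
    case True
    then show ?thesis
    proof
      assume "C = {}" then show ?thesis using C K by (intro exI[of _ K]) auto
    next
      assume "K = {}" then show ?thesis using C by (intro exI[of _ C]) auto
    qed
  next
    case False
    define h where "h = (\<lambda>(t::real, x, y::'a). (1 - t) *\<^sub>R x + t *\<^sub>R y)"
    have hull: "convex hull (C \<union> K) = h ` ({0..1} \<times> C \<times> K)"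
    proof
      show "h ` ({0..1} \<times> C \<times> K) \<subseteq> convex hull (C \<union> K)"
      proof clarify
        fix t x y assume "t \<in> {0..1::real}" "x \<in> C" "y \<in> K"
        then show "h (t, x, y) \<in> convex hull (C \<union> K)"
          unfolding h_def split by (intro convexD[OF convex_convex_hull] hull_inc) auto
      qed
      define S where "S = (\<lambda>b. if b then K else C)"
      have "convex hull (\<Union>(S ` UNIV)) =
          {sum (\<lambda>i. c i *\<^sub>R s i) UNIV | c s. (\<forall>i\<in>UNIV. c i \<ge> 0) \<and> sum c UNIV = 1 \<and> (\<forall>i\<in>UNIV. s i \<in> S i)}"
        using C K False by (intro convex_hull_finite_union) (auto simp: S_def)
      moreover have "\<Union>(S ` UNIV) = C \<union> K"
        by (auto simp: S_def UNIV_bool)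
      moreover have "(\<Sum>i\<in>UNIV. c i *\<^sub>R s i) \<in> h ` ({0..1} \<times> C \<times> K)"
        if c: "\<forall>i\<in>UNIV. (c i :: real) \<ge> 0" "sum c UNIV = 1" "\<forall>i\<in>UNIV. s i \<in> S i" for c s
      proof
        have c': "0 \<le> c True" "0 \<le> c False" "c False = 1 - c True"
          using c(1,2) by (auto simp: UNIV_bool)
        then show "(\<Sum>i\<in>UNIV. c i *\<^sub>R s i) = h (c True, s False, s True)"
          by (simp add: h_def UNIV_bool)
        have "s False \<in> C" "s True \<in> K"
          using c(3)[rule_format, of False] c(3)[rule_format, of True] by (simp_all add: S_def)
        then show "(c True, s False, s True) \<in> {0..1} \<times> C \<times> K"
          using c' by simp
      qed
      ultimately show "convex hull (C \<union> K) \<subseteq> h ` ({0..1} \<times> C \<times> K)"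
        by auto
    qed
    have "continuous_on ({0..1} \<times> C \<times> K) h"
      unfolding h_def case_prod_unfold by (intro continuous_intros)
    then have "compact (convex hull (C \<union> K))"
      unfolding hull using C K by (intro compact_continuous_image compact_Times) auto
    moreover have "convex hull (C \<union> K) \<subseteq> L"
      using C K assms by (intro hull_minimal) auto
    moreover have "e \<in> \<Union>(insert K \<K>)" if e: "e extreme_point_of L" "e \<in> convex hull (C \<union> K)" for e
    proof -
      obtain t x y where t: "0 \<le> t" "t \<le> 1" "x \<in> C" "y \<in> K" "e = (1 - t) *\<^sub>R x + t *\<^sub>R y"
        using e(2) unfolding hull h_def by auto
      have "e \<notin> open_segment x y"
        using e(1) t(3,4) C(4) K(3) unfolding extreme_point_of_def by blast
      then have "t = 0 \<or> t = 1 \<or> x = y"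
        using t(1,2,5) unfolding in_segment by (metis less_eq_real_def)
      then have "e = x \<or> e = y"
        unfolding t(5) by (auto simp: scaleR_add_left[symmetric])
      then show ?thesis using C(5)[OF e(1)] t by auto
    qed
    moreover have "\<Union>(insert K \<K>) \<subseteq> convex hull (C \<union> K)"
      using C(3) hull_subset[of "C \<union> K" convex] by auto
    ultimately show ?thesis
      by (intro exI[of _ "convex hull (C \<union> K)"]) auto
  qed
qed

text \<open>Milman's partial converse of the Krein--Milman theorem. If \<open>e\<close> is not in \<open>M\<close>, then \<open>M\<close> is covered by
finitely many convex open sets whose closures miss \<open>e\<close>. The closed hulls of the corresponding pieces
of \<open>M\<close> are compact and together generate \<open>L\<close>, so the extreme point \<open>e\<close> lies in one of them, which
is impossible.\<close>

theorem extreme_points_of_closed_hull_in_compact: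
  fixes M :: "'a::hausdorff_lctvs set"
  assumes M: "compact M" and L: "compact L" "L = closure (convex hull M)"
    and e: "e extreme_point_of L"
  shows "e \<in> M"
proof (rule ccontr)
  assume eM: "e \<notin> M"
  have "\<forall>y\<in>M. \<exists>N. open N \<and> convex N \<and> y \<in> N \<and> e \<notin> closure N"
  proof
    fix y assume "y \<in> M"
    then have "y \<noteq> e" using eM by auto
    then obtain U V where UV: "open U" "open V" "y \<in> U" "e \<in> V" "U \<inter> V = {}"
      by (meson hausdorff)
    then obtain N where N: "open N" "convex N" "y \<in> N" "N \<subseteq> U"
      using locally_convex_nhd by metis
    have "e \<notin> closure N"
      using UV N unfolding closure_iff_nhds_not_empty by blast
    then show "\<exists>N. open N \<and> convex N \<and> y \<in> N \<and> e \<notin> closure N"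
      using N by blast
  qed
  then obtain N where N: "\<And>y. y \<in> M \<Longrightarrow> open (N y) \<and> convex (N y) \<and> y \<in> N y \<and> e \<notin> closure (N y)"
    by metis
  then obtain F where F: "F \<subseteq> M" "finite F" "M \<subseteq> (\<Union>y\<in>F. N y)"
    using compactE_image[OF M, of M N] by (metis UN_I subsetI)
  define K where "K = (\<lambda>y. closure (convex hull (M \<inter> N y)))"
  have KL: "K y \<subseteq> L" for y
    unfolding K_def L(2) by (intro closure_mono hull_mono) auto
  have cL: "convex L"
    unfolding L(2) by (intro convex_closure_lctvs convex_convex_hull)
  have "compact (K y)" for y
    using closed_Int_compact[of "K y" L] KL[of y] L(1) by (simp add: K_def Int_absorb2)
  moreover have "convex (K y)" for y
    unfolding K_def by (intro convex_closure_lctvs convex_convex_hull)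
  ultimately have "\<exists>C. compact C \<and> convex C \<and> \<Union>(K ` F) \<subseteq> C \<and>
             (\<forall>e. e extreme_point_of L \<and> e \<in> C \<longrightarrow> e \<in> \<Union>(K ` F)) \<and> C \<subseteq> L"
    using F(2) cL KL by (intro compact_convex_hull_finite_Union) auto
  then obtain C where C: "compact C" "convex C" "\<Union>(K ` F) \<subseteq> C" "C \<subseteq> L"
     "\<And>e. e extreme_point_of L \<Longrightarrow> e \<in> C \<Longrightarrow> e \<in> \<Union>(K ` F)"
    by metis
  have "M \<subseteq> \<Union>(K ` F)"
  proof
    fix x assume "x \<in> M"
    then obtain y where "y \<in> F" "x \<in> N y" using F by auto
    moreover have "x \<in> K y"
      unfolding K_def using \<open>x \<in> M\<close> \<open>x \<in> N y\<close> by (intro closure_subset[THEN subsetD] hull_inc) auto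
    ultimately show "x \<in> \<Union>(K ` F)" by auto
  qed
  then have "L \<subseteq> C"
    unfolding L(2) using C by (intro closure_minimal hull_minimal compact_imp_closed) auto
  moreover have "e \<in> L" using e by (simp add: extreme_point_of_def)
  ultimately obtain y where y: "y \<in> F" "e \<in> K y"
    using C(5)[OF e] by auto
  have "K y \<subseteq> closure (N y)"
    unfolding K_def using N y F by (intro closure_mono hull_minimal) auto
  then show False using y N F by auto
qed

section \<open>Partitions of unity on compact Hausdorff spaces\<close>

abbreviation cts :: "'x topology \<Rightarrow> ('x \<Rightarrow> real) \<Rightarrow> bool" where
  "cts X f \<equiv> continuous_map X euclideanreal f"

lemma bounded_cts:
  assumes "compact_space X" "cts X f"
  shows "\<exists>c>0. \<forall>x\<in>topspace X. \<bar>f x\<bar> \<le> c"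
proof -
  have "compactin euclideanreal (f ` topspace X)"
    using assms image_compactin by (metis compact_space_def)
  then have "bounded (f ` topspace X)"
    by (auto intro: compact_imp_bounded)
  then show ?thesis by (auto simp: bounded_pos)
qed

lemma Urysohn_point:
  assumes "compact_space X" "Hausdorff_space X" "openin X U" "x \<in> U"
  shows "\<exists>f. cts X f \<and> (\<forall>y\<in>topspace X. 0 \<le> f y \<and> f y \<le> 1) \<and> f x = 1 \<and> (\<forall>y\<in>topspace X - U. f y = 0)"
proof -
  have x: "x \<in> topspace X" using assms openin_subset by blast
  have "normal_space X"
    using assms by (simp add: compact_Hausdorff_or_regular_imp_normal_space)
  moreover have "closedin X {x}"
    using assms(2) x by (simp add: closedin_Hausdorff_singleton)
  moreover have "closedin X (topspace X - U)" using assms by auto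
  moreover have "disjnt (topspace X - U) {x}" using assms by (auto simp: disjnt_def)
  ultimately obtain f where
    f: "continuous_map X (top_of_set {0..1::real}) f" "f ` (topspace X - U) \<subseteq> {0}" "f ` {x} \<subseteq> {1}"
    using Urysohn_lemma[of X "topspace X - U" "{x}" 0 1] by auto
  then show ?thesis
    by (intro exI[of _ f]) (auto simp: continuous_map_in_subtopology image_subset_iff Pi_iff)
qed

text \<open>The sum is \<open>1\<close> only on \<open>K\<close>, because the \<open>U i\<close> cover only \<open>K\<close>; being at most \<open>1\<close> everywhere is
kept for the estimates of measures of open sets.\<close>

theorem partition_of_unity:
  assumes X: "compact_space X" "Hausdorff_space X"
    and K: "closedin X K" and U: "\<And>i. i \<in> I \<Longrightarrow> openin X (U i)" "K \<subseteq> (\<Union>i\<in>I. U i)"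
  shows "\<exists>J g. finite J \<and> J \<subseteq> I \<and>
           (\<forall>i\<in>J. cts X (g i) \<and> (\<forall>x\<in>topspace X. 0 \<le> g i x \<and> (x \<notin> U i \<longrightarrow> g i x = 0))) \<and>
           (\<forall>x\<in>topspace X. (\<Sum>i\<in>J. g i x) \<le> 1) \<and> (\<forall>x\<in>K. (\<Sum>i\<in>J. g i x) = 1)"
proof -
  have KX: "K \<subseteq> topspace X" using K closedin_subset by blast
  have "\<forall>x\<in>K. \<exists>i h. i \<in> I \<and> cts X h \<and> (\<forall>y\<in>topspace X. 0 \<le> h y \<and> h y \<le> 1) \<and> h x = 1 \<and>
      (\<forall>y\<in>topspace X - U i. h y = 0)"
  proof
    fix x assume "x \<in> K"
    then obtain i where "i \<in> I" "x \<in> U i" using U by auto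
    then show "\<exists>i h. i \<in> I \<and> cts X h \<and> (\<forall>y\<in>topspace X. 0 \<le> h y \<and> h y \<le> 1) \<and> h x = 1 \<and>
      (\<forall>y\<in>topspace X - U i. h y = 0)"
      using Urysohn_point[OF X U(1), of i x] by blast
  qed
  from bchoice[OF this] obtain i where
    "\<forall>x\<in>K. \<exists>h. i x \<in> I \<and> cts X h \<and> (\<forall>y\<in>topspace X. 0 \<le> h y \<and> h y \<le> 1) \<and> h x = 1 \<and>
      (\<forall>y\<in>topspace X - U (i x). h y = 0)" by blast
  from bchoice[OF this] obtain h where
    "\<forall>x\<in>K. i x \<in> I \<and> cts X (h x) \<and> (\<forall>y\<in>topspace X. 0 \<le> h x y \<and> h x y \<le> 1) \<and> h x x = 1 \<and>
      (\<forall>y\<in>topspace X - U (i x). h x y = 0)" by blast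
  then have i: "\<And>x. x \<in> K \<Longrightarrow> i x \<in> I" and h: "\<And>x. x \<in> K \<Longrightarrow> cts X (h x)"
      "\<And>x y. x \<in> K \<Longrightarrow> y \<in> topspace X \<Longrightarrow> 0 \<le> h x y" "\<And>x. x \<in> K \<Longrightarrow> h x x = 1"
      "\<And>x y. x \<in> K \<Longrightarrow> y \<in> topspace X - U (i x) \<Longrightarrow> h x y = 0"
    by blast+
  define V where "V = (\<lambda>x. {y \<in> topspace X. h x y \<in> {1/2<..}})"
  have "compactin X K" using X K by (simp add: closedin_compact_space)
  moreover have "\<And>S. S \<in> V ` K \<Longrightarrow> openin X S"
    unfolding V_def using openin_continuous_map_preimage[OF h(1)] by (auto simp del: greaterThan_iff)
  moreover have "K \<subseteq> \<Union>(V ` K)"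
    using KX h(3) by (auto simp: V_def)
  ultimately obtain \<F> where "finite \<F>" "\<F> \<subseteq> V ` K" "K \<subseteq> \<Union>\<F>"
    using compactinD by metis
  then obtain F where F: "finite F" "F \<subseteq> K" "K \<subseteq> (\<Union>x\<in>F. V x)"
    by (metis finite_subset_image)
  define H where "H = (\<lambda>y. \<Sum>x\<in>F. h x y)"
  \<comment> \<open>The bumps with the same \<open>i x\<close> are added, so that there is one function per index. As \<open>2 * H > 1\<close>
     on \<open>K\<close>, dividing by the maximum with \<open>1\<close> normalises the sum on \<open>K\<close> and never divides by \<open>0\<close>.\<close>
  define g where "g = (\<lambda>j y. 2 * (\<Sum>x\<in>{x \<in> F. i x = j}. h x y) / max 1 (2 * H y))"
  have cH: "cts X H"
    unfolding H_def using F h(1) by (intro continuous_map_sum) auto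
  have sum_g: "(\<Sum>j\<in>i ` F. g j y) = 2 * H y / max 1 (2 * H y)" for y
    unfolding g_def H_def sum_divide_distrib[symmetric] sum_distrib_left[symmetric]
    using F(1) by (simp add: sum.image_gen[of F _ i])
  have cg: "cts X (g j)" for j
    unfolding g_def
  proof (intro continuous_map_real_divide continuous_map_real_mult continuous_map_sum
      continuous_map_real_max cH)
    show "cts X (h x)" if "x \<in> {x \<in> F. i x = j}" for x using that F h(1) by auto
    show "max 1 (2 * H y) \<noteq> 0" if "y \<in> topspace X" for y by linarith
  qed (use F in auto)
  have g: "0 \<le> g j y" if "y \<in> topspace X" for j y
    unfolding g_def using F h(2)[OF _ that] by (intro divide_nonneg_pos mult_nonneg_nonneg sum_nonneg) auto
  have g0: "g j y = 0" if "y \<in> topspace X" "y \<notin> U j" for j y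
    unfolding g_def using F h(4)[of _ y] that by (auto intro!: sum.neutral)
  have H: "1 < 2 * H y" if y: "y \<in> K" for y
  proof -
    obtain x where x: "x \<in> F" "y \<in> V x" using F y by auto
    have "y \<in> topspace X" using y KX by blast
    then have "h x y \<le> H y"
      unfolding H_def using F h(2) x(1) by (intro member_le_sum) auto
    with x show ?thesis by (auto simp: V_def)
  qed
  show ?thesis
  proof (intro exI[of _ "i ` F"] exI[of _ g] conjI ballI impI)
    show "(\<Sum>j\<in>i ` F. g j y) = 1" if "y \<in> K" for y
      unfolding sum_g using H[OF that] by (simp add: max_def)
    show "(\<Sum>j\<in>i ` F. g j y) \<le> 1" for y
      unfolding sum_g by (simp add: divide_le_eq_1 max_def)
  qed (use F i cg g g0 in auto)
qed

section \<open>States and the Riesz--Markov theorem\<close>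

text \<open>The states of the algebra of continuous functions: normalised positive linear functionals. They are
extended by \<open>0\<close> to the functions that are not continuous on \<open>X\<close>, as \<^const>\<open>measure_functional\<close> is.
All conditions are closed under pointwise limits and convex combinations, which makes this
description more manageable than the one by regular measures.\<close>

definition states :: "'x topology \<Rightarrow> (('x \<Rightarrow> real) \<Rightarrow> real) set" where
  "states X = {\<Lambda>.
     (\<forall>f. \<not> cts X f \<longrightarrow> \<Lambda> f = 0) \<and>
     (\<forall>f g. cts X f \<longrightarrow> cts X g \<longrightarrow> \<Lambda> (\<lambda>x. f x + g x) = \<Lambda> f + \<Lambda> g) \<and>
     (\<forall>c f. cts X f \<longrightarrow> \<Lambda> (\<lambda>x. c * f x) = c * \<Lambda> f) \<and>
     (\<forall>f. cts X f \<longrightarrow> (\<forall>x\<in>topspace X. 0 \<le> f x) \<longrightarrow> 0 \<le> \<Lambda> f) \<and>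
     \<Lambda> (\<lambda>_. 1) = 1}"

locale state =
  fixes X :: "'x topology" and \<Lambda> :: "('x \<Rightarrow> real) \<Rightarrow> real"
  assumes compact: "compact_space X" and Hausdorff: "Hausdorff_space X" and state: "\<Lambda> \<in> states X"
begin

lemmas state_conditions = state[unfolded states_def mem_Collect_eq]
lemmas not_cts = state_conditions[THEN conjunct1, rule_format]
  and add = state_conditions[THEN conjunct2, THEN conjunct1, rule_format]
  and scale = state_conditions[THEN conjunct2, THEN conjunct2, THEN conjunct1, rule_format]
  and nonneg = state_conditions[THEN conjunct2, THEN conjunct2, THEN conjunct2, THEN conjunct1, rule_format]
  and one = state_conditions[THEN conjunct2, THEN conjunct2, THEN conjunct2, THEN conjunct2]

lemma const: "\<Lambda> (\<lambda>_. c) = c"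
  using scale[of "\<lambda>_. 1" c] by (simp add: one)

lemma diff: "cts X f \<Longrightarrow> cts X g \<Longrightarrow> \<Lambda> (\<lambda>x. f x - g x) = \<Lambda> f - \<Lambda> g"
  using add[of f "\<lambda>x. - 1 * g x"] scale[of g "- 1"] by simp

lemma state_sum: "finite A \<Longrightarrow> (\<And>i. i \<in> A \<Longrightarrow> cts X (f i)) \<Longrightarrow> \<Lambda> (\<lambda>x. \<Sum>i\<in>A. f i x) = (\<Sum>i\<in>A. \<Lambda> (f i))"
  by (induction rule: finite_induct) (simp_all add: const add continuous_map_sum)

lemma mono: "cts X f \<Longrightarrow> cts X g \<Longrightarrow> (\<And>x. x \<in> topspace X \<Longrightarrow> f x \<le> g x) \<Longrightarrow> \<Lambda> f \<le> \<Lambda> g"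
  using nonneg[of "\<lambda>x. g x - f x"] by (simp add: diff continuous_map_diff)

lemma abs_le:
  assumes "cts X f" "\<And>x. x \<in> topspace X \<Longrightarrow> \<bar>f x\<bar> \<le> c"
  shows "\<bar>\<Lambda> f\<bar> \<le> c"
proof -
  have "\<Lambda> f \<le> \<Lambda> (\<lambda>_. c)" "\<Lambda> (\<lambda>_. - c) \<le> \<Lambda> f"
    using assms by (fastforce intro!: mono)+
  then show ?thesis by (simp add: const abs_le_iff)
qed

text \<open>The measure is constructed from its values on open sets, where it has to be the supremum of
\<open>\<Lambda> f\<close> over the continuous functions \<open>f\<close> between \<open>0\<close> and the indicator function; the outer measure is
the infimum over open supersets. Vanishing of \<open>f\<close> off \<open>U\<close> is asked for instead of a compact support
inside \<open>U\<close>; where compactness is needed, the set \<open>f \<ge> e\<close> takes over the role of the support.\<close>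

definition below :: "'x set \<Rightarrow> ('x \<Rightarrow> real) set" where
  "below U = {f. cts X f \<and> (\<forall>x\<in>topspace X. 0 \<le> f x \<and> f x \<le> 1 \<and> (x \<notin> U \<longrightarrow> f x = 0))}"

definition open_content :: "'x set \<Rightarrow> ennreal" where
  "open_content U = (SUP f\<in>below U. ennreal (\<Lambda> f))"

definition outer_content :: "'x set \<Rightarrow> ennreal" where
  "outer_content A = (INF U\<in>{U. openin X U \<and> A \<subseteq> U}. open_content U)"

lemma below_nonneg: "f \<in> below U \<Longrightarrow> 0 \<le> \<Lambda> f"
  by (auto simp: below_def intro: nonneg)

lemma open_content_upper: "f \<in> below U \<Longrightarrow> ennreal (\<Lambda> f) \<le> open_content U"
  unfolding open_content_def by (rule SUP_upper)

lemma below_ne: "below U \<noteq> {}"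
proof -
  have "(\<lambda>_. 0) \<in> below U" by (simp add: below_def)
  then show ?thesis by auto
qed

lemma open_content_mono: "U \<subseteq> V \<Longrightarrow> open_content U \<le> open_content V"
  unfolding open_content_def by (rule SUP_subset_mono) (auto simp: below_def)

lemma open_content_empty: "open_content {} = 0"
proof -
  have "\<Lambda> f = 0" if "f \<in> below {}" for f
    using that abs_le[of f 0] by (auto simp: below_def)
  then show ?thesis by (simp add: open_content_def below_ne)
qed

lemma open_content_space: "open_content (topspace X) = 1"
proof (rule antisym)
  have "\<Lambda> f \<le> 1" if "f \<in> below (topspace X)" for f
    using that abs_le[of f 1] by (auto simp: below_def)
  then show "open_content (topspace X) \<le> 1"
    unfolding open_content_def by (intro SUP_least) (simp add: ennreal_le_1)
  have "(\<lambda>_. 1) \<in> below (topspace X)" by (simp add: below_def)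
  from open_content_upper[OF this] show "1 \<le> open_content (topspace X)" by (simp add: one)
qed

lemma outer_open: "openin X U \<Longrightarrow> outer_content U = open_content U"
  unfolding outer_content_def by (intro antisym INF_lower INF_greatest open_content_mono) auto

lemma outer_le: "openin X U \<Longrightarrow> A \<subseteq> U \<Longrightarrow> outer_content A \<le> open_content U"
  unfolding outer_content_def by (rule INF_lower) auto

lemma outer_mono: "A \<subseteq> B \<Longrightarrow> outer_content A \<le> outer_content B"
  unfolding outer_content_def by (rule INF_superset_mono) auto

text \<open>Where \<open>f \<ge> e\<close>, the function \<open>f\<close> is a finite sum of functions \<open>f * g i\<close> below the \<open>U i\<close>, for a
partition of unity on that compact set; elsewhere \<open>f\<close> is smaller than \<open>e\<close>.\<close>

lemma open_content_countably_subadditive: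
  assumes U: "\<And>i::nat. openin X (U i)"
  shows "open_content (\<Union>i. U i) \<le> (\<Sum>i. open_content (U i))"
  unfolding open_content_def[of "\<Union>i. U i"]
proof (rule SUP_least, rule ennreal_le_epsilon)
  fix f and e :: real assume f: "f \<in> below (\<Union>i. U i)" and e: "0 < e"
  have cf: "cts X f" using f by (simp add: below_def)
  define K where "K = {x \<in> topspace X. f x \<in> {e..}}"
  have K: "closedin X K"
    unfolding K_def by (rule closedin_continuous_map_preimage[OF cf]) auto
  have KU: "K \<subseteq> (\<Union>i. U i)"
    using f e by (force simp: K_def below_def)
  obtain J g where J: "finite J" and
    *: "\<forall>i\<in>J. cts X (g i) \<and> (\<forall>x\<in>topspace X. 0 \<le> g i x \<and> (x \<notin> U i \<longrightarrow> g i x = 0))"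
       "\<forall>x\<in>topspace X. (\<Sum>i\<in>J. g i x) \<le> 1" "\<forall>x\<in>K. (\<Sum>i\<in>J. g i x) = 1"
    using partition_of_unity[OF compact Hausdorff K U KU] by blast
  then have cg: "\<And>i. i \<in> J \<Longrightarrow> cts X (g i)"
    and g: "\<And>i x. i \<in> J \<Longrightarrow> x \<in> topspace X \<Longrightarrow> 0 \<le> g i x"
    and g0: "\<And>i x. i \<in> J \<Longrightarrow> x \<in> topspace X \<Longrightarrow> x \<notin> U i \<Longrightarrow> g i x = 0"
    and g1: "\<And>x. x \<in> topspace X \<Longrightarrow> (\<Sum>i\<in>J. g i x) \<le> 1" "\<And>x. x \<in> K \<Longrightarrow> (\<Sum>i\<in>J. g i x) = 1"
    by blast+
  have f01: "0 \<le> f x" "f x \<le> 1" if "x \<in> topspace X" for x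
    using f that by (auto simp: below_def)
  have gle: "g i x \<le> 1" if "i \<in> J" "x \<in> topspace X" for i x
    using member_le_sum[of i J "\<lambda>i. g i x"] g J g1(1)[OF that(2)] that by fastforce
  have fg: "(\<lambda>x. f x * g i x) \<in> below (U i)" if "i \<in> J" for i
    unfolding below_def using that cf cg f01 g gle g0
    by (auto intro!: continuous_map_real_mult mult_le_one)
  have "\<Lambda> f \<le> \<Lambda> (\<lambda>x. e + (\<Sum>i\<in>J. f x * g i x))"
  proof (rule mono[OF cf])
    show "cts X (\<lambda>x. e + (\<Sum>i\<in>J. f x * g i x))"
      using cf cg J by (intro continuous_map_add continuous_map_sum continuous_map_real_mult) auto
    fix x assume x: "x \<in> topspace X"
    have "0 \<le> (\<Sum>i\<in>J. f x * g i x)"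
      using x f01 g by (intro sum_nonneg mult_nonneg_nonneg) auto
    moreover have "f x \<le> (\<Sum>i\<in>J. f x * g i x)" if "x \<in> K"
      using g1(2)[OF that] by (simp add: sum_distrib_left[symmetric])
    moreover have "f x \<le> e" if "x \<notin> K"
      using that x by (auto simp: K_def)
    ultimately show "f x \<le> e + (\<Sum>i\<in>J. f x * g i x)"
      using e by fastforce
  qed
  also have "\<dots> = e + (\<Sum>i\<in>J. \<Lambda> (\<lambda>x. f x * g i x))"
    using cf cg J by (subst add, simp_all add: continuous_map_sum continuous_map_real_mult const)
      (subst state_sum, auto intro!: continuous_map_real_mult)
  finally have "ennreal (\<Lambda> f) \<le> ennreal (e + (\<Sum>i\<in>J. \<Lambda> (\<lambda>x. f x * g i x)))"
    by (rule ennreal_leI)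
  also have "\<dots> = ennreal e + (\<Sum>i\<in>J. ennreal (\<Lambda> (\<lambda>x. f x * g i x)))"
    using e below_nonneg[OF fg] by (simp add: ennreal_plus sum_nonneg sum_ennreal)
  also have "\<dots> \<le> ennreal e + (\<Sum>i\<in>J. open_content (U i))"
    using fg by (intro add_left_mono sum_mono open_content_upper)
  also have "\<dots> \<le> ennreal e + (\<Sum>i. open_content (U i))"
    using J by (intro add_left_mono sum_le_suminf) auto
  finally show "ennreal (\<Lambda> f) \<le> (\<Sum>i. open_content (U i)) + ennreal e"
    by (simp add: add.commute)
qed

text \<open>The usual argument with errors \<open>e / 2 ^ (n + 1)\<close>, which add up to \<open>e\<close>.\<close>

lemma outer_countably_subadditive:
  fixes A :: "nat \<Rightarrow> 'x set"
  shows "outer_content (\<Union>i. A i) \<le> (\<Sum>i. outer_content (A i))"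
proof (rule ennreal_le_epsilon)
  fix e :: real assume e: "0 < e" and fin: "(\<Sum>i. outer_content (A i)) < top_class.top"
  then have "outer_content (A n) < outer_content (A n) + e * (1/2)^Suc n" for n
    by (auto simp add: less_top dest!: ennreal_suminf_lessD)
  then have "\<exists>U. openin X U \<and> A n \<subseteq> U \<and> open_content U \<le> outer_content (A n) + e * (1/2)^Suc n" for n
    unfolding outer_content_def INF_less_iff by (metis (mono_tags, lifting) less_imp_le mem_Collect_eq)
  then obtain U where U: "\<And>n. openin X (U n)" "\<And>n. A n \<subseteq> U n"
      "\<And>n. open_content (U n) \<le> outer_content (A n) + e * (1/2)^Suc n"
    by metis
  have "outer_content (\<Union>i. A i) \<le> open_content (\<Union>i. U i)"
    using U by (intro outer_le) auto
  also have "\<dots> \<le> (\<Sum>n. open_content (U n))"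
    by (rule open_content_countably_subadditive[OF U(1)])
  also have "\<dots> \<le> (\<Sum>n. outer_content (A n) + e * (1/2)^Suc n)"
    using U(3) by (intro suminf_le) auto
  also have "\<dots> = (\<Sum>n. outer_content (A n)) + (\<Sum>n. ennreal e * ennreal ((1/2) ^ Suc n))"
    using e by (subst suminf_add[symmetric])
      (auto simp del: ennreal_suminf_cmult simp add: ennreal_mult[symmetric])
  also have "\<dots> = (\<Sum>n. outer_content (A n)) + e"
    unfolding ennreal_suminf_cmult
    by (subst suminf_ennreal_eq[OF zero_le_power power_half_series]) auto
  finally show "outer_content (\<Union>i. A i) \<le> (\<Sum>i. outer_content (A i)) + ennreal e" .
qed

lemma outer_empty: "outer_content {} = 0"
  by (simp add: outer_open open_content_empty)

lemma outer_measure_space: "outer_measure_space (Pow (topspace X)) outer_content"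
  unfolding outer_measure_space_def
proof (intro conjI)
  show "positive (Pow (topspace X)) outer_content" by (simp add: positive_def outer_empty)
  show "increasing (Pow (topspace X)) outer_content" by (simp add: increasing_def outer_mono)
  show "countably_subadditive (Pow (topspace X)) outer_content"
    unfolding countably_subadditive_def using outer_countably_subadditive by blast
qed

lemma outer_Un: "A \<subseteq> topspace X \<Longrightarrow> B \<subseteq> topspace X \<Longrightarrow> outer_content (A \<union> B) \<le> outer_content A + outer_content B"
proof -
  interpret sigma_algebra "topspace X" "Pow (topspace X)" by (rule sigma_algebra_Pow)
  have "subadditive (Pow (topspace X)) outer_content"
    using outer_measure_space
    by (intro countably_subadditive_subadditive) (auto simp: outer_measure_space_def)
  moreover assume AB: "A \<subseteq> topspace X" "B \<subseteq> topspace X"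
  moreover have "outer_content (A \<union> (B - A)) \<le> outer_content A + outer_content (B - A)"
    using calculation by (intro subadditiveD) auto
  moreover have "outer_content (B - A) \<le> outer_content B" by (rule outer_mono) auto
  ultimately show ?thesis
    by (metis Un_Diff_cancel add_left_mono order_trans)
qed

text \<open>The Caratheodory condition for open sets. Given \<open>f\<close> below \<open>V \<inter> U\<close>, the points of \<open>V\<close> with \<open>f < e\<close>
form an open superset \<open>V'\<close> of \<open>V - U\<close>. For \<open>g\<close> below \<open>V'\<close> the function \<open>f + g\<close> exceeds \<open>1\<close> by at
most \<open>e\<close>, since \<open>g\<close> vanishes wherever \<open>f \<ge> e\<close>; so \<open>\<Lambda> f + \<Lambda> g\<close> is at most the content of \<open>V\<close>
plus \<open>e\<close>.\<close>

lemma open_content_split: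
  assumes U: "openin X U" and V: "openin X V"
  shows "open_content (V \<inter> U) + outer_content (V - U) \<le> open_content V"
  unfolding open_content_def[of "V \<inter> U"] ennreal_SUP_add_left[OF below_ne, symmetric]
proof (rule SUP_least, rule ennreal_le_epsilon)
  fix f and e :: real assume f: "f \<in> below (V \<inter> U)" and e: "0 < e"
  have cf: "cts X f" using f by (simp add: below_def)
  have f01: "0 \<le> f x" "f x \<le> 1" if "x \<in> topspace X" for x
    using f that by (auto simp: below_def)
  define V' where "V' = {x \<in> V. f x \<in> {..<e}}"
  have V': "openin X V'"
    unfolding V'_def by (rule openin_continuous_map_preimage_gen[OF cf V]) auto
  have "V - U \<subseteq> V'"
    using f e openin_subset[OF V] by (auto simp: V'_def below_def)
  then have "ennreal (\<Lambda> f) + outer_content (V - U) \<le> ennreal (\<Lambda> f) + open_content V'"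
    by (intro add_left_mono outer_le V')
  also have "\<dots> \<le> open_content V + ennreal e"
    unfolding open_content_def[of V'] ennreal_SUP_add_right[OF below_ne]
  proof (rule SUP_least)
    fix g assume g: "g \<in> below V'"
    have cg: "cts X g" using g by (simp add: below_def)
    have g01: "0 \<le> g x" "g x \<le> 1" if "x \<in> topspace X" for x
      using g that by (auto simp: below_def)
    have h: "(\<lambda>x. min 1 (f x + g x)) \<in> below V"
      unfolding below_def using f g cf cg
      by (auto simp: below_def V'_def intro!: continuous_map_real_min continuous_map_add)
    have "\<Lambda> f + \<Lambda> g = \<Lambda> (\<lambda>x. f x + g x)"
      using cf cg by (simp add: add)
    also have "\<dots> \<le> \<Lambda> (\<lambda>x. min 1 (f x + g x) + e)"
    proof (rule mono)
      fix x assume x: "x \<in> topspace X"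
      show "f x + g x \<le> min 1 (f x + g x) + e"
      proof (cases "x \<in> V'")
        case True
        then show ?thesis using g01[OF x] e by (auto simp: V'_def min_def)
      next
        case False
        then have "g x = 0" using g x by (auto simp: below_def)
        then show ?thesis using f01[OF x] e by simp
      qed
    qed (use cf cg in \<open>auto intro!: continuous_map_real_min continuous_map_add\<close>)
    also have "\<dots> = \<Lambda> (\<lambda>x. min 1 (f x + g x)) + e"
      using h by (subst add) (auto simp: below_def const)
    finally have "ennreal (\<Lambda> f + \<Lambda> g) \<le> ennreal (\<Lambda> (\<lambda>x. min 1 (f x + g x)) + e)"
      by (rule ennreal_leI)
    also have "\<dots> = ennreal (\<Lambda> (\<lambda>x. min 1 (f x + g x))) + ennreal e"
      using e below_nonneg[OF h] by (simp add: ennreal_plus)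
    also have "\<dots> \<le> open_content V + ennreal e"
      by (intro add_right_mono open_content_upper h)
    finally show "ennreal (\<Lambda> f) + ennreal (\<Lambda> g) \<le> open_content V + ennreal e"
      using below_nonneg[OF f] below_nonneg[OF g] by (simp add: ennreal_plus)
  qed
  finally show "ennreal (\<Lambda> f) + outer_content (V - U) \<le> open_content V + ennreal e" .
qed

lemma open_in_lambda_system:
  assumes U: "openin X U"
  shows "U \<in> lambda_system (topspace X) (Pow (topspace X)) outer_content"
  unfolding lambda_system_def
proof (intro CollectI conjI ballI antisym)
  show "U \<in> Pow (topspace X)" using openin_subset[OF U] by simp
  fix A assume A: "A \<in> Pow (topspace X)"
  have "outer_content A \<le> outer_content (U \<inter> A \<union> (topspace X - U) \<inter> A)"
    using A by (intro outer_mono) auto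
  also have "\<dots> \<le> outer_content (U \<inter> A) + outer_content ((topspace X - U) \<inter> A)"
    using A by (intro outer_Un) auto
  finally show "outer_content A \<le> outer_content (U \<inter> A) + outer_content ((topspace X - U) \<inter> A)" .
  show "outer_content (U \<inter> A) + outer_content ((topspace X - U) \<inter> A) \<le> outer_content A"
    unfolding outer_content_def[of A]
  proof (rule INF_greatest, clarify)
    fix V assume V: "openin X V" "A \<subseteq> V"
    have "outer_content (U \<inter> A) + outer_content ((topspace X - U) \<inter> A) \<le> open_content (V \<inter> U) + outer_content (V - U)"
      using U V by (intro add_mono outer_le outer_mono) auto
    also have "\<dots> \<le> open_content V" by (rule open_content_split[OF U V(1)])
    finally show "outer_content (U \<inter> A) + outer_content ((topspace X - U) \<inter> A) \<le> open_content V" .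
  qed
qed

definition riesz_measure :: "'x measure" where
  "riesz_measure = measure_of (topspace X) (sets (borel_of X)) outer_content"

lemma measure_space_outer: "measure_space (topspace X) (sets (borel_of X)) outer_content"
proof (rule measure_down)
  interpret sigma_algebra "topspace X" "Pow (topspace X)" by (rule sigma_algebra_Pow)
  show ms: "measure_space (topspace X) (lambda_system (topspace X) (Pow (topspace X)) outer_content) outer_content"
    by (rule caratheodory_lemma[OF outer_measure_space])
  show "sigma_algebra (topspace X) (sets (borel_of X))"
    using sets.sigma_algebra_axioms[of "borel_of X"] by simp
  show "sets (borel_of X) \<subseteq> lambda_system (topspace X) (Pow (topspace X)) outer_content"
    unfolding sets_borel_of using ms open_in_lambda_system
    by (intro sigma_algebra.sigma_sets_subset) (auto simp: measure_space_def)
qed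

lemma space_riesz [simp]: "space riesz_measure = topspace X"
  by (simp add: riesz_measure_def space_measure_of_conv)

lemma sets_riesz [simp]: "sets riesz_measure = sets (borel_of X)"
proof -
  have "sets (borel_of X) \<subseteq> Pow (topspace X)"
    using sets.space_closed[of "borel_of X"] by simp
  then have "sets riesz_measure = sigma_sets (topspace X) (sets (borel_of X))"
    unfolding riesz_measure_def by (rule sets_measure_of)
  also have "\<dots> = sets (borel_of X)"
    using sets.sigma_sets_eq[of "borel_of X"] by simp
  finally show ?thesis .
qed

lemma emeasure_riesz:
  assumes "A \<in> sets (borel_of X)"
  shows "emeasure riesz_measure A = outer_content A"
proof -
  have "sigma_algebra (topspace X) (sets (borel_of X))" "positive (sets (borel_of X)) outer_content"
    "countably_additive (sets (borel_of X)) outer_content"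
    using measure_space_outer by (simp_all add: measure_space_def)
  then show ?thesis
    unfolding riesz_measure_def using assms by (intro emeasure_measure_of_sigma)
qed

lemma emeasure_riesz_open: "openin X U \<Longrightarrow> emeasure riesz_measure U = open_content U"
  by (simp add: emeasure_riesz openin_borel_of outer_open)

lemma prob_space_riesz: "prob_space riesz_measure"
  by (rule prob_spaceI) (simp add: emeasure_riesz_open open_content_space)

text \<open>Outer regularity is built into the outer measure. Inner regularity follows by passing to
complements, because the total mass is finite and closed sets are compact.\<close>

lemma regular_riesz: "regular_borel_probability X riesz_measure"
  unfolding regular_borel_probability_def
proof (intro conjI ballI)
  interpret M: prob_space riesz_measure by (rule prob_space_riesz)
  show "prob_space riesz_measure" by (rule prob_space_riesz)
  fix A assume "A \<in> sets riesz_measure"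
  then have A: "A \<in> sets (borel_of X)" by simp
  then have AX: "A \<subseteq> topspace X" using sets.sets_into_space by fastforce
  have outer: "emeasure riesz_measure B = (INF U\<in>{U. openin X U \<and> B \<subseteq> U}. emeasure riesz_measure U)"
    if "B \<in> sets (borel_of X)" for B
    unfolding emeasure_riesz[OF that] outer_content_def by (intro INF_cong) (auto simp: emeasure_riesz_open)
  show "emeasure riesz_measure A = (INF U\<in>{U. openin X U \<and> A \<subseteq> U}. emeasure riesz_measure U)"
    by (rule outer[OF A])
  show "emeasure riesz_measure A = (SUP C\<in>{C. compactin X C \<and> C \<subseteq> A}. emeasure riesz_measure C)"
  proof (rule antisym)
    show "(SUP C\<in>{C. compactin X C \<and> C \<subseteq> A}. emeasure riesz_measure C) \<le> emeasure riesz_measure A"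
      using A by (intro SUP_least emeasure_mono) auto
    show "emeasure riesz_measure A \<le> (SUP C\<in>{C. compactin X C \<and> C \<subseteq> A}. emeasure riesz_measure C)"
    proof (rule ennreal_le_epsilon)
      fix e :: real assume e: "0 < e"
      let ?B = "topspace X - A"
      have B: "?B \<in> sets (borel_of X)" using sets.compl_sets[OF A] by simp
      have "emeasure riesz_measure ?B < emeasure riesz_measure ?B + e"
        using e by (simp add: M.emeasure_eq_measure ennreal_plus[symmetric] ennreal_less_iff del: ennreal_plus)
      then obtain U where U: "openin X U" "?B \<subseteq> U"
          "emeasure riesz_measure U < emeasure riesz_measure ?B + e"
        unfolding outer[OF B] INF_less_iff by auto
      have Us: "U \<in> sets (borel_of X)" by (rule openin_borel_of[OF U(1)])
      have C: "closedin X (topspace X - U)" using U by auto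
      have "M.prob (topspace X - U) = 1 - M.prob U" "M.prob ?B = 1 - M.prob A"
        using M.prob_compl[of U] M.prob_compl[of A] Us A by auto
      moreover have "M.prob U < M.prob ?B + e"
        using U(3) e by (simp add: M.emeasure_eq_measure ennreal_plus[symmetric] ennreal_less_iff del: ennreal_plus)
      ultimately have "emeasure riesz_measure A \<le> emeasure riesz_measure (topspace X - U) + e"
        using e by (simp add: M.emeasure_eq_measure ennreal_plus[symmetric] del: ennreal_plus)
      also have "\<dots> \<le> (SUP C\<in>{C. compactin X C \<and> C \<subseteq> A}. emeasure riesz_measure C) + e"
        using C U compact by (intro add_right_mono SUP_upper) (auto intro: closedin_compact_space)
      finally show "emeasure riesz_measure A \<le>
        (SUP C\<in>{C. compactin X C \<and> C \<subseteq> A}. emeasure riesz_measure C) + ennreal e" .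
    qed
  qed
qed auto

lemma integrable_riesz: 
  assumes "cts X f" shows "integrable riesz_measure f"
proof -
  interpret M: prob_space riesz_measure by (rule prob_space_riesz)
  obtain c where "\<forall>x\<in>topspace X. \<bar>f x\<bar> \<le> c" using bounded_cts[OF compact assms] by blast
  moreover have "f \<in> borel_measurable riesz_measure"
    unfolding measurable_cong_sets[OF sets_riesz refl]
    by (rule continuous_map_borel_measurable[OF assms])
  ultimately show ?thesis
    by (intro M.integrable_const_bound[where B = c] AE_I2) simp_all
qed

text \<open>The function \<open>f\<close> is cut into \<open>N\<close> slices \<open>F k\<close> of height \<open>1 / N\<close>. Each slice lies between \<open>1 / N\<close>
times the indicator functions of \<open>f > (k + 1) / N\<close> and of \<open>f > k / N\<close>, so that \<open>\<Lambda> (F k)\<close> and the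
integral of \<open>F k\<close> are controlled by the measures of these sets; after summation the two bounds differ
by at most \<open>1 / N\<close>.\<close>

lemma le_integral_unit:
  assumes f: "cts X f" "\<And>x. x \<in> topspace X \<Longrightarrow> 0 \<le> f x \<and> f x \<le> 1"
  shows "\<Lambda> f \<le> (\<integral>x. f x \<partial>riesz_measure)"
proof (rule field_le_epsilon)
  interpret M: prob_space riesz_measure by (rule prob_space_riesz)
  fix e :: real assume "0 < e"
  then obtain n :: nat where n: "inverse (of_nat (Suc n)) < e" using reals_Archimedean by blast
  define N where "N = Suc n"
  have N: "0 < N" "1 / real N < e" using n by (auto simp: N_def inverse_eq_divide)
  define F where "F = (\<lambda>k x. min (f x) (real (Suc k) / N) - min (f x) (real k / N))"
  define m where "m = (\<lambda>k. M.prob {x \<in> topspace X. f x \<in> {real k / N<..}})"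
  have op: "openin X {x \<in> topspace X. f x \<in> {real k / N<..}}" for k
    by (rule openin_continuous_map_preimage[OF f(1)]) auto
  have cF: "cts X (F k)" for k
    unfolding F_def by (intro continuous_map_diff continuous_map_real_min f) auto
  have le: "real k / N \<le> real (Suc k) / N" for k
    by (simp add: divide_right_mono)
  have step: "real (Suc k) / N = real k / N + 1 / N" for k
    by (simp add: add_divide_distrib)
  have "real N * \<Lambda> (F k) \<le> m k" for k
  proof -
    have "(\<lambda>x. real N * F k x) \<in> below {x \<in> topspace X. f x \<in> {real k / N<..}}"
      unfolding below_def
    proof (intro CollectI conjI ballI impI)
      show "cts X (\<lambda>x. real N * F k x)" by (intro continuous_map_real_mult cF) auto
      fix x assume x: "x \<in> topspace X"
      show "0 \<le> real N * F k x" using le[of k] by (auto simp: F_def min_def)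
      have "0 < 1 / real N" using N by simp
      then have "F k x \<le> 1 / N" unfolding F_def step by linarith
      then show "real N * F k x \<le> 1" using N by (simp add: field_simps)
      assume "x \<notin> {x \<in> topspace X. f x \<in> {real k / N<..}}"
      then show "real N * F k x = 0" using x le[of k] by (auto simp: F_def min_def)
    qed
    from open_content_upper[OF this] show ?thesis
      unfolding emeasure_riesz_open[OF op, symmetric] M.emeasure_eq_measure
      by (simp add: m_def scale[OF cF])
  qed
  then have upper: "\<Lambda> (F k) \<le> m k / N" for k
    using N by (simp add: field_simps)
  have lower: "m (Suc k) / N \<le> (\<integral>x. F k x \<partial>riesz_measure)" for k
  proof -
    let ?A = "{x \<in> topspace X. f x \<in> {real (Suc k) / N<..}}"
    have A: "?A \<in> sets riesz_measure" using openin_borel_of[OF op[of "Suc k"]] by simp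
    have "m (Suc k) / N = (\<integral>x. indicator ?A x / N \<partial>riesz_measure)"
      using A by (simp add: m_def Int_absorb2 Collect_subset)
    also have "\<dots> \<le> (\<integral>x. F k x \<partial>riesz_measure)"
    proof (rule integral_mono)
      show "integrable riesz_measure (\<lambda>x. indicator ?A x / real N)"
        using A by (intro integrable_divide_zero) (simp add: less_top[symmetric])
      show "integrable riesz_measure (F k)" by (rule integrable_riesz[OF cF])
      show "indicator ?A x / real N \<le> F k x" if "x \<in> space riesz_measure" for x
      proof (cases "x \<in> ?A")
        case True
        moreover from this have "real (Suc k) / N < f x" by simp
        ultimately show ?thesis using le[of k] unfolding F_def step[of k] by simp
      next
        case False
        then show ?thesis using le[of k] unfolding F_def by simp
      qed
    qed
    finally show ?thesis .
  qed
  have tele: "(\<Sum>k<N. F k x) = f x" if "x \<in> topspace X" for x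
    unfolding F_def using sum_lessThan_telescope[of "\<lambda>k. min (f x) (real k / N)" N] f(2)[OF that] N
    by (simp add: min_def)
  have "\<Lambda> f \<le> \<Lambda> (\<lambda>x. \<Sum>k<N. F k x)"
    using f(1) cF by (intro mono continuous_map_sum) (auto simp: tele)
  also have "\<dots> = (\<Sum>k<N. \<Lambda> (F k))"
    using cF by (intro state_sum) auto
  also have "\<dots> \<le> (\<Sum>k<N. m k / N)"
    by (intro sum_mono upper)
  also have "\<dots> \<le> (\<Sum>k<Suc N. m k / N)"
    by (simp add: m_def)
  also have "\<dots> = m 0 / N + (\<Sum>k<N. m (Suc k) / N)"
    by (rule sum.lessThan_Suc_shift)
  also have "\<dots> \<le> 1 / N + (\<Sum>k<N. \<integral>x. F k x \<partial>riesz_measure)"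
    by (intro add_mono sum_mono lower divide_right_mono) (auto simp: m_def)
  also have "(\<Sum>k<N. \<integral>x. F k x \<partial>riesz_measure) = (\<integral>x. (\<Sum>k<N. F k x) \<partial>riesz_measure)"
    using integrable_riesz[OF cF] by (simp add: Bochner_Integration.integral_sum)
  also have "\<dots> = (\<integral>x. f x \<partial>riesz_measure)"
    by (intro Bochner_Integration.integral_cong) (auto simp: tele)
  finally show "\<Lambda> f \<le> (\<integral>x. f x \<partial>riesz_measure) + e" using N by simp
qed

text \<open>Reduction to values in the unit interval by the affine change \<open>(f + c) / (2 * c)\<close>.\<close>

lemma le_integral:
  assumes f: "cts X f"
  shows "\<Lambda> f \<le> (\<integral>x. f x \<partial>riesz_measure)"
proof -
  interpret M: prob_space riesz_measure by (rule prob_space_riesz)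
  obtain c where c: "c > 0" "\<And>x. x \<in> topspace X \<Longrightarrow> \<bar>f x\<bar> \<le> c"
    using bounded_cts[OF compact f] by blast
  define g where "g = (\<lambda>x. 1 / (2 * c) * (f x + c))"
  have cg: "cts X g"
    unfolding g_def using f by (intro continuous_map_real_mult continuous_map_add) auto
  have "\<Lambda> g \<le> (\<integral>x. g x \<partial>riesz_measure)"
  proof (rule le_integral_unit[OF cg])
    fix x assume "x \<in> topspace X"
    then show "0 \<le> g x \<and> g x \<le> 1"
      using c(1) c(2)[of x] by (auto simp: g_def field_simps abs_le_iff)
  qed
  also have "\<Lambda> g = 1 / (2 * c) * (\<Lambda> f + c)"
    unfolding g_def using f by (subst scale) (auto simp: add const continuous_map_add)
  also have "(\<integral>x. g x \<partial>riesz_measure) = 1 / (2 * c) * ((\<integral>x. f x \<partial>riesz_measure) + c)"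
    unfolding g_def using integrable_riesz[OF f] by (simp add: M.prob_space[simplified])
  finally show ?thesis using c(1) by (simp add: field_simps)
qed

text \<open>The Riesz--Markov theorem for states. The inequality \<open>\<Lambda> f \<le> \<integral> f\<close>, applied to \<open>- f\<close> as well, gives
equality.\<close>

theorem riesz_representation: "measure_functional X riesz_measure = \<Lambda>"
proof
  fix f
  show "measure_functional X riesz_measure f = \<Lambda> f"
  proof (cases "cts X f")
    case True
    have "\<Lambda> (\<lambda>x. - 1 * f x) \<le> (\<integral>x. - 1 * f x \<partial>riesz_measure)"
      using True by (intro le_integral continuous_map_real_mult) auto
    then have "(\<integral>x. f x \<partial>riesz_measure) \<le> \<Lambda> f"
      unfolding scale[OF True] using integrable_riesz[OF True] by simp
    with le_integral[OF True] True show ?thesis by (simp add: measure_functional_def)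
  qed (simp add: measure_functional_def not_cts)
qed

end

text \<open>From here on the affine flow of measures is treated as the flow of states.\<close>

theorem probability_measures_eq_states:
  assumes X: "compact_space X" "Hausdorff_space X"
  shows "probability_measures X = states X"
proof
  show "states X \<subseteq> probability_measures X"
  proof
    fix \<Lambda> assume "\<Lambda> \<in> states X"
    then interpret state X \<Lambda> using X by unfold_locales
    show "\<Lambda> \<in> probability_measures X"
      unfolding probability_measures_def using riesz_representation regular_riesz by (metis imageI mem_Collect_eq)
  qed
  show "probability_measures X \<subseteq> states X"
    unfolding probability_measures_def
  proof clarify
    fix M assume M: "regular_borel_probability X M"
    interpret M: prob_space M using M by (simp add: regular_borel_probability_def)
    have sp [simp]: "space M = topspace X" and st: "sets M = sets (borel_of X)"
      using M by (auto simp: regular_borel_probability_def)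
    have int: "integrable M f" if f: "cts X f" for f
    proof -
      obtain c where "\<forall>x\<in>topspace X. \<bar>f x\<bar> \<le> c" using bounded_cts[OF X(1) f] by blast
      moreover have "f \<in> borel_measurable M"
        unfolding measurable_cong_sets[OF st refl] by (rule continuous_map_borel_measurable[OF f])
      ultimately show ?thesis
        by (intro M.integrable_const_bound[where B = c] AE_I2) simp_all
    qed
    have "integral\<^sup>L M (\<lambda>x. f x + g x) = integral\<^sup>L M f + integral\<^sup>L M g"
      if "cts X f" "cts X g" for f g
      using that int by (intro Bochner_Integration.integral_add)
    moreover have "0 \<le> integral\<^sup>L M f" if "\<forall>x\<in>topspace X. 0 \<le> f x" for f :: "_ \<Rightarrow> real"
      using that by (intro integral_nonneg_AE AE_I2) simp
    ultimately show "measure_functional X M \<in> states X"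
      unfolding states_def mem_Collect_eq measure_functional_def
      by (intro conjI allI impI)
        (simp_all add: int M.prob_space[simplified] continuous_map_add continuous_map_real_mult)
  qed
qed

section \<open>The compact convex set of states and its extreme points\<close>

lemma Hausdorff_space_top_of_set: "Hausdorff_space (top_of_set (S :: 'a::t2_space set))"
proof (rule Hausdorff_space_subtopology)
  show "Hausdorff_space (euclidean :: 'a topology)"
    unfolding Hausdorff_space_def disjnt_def by (metis hausdorff open_openin)
qed

lemma states_add_scale:
  assumes "\<Lambda> \<in> states X" "\<Lambda>' \<in> states X" "0 \<le> u" "0 \<le> v" "u + v = 1"
  shows "u *\<^sub>R \<Lambda> + v *\<^sub>R \<Lambda>' \<in> states X"
  using assms unfolding states_def mem_Collect_eq
  by (intro conjI allI impI) (simp_all add: algebra_simps)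

lemma convex_states: "convex (states X)"
  by (intro convexI states_add_scale)

text \<open>The states form a closed subset of a product of compact intervals (Tychonoff).\<close>

lemma compact_states:
  assumes X: "compact_space X" "Hausdorff_space X"
  shows "compact (states X)"
proof -
  have "\<exists>c. \<forall>x\<in>topspace X. \<bar>f x\<bar> \<le> c" if "cts X f" for f
    using bounded_cts[OF X(1) that] by blast
  then obtain B where B: "\<And>f x. cts X f \<Longrightarrow> x \<in> topspace X \<Longrightarrow> \<bar>f x\<bar> \<le> B f"
    by metis
  have "compactin (product_topology (\<lambda>_. euclideanreal) UNIV) (PiE UNIV (\<lambda>f. {- \<bar>B f\<bar>..\<bar>B f\<bar>}))"
    by (simp add: compactin_PiE)
  then have "compact (PiE UNIV (\<lambda>f. {- \<bar>B f\<bar>..\<bar>B f\<bar>}))"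
    by (simp add: euclidean_product_topology)
  moreover have "closed (states X)"
    unfolding states_def
    by (intro closed_Collect_conj closed_Collect_all closed_Collect_imp open_Collect_const
        closed_Collect_eq closed_Collect_le continuous_intros continuous_on_product_coordinates)
  moreover have "states X \<subseteq> PiE UNIV (\<lambda>f. {- \<bar>B f\<bar>..\<bar>B f\<bar>})"
  proof
    fix \<Lambda> assume "\<Lambda> \<in> states X"
    then interpret state X \<Lambda> using X by unfold_locales
    have "\<bar>\<Lambda> f\<bar> \<le> \<bar>B f\<bar>" for f
    proof (cases "cts X f")
      case True
      then show ?thesis using B[OF True] by (intro abs_le) force+
    qed (simp add: not_cts)
    then show "\<Lambda> \<in> PiE UNIV (\<lambda>f. {- \<bar>B f\<bar>..\<bar>B f\<bar>})"
      by (auto simp: PiE_UNIV_domain Pi_iff abs_le_iff minus_le_iff)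
  qed
  ultimately show ?thesis
    using closed_Int_compact[of "states X"] by (metis inf.absorb1)
qed

text \<open>The functional of the point mass at \<open>x\<close>, extended by \<open>0\<close> like every state.\<close>

definition dirac :: "'x topology \<Rightarrow> 'x \<Rightarrow> ('x \<Rightarrow> real) \<Rightarrow> real" where
  "dirac X x = (\<lambda>f. if cts X f then f x else 0)"

lemma dirac_in_states: "x \<in> topspace X \<Longrightarrow> dirac X x \<in> states X"
  by (simp add: states_def dirac_def continuous_map_add continuous_map_real_mult)

lemma continuous_map_dirac: "continuous_map X euclidean (dirac X)"
  unfolding euclidean_product_topology[symmetric] continuous_map_componentwise_UNIV
  by (simp add: dirac_def)

lemma tendsto_dirac: "limitin X p z F \<Longrightarrow> ((\<lambda>g. dirac X (p g)) \<longlongrightarrow> dirac X z) F"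
  using continuous_map_limit[OF continuous_map_dirac] by (simp add: o_def)

text \<open>Point masses are extreme: if a convex combination of two states is the point mass at \<open>x\<close>, then both
states vanish on the nonnegative function \<open>\<bar>f - f x\<bar>\<close>, which bounds \<open>f - f x\<close>.\<close>

lemma dirac_extreme:
  assumes X: "compact_space X" "Hausdorff_space X" and x: "x \<in> topspace X"
    and L: "\<Lambda> \<in> states X" "\<Lambda>' \<in> states X" and t: "0 < t" "t < 1"
    and eq: "(1 - t) *\<^sub>R \<Lambda> + t *\<^sub>R \<Lambda>' = dirac X x"
  shows "\<Lambda> = dirac X x"
proof
  interpret state X \<Lambda> using X L by unfold_locales auto
  interpret L': state X \<Lambda>' using X L by unfold_locales auto
  fix f
  show "\<Lambda> f = dirac X x f"
  proof (cases "cts X f")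
    case True
    let ?g = "\<lambda>y. f y - f x"
    let ?h = "\<lambda>y. \<bar>f y - f x\<bar>"
    have c: "cts X ?g" "cts X ?h"
      using True by (auto intro!: continuous_map_diff continuous_map_real_abs)
    have "(1 - t) * \<Lambda> ?h + t * \<Lambda>' ?h = 0"
      using fun_cong[OF eq, of ?h] c by (simp add: dirac_def)
    moreover have "0 \<le> \<Lambda> ?h" "0 \<le> \<Lambda>' ?h"
      using c by (auto intro: nonneg L'.nonneg)
    ultimately have "(1 - t) * \<Lambda> ?h = 0"
      using t by (smt (verit) mult_nonneg_nonneg)
    then have h: "\<Lambda> ?h = 0" using t by simp
    have "\<Lambda> ?g \<le> \<Lambda> ?h" using c by (intro mono) auto
    moreover have "\<Lambda> (\<lambda>y. - 1 * ?g y) \<le> \<Lambda> ?h"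
      using c by (intro mono continuous_map_real_mult) auto
    ultimately have "\<Lambda> ?g = 0"
      using h scale[OF c(1), of "- 1"] by simp
    then have "\<Lambda> f = f x"
      using True by (simp add: diff const)
    then show ?thesis using True by (simp add: dirac_def)
  qed (simp add: not_cts dirac_def)
qed

context state begin

text \<open>The state with density \<open>h / \<Lambda> h\<close> with respect to \<open>\<Lambda>\<close>.\<close>

definition density_state :: "('x \<Rightarrow> real) \<Rightarrow> ('x \<Rightarrow> real) \<Rightarrow> real" where
  "density_state h = (\<lambda>f. if cts X f then \<Lambda> (\<lambda>x. h x * f x) / \<Lambda> h else 0)"

lemma density_state_in_states:
  assumes h: "cts X h" "\<And>x. x \<in> topspace X \<Longrightarrow> 0 \<le> h x" "0 < \<Lambda> h"
  shows "density_state h \<in> states X"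
proof -
  have "\<Lambda> (\<lambda>x. h x * (f x + g x)) = \<Lambda> (\<lambda>x. h x * f x) + \<Lambda> (\<lambda>x. h x * g x)"
    if "cts X f" "cts X g" for f g
    using add[of "\<lambda>x. h x * f x" "\<lambda>x. h x * g x"] h that
    by (simp add: continuous_map_real_mult distrib_left)
  moreover have "\<Lambda> (\<lambda>x. h x * (c * f x)) = c * \<Lambda> (\<lambda>x. h x * f x)" if "cts X f" for c f
    using scale[of "\<lambda>x. h x * f x" c] h that
    by (simp add: continuous_map_real_mult mult.left_commute)
  moreover have "0 \<le> \<Lambda> (\<lambda>x. h x * f x)" if "cts X f" "\<forall>x\<in>topspace X. 0 \<le> f x" for f
    using h that by (intro nonneg continuous_map_real_mult) auto
  ultimately show ?thesis
    unfolding states_def mem_Collect_eq density_state_def using h(3)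
    by (intro conjI allI impI)
      (simp_all add: continuous_map_add continuous_map_real_mult add_divide_distrib)
qed

text \<open>An extreme state is multiplicative: it is the convex combination of its states with densities \<open>h\<close>
and \<open>1 - h\<close>, with weights \<open>\<Lambda> h\<close> and \<open>1 - \<Lambda> h\<close>. So both equal \<open>\<Lambda>\<close>, unless one of the weights
vanishes, in which case positivity gives the claim.\<close>

lemma extreme_mult:
  assumes ext: "\<Lambda> extreme_point_of states X"
    and h: "cts X h" "\<And>x. x \<in> topspace X \<Longrightarrow> 0 \<le> h x \<and> h x \<le> 1" and f: "cts X f"
  shows "\<Lambda> (\<lambda>x. h x * f x) = \<Lambda> h * \<Lambda> f"
proof -
  have null: "\<Lambda> (\<lambda>x. k x * f x) = 0"
    if k: "cts X k" "\<And>x. x \<in> topspace X \<Longrightarrow> 0 \<le> k x" "\<Lambda> k = 0" for k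
  proof -
    obtain c where c: "\<And>x. x \<in> topspace X \<Longrightarrow> \<bar>f x\<bar> \<le> c"
      using bounded_cts[OF compact f] by blast
    have b: "k x * f x \<le> c * k x" "- c * k x \<le> k x * f x" if "x \<in> topspace X" for x
      using mult_left_mono[of "f x" c "k x"] mult_left_mono[of "- f x" c "k x"] c[OF that] k(2)[OF that]
      by (auto simp: abs_le_iff mult.commute)
    have "\<Lambda> (\<lambda>x. k x * f x) \<le> \<Lambda> (\<lambda>x. c * k x)" "\<Lambda> (\<lambda>x. - c * k x) \<le> \<Lambda> (\<lambda>x. k x * f x)"
      using k(1) f b by (auto intro!: mono continuous_map_real_mult)
    then show ?thesis unfolding scale[OF k(1)] k(3) by simp
  qed
  let ?k = "\<lambda>x. 1 - h x"
  have ck: "cts X ?k" using h by (intro continuous_map_diff) auto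
  have k: "\<Lambda> ?k = 1 - \<Lambda> h" using h by (simp add: diff const)
  have split: "\<Lambda> (\<lambda>x. ?k x * g x) = \<Lambda> g - \<Lambda> (\<lambda>x. h x * g x)" if "cts X g" for g
    using diff[of g "\<lambda>x. h x * g x"] h that by (simp add: continuous_map_real_mult left_diff_distrib)
  have h01: "0 \<le> \<Lambda> h" "\<Lambda> h \<le> 1"
    using h mono[of h "\<lambda>_. 1"] by (auto intro: nonneg simp: const)
  consider "\<Lambda> h = 0" | "\<Lambda> h = 1" | "0 < \<Lambda> h" "\<Lambda> h < 1" using h01 by linarith
  then show ?thesis
  proof cases
    case 1
    then show ?thesis using null[of h] h by simp
  next
    case 2
    then have "\<Lambda> (\<lambda>x. ?k x * f x) = 0" using k ck h by (intro null) auto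
    then show ?thesis using split[OF f] 2 by simp
  next
    case 3
    let ?D = "density_state h" and ?E = "density_state ?k"
    have DE: "?D \<in> states X" "?E \<in> states X"
      using h ck k 3 by (auto intro!: density_state_in_states)
    have comb: "\<Lambda> = (1 - \<Lambda> ?k) *\<^sub>R ?D + \<Lambda> ?k *\<^sub>R ?E"
    proof
      fix g
      show "\<Lambda> g = ((1 - \<Lambda> ?k) *\<^sub>R ?D + \<Lambda> ?k *\<^sub>R ?E) g"
        using 3 by (cases "cts X g") (simp_all add: density_state_def k split not_cts)
    qed
    have "\<Lambda> \<notin> open_segment ?D ?E"
      using ext DE by (auto simp: extreme_point_of_def)
    then have "?D = ?E"
      using comb 3 k unfolding in_segment by (metis diff_gt_0_iff_gt diff_less_eq less_add_same_cancel1)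
    then have "\<Lambda> = ?D"
      using comb by (simp add: scaleR_add_left[symmetric])
    then have "\<Lambda> f = ?D f" by simp
    then show ?thesis using 3 f by (simp add: density_state_def field_simps)
  qed
qed

text \<open>Otherwise finitely many nonnegative functions in the kernel of \<open>\<Lambda>\<close> would have, by compactness, a
strictly positive sum \<open>H\<close>; but a multiple of \<open>H\<close> dominates \<open>1\<close>.\<close>

lemma zero_set_point:
  "\<exists>x\<in>topspace X. \<forall>h. cts X h \<and> (\<forall>y\<in>topspace X. 0 \<le> h y) \<and> \<Lambda> h = 0 \<longrightarrow> h x = 0"
proof (rule ccontr)
  assume "\<not> ?thesis"
  then have "\<forall>x\<in>topspace X. \<exists>h. cts X h \<and> (\<forall>y\<in>topspace X. 0 \<le> h y) \<and> \<Lambda> h = 0 \<and> h x \<noteq> 0"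
    by blast
  from bchoice[OF this] obtain h where
    "\<forall>x\<in>topspace X. cts X (h x) \<and> (\<forall>y\<in>topspace X. 0 \<le> h x y) \<and> \<Lambda> (h x) = 0 \<and> h x x \<noteq> 0"
    by blast
  then have h: "\<And>x. x \<in> topspace X \<Longrightarrow> cts X (h x)"
     "\<And>x y. x \<in> topspace X \<Longrightarrow> y \<in> topspace X \<Longrightarrow> 0 \<le> h x y"
     "\<And>x. x \<in> topspace X \<Longrightarrow> \<Lambda> (h x) = 0" "\<And>x. x \<in> topspace X \<Longrightarrow> h x x \<noteq> 0"
    by blast+
  define V where "V = (\<lambda>x. {y \<in> topspace X. h x y \<in> {0<..}})"
  have "\<And>S. S \<in> V ` topspace X \<Longrightarrow> openin X S"
    unfolding V_def using openin_continuous_map_preimage[OF h(1)] by (auto simp del: greaterThan_iff)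
  moreover have "topspace X \<subseteq> \<Union>(V ` topspace X)"
    using h(2,4) by (force simp: V_def less_le)
  ultimately obtain \<F> where "finite \<F>" "\<F> \<subseteq> V ` topspace X" "topspace X \<subseteq> \<Union>\<F>"
    using compactinD[of X "topspace X" "V ` topspace X"] compact by (auto simp: compact_space_def)
  then obtain F where F: "finite F" "F \<subseteq> topspace X" "topspace X \<subseteq> (\<Union>x\<in>F. V x)"
    by (metis finite_subset_image)
  define H where "H = (\<lambda>y. \<Sum>x\<in>F. h x y)"
  have cH: "cts X H"
    unfolding H_def using F h(1) by (intro continuous_map_sum) auto
  have LH: "\<Lambda> H = 0"
    unfolding H_def using F h(1,3) by (subst state_sum) (auto intro!: sum.neutral)
  have pos: "0 < H y" if y: "y \<in> topspace X" for y
  proof -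
    obtain x where x: "x \<in> F" "y \<in> V x" using F y by auto
    then have "h x y \<le> H y"
      unfolding H_def using F h(2) y by (intro member_le_sum) auto
    with x show ?thesis by (auto simp: V_def)
  qed
  have "cts X (\<lambda>y. inverse (H y))"
    using pos by (intro continuous_map_real_inverse cH) fastforce
  then obtain c where c: "\<And>y. y \<in> topspace X \<Longrightarrow> \<bar>inverse (H y)\<bar> \<le> c"
    using bounded_cts[OF compact] by blast
  have "1 \<le> c * H y" if "y \<in> topspace X" for y
    using c[OF that] pos[OF that] by (simp add: field_simps)
  then have "\<Lambda> (\<lambda>_. 1) \<le> \<Lambda> (\<lambda>y. c * H y)"
    using cH by (intro mono continuous_map_real_mult) auto
  then show False unfolding scale[OF cH] LH one by simp
qed

text \<open>At the point \<open>x\<close> of the previous lemma, every \<open>f\<close> takes the value \<open>\<Lambda> f\<close>: rescale \<open>f\<close> to a function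
\<open>g\<close> with values in the unit interval; by multiplicativity \<open>(g - \<Lambda> g)\<^sup>2\<close> is a nonnegative function
in the kernel of \<open>\<Lambda>\<close>, so it vanishes at \<open>x\<close>.\<close>

theorem extreme_imp_dirac:
  assumes ext: "\<Lambda> extreme_point_of states X"
  shows "\<exists>x\<in>topspace X. \<Lambda> = dirac X x"
proof -
  obtain x where x: "x \<in> topspace X"
    and zero: "\<And>h. cts X h \<Longrightarrow> (\<And>y. y \<in> topspace X \<Longrightarrow> 0 \<le> h y) \<Longrightarrow> \<Lambda> h = 0 \<Longrightarrow> h x = 0"
    using zero_set_point by blast
  have "\<Lambda> f = f x" if f: "cts X f" for f
  proof -
    obtain c where c: "c > 0" "\<And>x. x \<in> topspace X \<Longrightarrow> \<bar>f x\<bar> \<le> c"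
      using bounded_cts[OF compact f] by blast
    define g where "g = (\<lambda>x. 1 / (2 * c) * (f x + c))"
    have cg: "cts X g"
      unfolding g_def using f by (intro continuous_map_real_mult continuous_map_add) auto
    have Lg: "\<Lambda> g = 1 / (2 * c) * (\<Lambda> f + c)"
      unfolding g_def using f by (subst scale) (auto simp: add const continuous_map_add)
    have g01: "0 \<le> g y \<and> g y \<le> 1" if "y \<in> topspace X" for y
      using c(1) c(2)[OF that] by (auto simp: g_def field_simps abs_le_iff)
    let ?a = "\<Lambda> g"
    define u where "u = (\<lambda>y. (g y * g y - 2 * ?a * g y) + ?a * ?a)"
    have cu: "cts X (\<lambda>y. g y * g y)" "cts X (\<lambda>y. 2 * ?a * g y)" "cts X (\<lambda>y. g y * g y - 2 * ?a * g y)" "cts X u"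
      unfolding u_def using cg
      by (auto intro!: continuous_map_add continuous_map_diff continuous_map_real_mult)
    have "\<Lambda> u = 0"
      unfolding u_def using cu cg
      by (simp add: add diff scale const extreme_mult[OF ext cg g01 cg])
    then have "u x = 0"
    proof (rule zero[OF cu(4), rotated])
      have "u y = (g y - ?a)\<^sup>2" for y by (simp add: u_def power2_eq_square algebra_simps)
      then show "0 \<le> u y" for y by simp
    qed
    then have "(g x - ?a)\<^sup>2 = 0" by (simp add: u_def power2_eq_square algebra_simps)
    then have "g x = ?a" by simp
    then show ?thesis using c(1) unfolding Lg by (simp add: g_def field_simps)
  qed
  then have "\<Lambda> = dirac X x"
    using not_cts by (force simp: dirac_def)
  then show ?thesis using x by blast
qed

end

text \<open>The set of point masses is compact, so it also contains the limits of extreme states.\<close>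

lemma ext_closure_states:
  assumes X: "compact_space X" "Hausdorff_space X"
  shows "ext_closure (states X) \<subseteq> dirac X ` topspace X"
proof (rule closure_minimal)
  show "{\<Lambda>. \<Lambda> extreme_point_of states X} \<subseteq> dirac X ` topspace X"
  proof clarify
    fix \<Lambda> assume e: "\<Lambda> extreme_point_of states X"
    then have "\<Lambda> \<in> states X" by (simp add: extreme_point_of_def)
    then interpret state X \<Lambda> using X by unfold_locales
    show "\<Lambda> \<in> dirac X ` topspace X" using extreme_imp_dirac[OF e] by blast
  qed
  have "compactin euclidean (dirac X ` topspace X)"
    using X continuous_map_dirac image_compactin by (metis compact_space_def)
  then show "closed (dirac X ` topspace X)"
    by (simp add: compact_imp_closed)
qed

section \<open>The affine flow of states\<close>

lemma flow_action_in:
  assumes G: "topological_group G T" and X: "flow G T X \<alpha>" and g: "g \<in> carrier G" and x: "x \<in> topspace X"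
  shows "\<alpha> g x \<in> topspace X"
  using flow_continuous_map[OF G X g] x by (auto simp: continuous_map_def)

text \<open>The equivalence, and not only one implication, is what makes the push-forward respect the
convention that states are \<open>0\<close> on discontinuous functions.\<close>

lemma cts_translate_iff:
  assumes G: "topological_group G T" and X: "flow G T X \<alpha>" and g: "g \<in> carrier G"
  shows "cts X (\<lambda>x. f (\<alpha> g x)) \<longleftrightarrow> cts X f"
proof
  interpret group G using G by (simp add: topological_group_def)
  have gi: "\<alpha> g (\<alpha> (inv\<^bsub>G\<^esub> g) x) = x" if "x \<in> topspace X" for x
    using X g that unfolding flow_def by (metis inv_closed r_inv)
  assume "cts X (\<lambda>x. f (\<alpha> g x))"
  then have "cts X ((\<lambda>x. f (\<alpha> g x)) \<circ> \<alpha> (inv\<^bsub>G\<^esub> g))"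
    using flow_continuous_map[OF G X, of "inv\<^bsub>G\<^esub> g"] g by (intro continuous_map_compose) auto
  then show "cts X f"
    by (rule continuous_map_eq) (simp add: gi)
next
  assume "cts X f"
  from continuous_map_compose[OF flow_continuous_map[OF G X g] this]
  show "cts X (\<lambda>x. f (\<alpha> g x))" by (simp add: o_def)
qed

lemma push_forward_in_states:
  assumes G: "topological_group G T" and X: "flow G T X \<alpha>" and g: "g \<in> carrier G"
    and L: "\<Lambda> \<in> states X"
  shows "push_forward \<alpha> g \<Lambda> \<in> states X"
  using L flow_action_in[OF G X g] unfolding states_def push_forward_def mem_Collect_eq
  by (simp add: cts_translate_iff[OF G X g])

lemma push_forward_dirac:
  assumes G: "topological_group G T" and X: "flow G T X \<alpha>" and g: "g \<in> carrier G"
  shows "push_forward \<alpha> g (dirac X x) = dirac X (\<alpha> g x)"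
  by (simp add: push_forward_def dirac_def cts_translate_iff[OF G X g])

text \<open>An application of the tube lemma along the compact space \<open>X\<close>.\<close>

lemma translates_uniformly_close:
  assumes G: "topological_group G T" and X: "flow G T X \<alpha>" and g: "g \<in> carrier G"
    and f: "cts X f" and e: "0 < e"
  shows "\<exists>N. openin T N \<and> g \<in> N \<and> (\<forall>h\<in>N. \<forall>x\<in>topspace X. \<bar>f (\<alpha> h x) - f (\<alpha> g x)\<bar> < e)"
proof -
  have tT: "topspace T = carrier G" using G by (simp add: topological_group_def)
  have c: "cts (prod_topology T X) (\<lambda>(h, x). f (\<alpha> h x))"
  proof -
    have "continuous_map (prod_topology T X) X (\<lambda>(h, x). \<alpha> h x)"
      using X by (simp add: flow_def)
    from continuous_map_compose[OF this f] show ?thesis by (simp add: o_def case_prod_unfold)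
  qed
  have c': "cts (prod_topology T X) (\<lambda>(h, x). f (\<alpha> g x))"
    using continuous_map_compose[OF continuous_map_snd[of T X], of euclideanreal "\<lambda>x. f (\<alpha> g x)"]
      cts_translate_iff[OF G X g] f
    by (simp add: o_def case_prod_unfold)
  define D where "D = (\<lambda>(h, x). f (\<alpha> h x) - f (\<alpha> g x))"
  have cD: "cts (prod_topology T X) D"
    using continuous_map_diff[OF c c'] by (simp add: D_def case_prod_unfold)
  have op: "openin (prod_topology T X) {p \<in> topspace (prod_topology T X). D p \<in> {-e<..<e}}"
    by (rule openin_continuous_map_preimage[OF cD]) auto
  have sub: "{g} \<times> topspace X \<subseteq> {p \<in> topspace (prod_topology T X). D p \<in> {-e<..<e}}"
    using g e by (auto simp: D_def tT)
  have "compactin X (topspace X)" using X by (simp add: flow_def compact_space_def)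
  from tube_lemma_right[OF op this _ sub] g tT obtain U V where U: "openin T U" "g \<in> U" "topspace X \<subseteq> V"
      "U \<times> V \<subseteq> {p \<in> topspace (prod_topology T X). D p \<in> {-e<..<e}}"
    by blast
  have "\<bar>f (\<alpha> h x) - f (\<alpha> g x)\<bar> < e" if "h \<in> U" "x \<in> topspace X" for h x
  proof -
    have "(h, x) \<in> U \<times> V" using that U(3) by auto
    then have "D (h, x) \<in> {-e<..<e}" using U(4) by auto
    then show ?thesis by (auto simp: D_def abs_less_iff)
  qed
  then show ?thesis using U by blast
qed

text \<open>It suffices to consider the evaluation at one continuous \<open>f\<close>. States are contractions for the
supremum norm, and the translates of \<open>f\<close> vary continuously in that norm, so the two arguments can be
moved one after the other.\<close>

lemma continuous_push_forward:
  assumes G: "topological_group G T" and X: "flow G T X \<alpha>"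
  shows "continuous_map (prod_topology T (top_of_set (states X))) (top_of_set (states X))
           (\<lambda>(g, \<Lambda>). push_forward \<alpha> g \<Lambda>)"
    (is "continuous_map ?P _ ?F")
proof (rule continuous_map_into_subtopology)
  have tT: "topspace T = carrier G" using G by (simp add: topological_group_def)
  have XX: "compact_space X" "Hausdorff_space X" using X by (auto simp: flow_def)
  show "?F \<in> topspace ?P \<rightarrow> states X"
    using push_forward_in_states[OF G X] by (auto simp: tT)
  have "cts ?P (\<lambda>p. ?F p f)" for f
  proof (cases "cts X f")
    case False
    have "cts ?P (\<lambda>_. 0)" by simp
    then show ?thesis
    proof (rule continuous_map_eq)
      fix p assume "p \<in> topspace ?P"
      then obtain g \<Lambda> where p: "p = (g, \<Lambda>)" "g \<in> carrier G" "\<Lambda> \<in> states X" by (auto simp: tT)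
      then have "push_forward \<alpha> g \<Lambda> \<in> states X" by (intro push_forward_in_states[OF G X])
      then show "0 = ?F p f" using False p(1) by (simp add: states_def)
    qed
  next
    case True
    show ?thesis
      unfolding continuous_map_def
    proof (intro conjI allI impI)
      fix U :: "real set" assume U: "openin euclideanreal U"
      show "openin ?P {p \<in> topspace ?P. ?F p f \<in> U}"
      proof (subst openin_subopen, rule ballI)
        fix q assume "q \<in> {p \<in> topspace ?P. ?F p f \<in> U}"
        then obtain g \<Lambda> where q: "q = (g, \<Lambda>)" and g: "g \<in> carrier G" and L: "\<Lambda> \<in> states X"
          and FU: "push_forward \<alpha> g \<Lambda> f \<in> U"
          by (auto simp: tT)
        let ?fg = "\<lambda>x. f (\<alpha> g x)"
        have cg: "cts X ?fg" using True by (simp add: cts_translate_iff[OF G X g])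
        have "\<Lambda> ?fg \<in> U" using FU by (simp add: push_forward_def)
        then obtain e where e: "0 < e" "ball (\<Lambda> ?fg) e \<subseteq> U"
          using U by (auto simp: elim: openE)
        obtain N where N: "openin T N" "g \<in> N" "\<And>h x. h \<in> N \<Longrightarrow> x \<in> topspace X \<Longrightarrow> \<bar>f (\<alpha> h x) - ?fg x\<bar> < e / 2"
          using translates_uniformly_close[OF G X g True, of "e / 2"] e by auto
        define N' where "N' = states X \<inter> (\<lambda>\<Lambda>. \<Lambda> ?fg) -` ball (\<Lambda> ?fg) (e / 2)"
        have "openin (top_of_set (states X)) N'"
          unfolding N'_def by (intro openin_open_Int open_vimage_coordinate open_ball)
        with N have "openin ?P (N \<times> N')" by (simp add: openin_prod_Times_iff)
        moreover have "q \<in> N \<times> N'" using N L e by (simp add: N'_def q)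
        moreover have "N \<times> N' \<subseteq> {p \<in> topspace ?P. ?F p f \<in> U}"
        proof
          fix p assume "p \<in> N \<times> N'"
          then obtain h \<Lambda>' where p: "p = (h, \<Lambda>')" and h: "h \<in> N" and L': "\<Lambda>' \<in> N'" by blast
          have hG: "h \<in> carrier G" using h openin_subset[OF N(1)] tT by auto
          have s: "\<Lambda>' \<in> states X" "\<bar>\<Lambda>' ?fg - \<Lambda> ?fg\<bar> < e / 2"
            using L' by (auto simp: N'_def dist_real_def abs_minus_commute)
          interpret L': state X \<Lambda>' using XX s by unfold_locales auto
          have ch: "cts X (\<lambda>x. f (\<alpha> h x))" using True by (simp add: cts_translate_iff[OF G X hG])
          have "\<bar>\<Lambda>' (\<lambda>x. f (\<alpha> h x) - ?fg x)\<bar> \<le> e / 2"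
            using N(3)[OF h] ch cg by (intro L'.abs_le continuous_map_diff) (auto intro: less_imp_le)
          then have "\<bar>\<Lambda>' (\<lambda>x. f (\<alpha> h x)) - \<Lambda>' ?fg\<bar> \<le> e / 2"
            by (simp add: L'.diff ch cg)
          with s have "\<Lambda>' (\<lambda>x. f (\<alpha> h x)) \<in> ball (\<Lambda> ?fg) e"
            unfolding mem_ball dist_real_def by linarith
          then have "?F p f \<in> U"
            using e(2) by (auto simp: push_forward_def p)
          then show "p \<in> {p \<in> topspace ?P. ?F p f \<in> U}"
            using s(1) hG by (simp add: tT p)
        qed
        ultimately show "\<exists>S. openin ?P S \<and> q \<in> S \<and> S \<subseteq> {p \<in> topspace ?P. ?F p f \<in> U}"
          by blast
      qed
    qed simp
  qed
  then show "continuous_map ?P euclidean ?F"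
    unfolding euclidean_product_topology[symmetric] continuous_map_componentwise_UNIV by blast
qed

theorem affine_flow_states:
  assumes G: "topological_group G T" and X: "flow G T X \<alpha>"
  shows "affine_flow G T (states X) (push_forward \<alpha>)"
  unfolding affine_flow_def flow_def
proof (intro conjI ballI)
  have XX: "compact_space X" "Hausdorff_space X" "topspace X \<noteq> {}"
    using X by (auto simp: flow_def)
  interpret group G using G by (simp add: topological_group_def)
  have act: "\<alpha> \<one>\<^bsub>G\<^esub> x = x" "\<And>g h. g \<in> carrier G \<Longrightarrow> h \<in> carrier G \<Longrightarrow> \<alpha> (g \<otimes>\<^bsub>G\<^esub> h) x = \<alpha> g (\<alpha> h x)"
    if "x \<in> topspace X" for x
    using X that unfolding flow_def by blast+
  have cong: "\<Lambda> f = \<Lambda> f'" if L: "\<Lambda> \<in> states X" and f: "\<And>x. x \<in> topspace X \<Longrightarrow> f x = f' x" for \<Lambda> f f'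
  proof -
    interpret state X \<Lambda> using XX L by unfold_locales auto
    have iff: "cts X f \<longleftrightarrow> cts X f'"
      using f by (auto intro: continuous_map_eq)
    show ?thesis
    proof (cases "cts X f")
      case True
      then show ?thesis using iff f mono[of f f'] mono[of f' f] by (auto intro!: antisym)
    qed (use iff in \<open>simp add: not_cts\<close>)
  qed
  show "convex (states X)" by (rule convex_states)
  show "topspace (top_of_set (states X)) \<noteq> {}"
    using XX(3) dirac_in_states by fastforce
  show "compact_space (top_of_set (states X))"
    using compact_states[OF XX(1,2)] by (simp add: compact_space_subtopology)
  show "Hausdorff_space (top_of_set (states X))"
    by (rule Hausdorff_space_top_of_set)
  show "continuous_map (prod_topology T (top_of_set (states X))) (top_of_set (states X))
           (\<lambda>(g, \<Lambda>). push_forward \<alpha> g \<Lambda>)"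
    by (rule continuous_push_forward[OF G X])
  show "push_forward \<alpha> \<one>\<^bsub>G\<^esub> \<Lambda> = \<Lambda>" if "\<Lambda> \<in> topspace (top_of_set (states X))" for \<Lambda>
  proof
    show "push_forward \<alpha> \<one>\<^bsub>G\<^esub> \<Lambda> f = \<Lambda> f" for f
      unfolding push_forward_def using that by - (rule cong[of \<Lambda>], simp_all add: act)
  qed
  show "push_forward \<alpha> (g \<otimes>\<^bsub>G\<^esub> h) \<Lambda> = push_forward \<alpha> g (push_forward \<alpha> h \<Lambda>)"
    if "g \<in> carrier G" "h \<in> carrier G" "\<Lambda> \<in> topspace (top_of_set (states X))" for g h \<Lambda>
  proof
    show "push_forward \<alpha> (g \<otimes>\<^bsub>G\<^esub> h) \<Lambda> f = push_forward \<alpha> g (push_forward \<alpha> h \<Lambda>) f" for f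
      unfolding push_forward_def using that by - (rule cong[of \<Lambda>], simp_all add: act)
  qed
  show "affine_map_on (states X) (push_forward \<alpha> g)" for g
    by (simp add: affine_map_on_def push_forward_def fun_eq_iff)
qed

section \<open>Proximally irreducible extensions of the flow of states\<close>

text \<open>The common situation of the remaining lemmas: a proximally irreducible extension \<open>\<phi>\<close> of the flow of
states of a minimal proximal flow \<open>X\<close>. Universality of \<open>X\<close> enters only at the end, through a factor
map from \<open>X\<close> to a minimal proximal flow found inside \<open>L\<close>.\<close>

locale irreducible_over_states =
  fixes G :: "('g, 'm) monoid_scheme" and T :: "'g topology"
    and X :: "'x topology" and \<alpha> :: "'g \<Rightarrow> 'x \<Rightarrow> 'x"
    and L :: "'v::hausdorff_lctvs set" and \<sigma> :: "'g \<Rightarrow> 'v \<Rightarrow> 'v"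
    and \<phi> :: "'v \<Rightarrow> ('x \<Rightarrow> real) \<Rightarrow> real"
  assumes topological_group: "topological_group G T"
    and minimal: "minimal_flow G T X \<alpha>" and proximal: "proximal_flow G T X \<alpha>"
    and affine_flow: "affine_flow G T L \<sigma>"
    and irreducible: "proximally_irreducible_extension G L \<sigma> (states X) (push_forward \<alpha>) \<phi>"
begin

lemma X_flow: "flow G T X \<alpha>" and compact_X: "compact_space X" and Hausdorff_X: "Hausdorff_space X"
  and X_nonempty: "topspace X \<noteq> {}"
  using minimal by (auto simp: minimal_flow_def flow_def)

lemma group_one: "\<one>\<^bsub>G\<^esub> \<in> carrier G"
  and group_mult: "g \<in> carrier G \<Longrightarrow> h \<in> carrier G \<Longrightarrow> g \<otimes>\<^bsub>G\<^esub> h \<in> carrier G"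
  using topological_group unfolding topological_group_def
  by (auto intro: group.is_monoid monoid.one_closed monoid.m_closed)

lemma X_orbit_dense:
  assumes "x \<in> topspace X" "closedin X S" "\<And>g. g \<in> carrier G \<Longrightarrow> \<alpha> g x \<in> S"
  shows "topspace X \<subseteq> S"
proof -
  have "X closure_of ((\<lambda>g. \<alpha> g x) ` carrier G) \<subseteq> S"
    using assms by (intro closure_of_minimal) auto
  then show ?thesis using minimal assms(1) by (simp add: minimal_flow_def)
qed

lemma L_flow: "flow G T (top_of_set L) \<sigma>" and convex_L: "convex L"
  using affine_flow by (auto simp: affine_flow_def)

lemma compact_L: "compact L" and L_nonempty: "L \<noteq> {}"
  using L_flow by (auto simp: flow_def compact_space_subtopology compact_space_def compactin_subtopology)

lemma closed_L: "closed L"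
  using compact_L by (rule compact_imp_closed)

lemma \<sigma>_continuous: "g \<in> carrier G \<Longrightarrow> continuous_on L (\<sigma> g)"
  using flow_continuous_map[OF topological_group L_flow]
  by (force simp: continuous_map_in_subtopology continuous_map_iff_continuous)

lemma \<sigma>_in: "g \<in> carrier G \<Longrightarrow> x \<in> L \<Longrightarrow> \<sigma> g x \<in> L"
  using flow_action_in[OF topological_group L_flow] by simp

lemma \<sigma>_one: "x \<in> L \<Longrightarrow> \<sigma> \<one>\<^bsub>G\<^esub> x = x"
  using L_flow unfolding flow_def by simp

lemma \<sigma>_mult: "g \<in> carrier G \<Longrightarrow> h \<in> carrier G \<Longrightarrow> x \<in> L \<Longrightarrow> \<sigma> (g \<otimes>\<^bsub>G\<^esub> h) x = \<sigma> g (\<sigma> h x)"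
  using L_flow unfolding flow_def by simp

lemma \<sigma>_affine:
  assumes "g \<in> carrier G" "x \<in> L" "y \<in> L" "0 \<le> u" "0 \<le> v" "u + v = 1"
  shows "\<sigma> g (u *\<^sub>R x + v *\<^sub>R y) = u *\<^sub>R \<sigma> g x + v *\<^sub>R \<sigma> g y"
proof -
  have "u = 1 - v" "v \<le> 1" using assms by auto
  then show ?thesis using affine_flow assms unfolding affine_flow_def affine_map_on_def by blast
qed

lemma extension: "affine_extension G L \<sigma> (states X) (push_forward \<alpha>) \<phi>"
  using irreducible by (simp add: proximally_irreducible_extension_def)

lemma \<phi>_continuous: "continuous_on L \<phi>" and \<phi>_image: "\<phi> ` L = states X"
  and \<phi>_equivariant: "g \<in> carrier G \<Longrightarrow> x \<in> L \<Longrightarrow> \<phi> (\<sigma> g x) = push_forward \<alpha> g (\<phi> x)"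
  using extension
  by (auto simp: affine_extension_def factor_map_def continuous_map_in_subtopology continuous_map_iff_continuous)

lemma \<phi>_affine:
  assumes "x \<in> L" "y \<in> L" "0 \<le> u" "0 \<le> v" "u + v = 1"
  shows "\<phi> (u *\<^sub>R x + v *\<^sub>R y) = u *\<^sub>R \<phi> x + v *\<^sub>R \<phi> y"
proof -
  have "u = 1 - v" "v \<le> 1" using assms by auto
  then show ?thesis using extension assms unfolding affine_extension_def affine_map_on_def by blast
qed

lemma \<phi>_dirac: "g \<in> carrier G \<Longrightarrow> x \<in> L \<Longrightarrow> \<phi> x = dirac X p \<Longrightarrow> \<phi> (\<sigma> g x) = dirac X (\<alpha> g p)"
  by (simp add: \<phi>_equivariant push_forward_dirac[OF topological_group X_flow])

text \<open>Irreducibility in the form in which it is used: the points of the closed extreme boundary of the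
base are point masses.\<close>

lemma L_eq:
  assumes "affine_subflow G \<sigma> L C"
    and "\<And>x. x \<in> topspace X \<Longrightarrow> C \<inter> convex hull (ext_closure L \<inter> {l \<in> L. \<phi> l = dirac X x}) \<noteq> {}"
  shows "C = L"
proof -
  have "C \<inter> convex hull (ext_closure L \<inter> {l \<in> L. \<phi> l = y}) \<noteq> {}" if "y \<in> ext_closure (states X)" for y
    using that assms(2) ext_closure_states[OF compact_X Hausdorff_X] by blast
  then show ?thesis
    using irreducible assms(1) unfolding proximally_irreducible_extension_def by blast
qed

abbreviation Y :: "'v set" where "Y \<equiv> ext_closure L"

lemma Y_subset: "Y \<subseteq> L"
  by (rule closure_minimal[OF _ closed_L]) (auto simp: extreme_point_of_def)

lemma compact_Y: "compact Y"
  using closed_Int_compact[of Y L] compact_L Y_subset by (simp add: Int_absorb2)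

text \<open>Group elements act by affine bijections of \<open>L\<close>.\<close>

lemma \<sigma>_extreme:
  assumes g: "g \<in> carrier G" and e: "e extreme_point_of L"
  shows "\<sigma> g e extreme_point_of L"
  unfolding extreme_point_of_def
proof (intro conjI ballI notI)
  interpret group G using topological_group by (simp add: topological_group_def)
  let ?h = "inv\<^bsub>G\<^esub> g"
  have eL: "e \<in> L" using e by (simp add: extreme_point_of_def)
  then show "\<sigma> g e \<in> L" using g by (intro \<sigma>_in)
  have hg: "\<sigma> ?h (\<sigma> g x) = x" "\<sigma> g (\<sigma> ?h x) = x" if "x \<in> L" for x
    using \<sigma>_mult[of ?h g x] \<sigma>_mult[of g ?h x] g that by (simp_all add: \<sigma>_one)
  fix a b assume ab: "a \<in> L" "b \<in> L" "\<sigma> g e \<in> open_segment a b"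
  then obtain u where u: "0 < u" "u < 1" "\<sigma> g e = (1 - u) *\<^sub>R a + u *\<^sub>R b" "a \<noteq> b"
    by (auto simp: in_segment)
  have "\<sigma> ?h (\<sigma> g e) = (1 - u) *\<^sub>R \<sigma> ?h a + u *\<^sub>R \<sigma> ?h b"
    unfolding u(3) using g ab u by (intro \<sigma>_affine) auto
  moreover have "\<sigma> ?h a \<noteq> \<sigma> ?h b" using hg(2)[OF ab(1)] hg(2)[OF ab(2)] u(4) by metis
  ultimately have "e \<in> open_segment (\<sigma> ?h a) (\<sigma> ?h b)"
    using hg(1)[OF eL] u unfolding in_segment by metis
  moreover have "\<sigma> ?h a \<in> L" "\<sigma> ?h b \<in> L" using ab g by (auto intro: \<sigma>_in)
  ultimately show False using e by (auto simp: extreme_point_of_def)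
qed

lemma \<sigma>_Y:
  assumes g: "g \<in> carrier G" and y: "y \<in> Y"
  shows "\<sigma> g y \<in> Y"
proof -
  have "\<sigma> g ` Y \<subseteq> Y"
  proof (rule image_closure_subset)
    show "continuous_on Y (\<sigma> g)"
      by (rule continuous_on_subset[OF \<sigma>_continuous[OF g] Y_subset])
    show "\<sigma> g ` {x. x extreme_point_of L} \<subseteq> Y"
      using \<sigma>_extreme[OF g] by (auto intro!: closure_subset[THEN subsetD])
  qed simp
  then show ?thesis using y by blast
qed

text \<open>Proximality of \<open>a\<close> and \<open>b\<close> is expressed through the orbit of the pair in the product: \<open>a\<close> and \<open>b\<close> are
proximal iff its closure meets the diagonal. The orbit of a single point is the case \<open>a = b\<close>.\<close>

definition pair_orbit :: "'v \<Rightarrow> 'v \<Rightarrow> ('v \<times> 'v) set" where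
  "pair_orbit a b = (\<lambda>g. (\<sigma> g a, \<sigma> g b)) ` carrier G"

lemma pair_orbit_closure_subset:
  assumes "closed S" "\<And>g. g \<in> carrier G \<Longrightarrow> \<sigma> g a \<in> S" "\<And>g. g \<in> carrier G \<Longrightarrow> \<sigma> g b \<in> S"
  shows "closure (pair_orbit a b) \<subseteq> S \<times> S"
  using assms by (intro closure_minimal closed_Times) (auto simp: pair_orbit_def)

lemma pair_orbit_closure_L: "a \<in> L \<Longrightarrow> b \<in> L \<Longrightarrow> closure (pair_orbit a b) \<subseteq> L \<times> L"
  by (intro pair_orbit_closure_subset closed_L \<sigma>_in)

lemma pair_orbit_closure_Y: "a \<in> Y \<Longrightarrow> b \<in> Y \<Longrightarrow> closure (pair_orbit a b) \<subseteq> Y \<times> Y"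
  by (intro pair_orbit_closure_subset closed_closure \<sigma>_Y)

lemma compact_pair_orbit:
  assumes "a \<in> L" "b \<in> L" shows "compact (closure (pair_orbit a b))"
  using closed_Int_compact[of "closure (pair_orbit a b)" "L \<times> L"] pair_orbit_closure_L[OF assms]
  by (simp add: Int_absorb2 compact_Times compact_L)

lemma pair_orbit_closure_trans:
  assumes ab: "a \<in> L" "b \<in> L" and p: "(a', b') \<in> closure (pair_orbit a b)"
  shows "closure (pair_orbit a' b') \<subseteq> closure (pair_orbit a b)"
proof (rule closure_minimal)
  show "pair_orbit a' b' \<subseteq> closure (pair_orbit a b)"
    unfolding pair_orbit_def[of a' b']
  proof clarify
    fix g assume g: "g \<in> carrier G"
    have "(\<lambda>p. (\<sigma> g (fst p), \<sigma> g (snd p))) ` closure (pair_orbit a b) \<subseteq> closure (pair_orbit a b)"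
    proof (rule image_closure_subset)
      have "continuous_on (L \<times> L) (\<lambda>p. (\<sigma> g (fst p), \<sigma> g (snd p)))"
        by (intro continuous_on_Pair continuous_on_compose2[OF \<sigma>_continuous[OF g]] continuous_intros) auto
      then show "continuous_on (closure (pair_orbit a b)) (\<lambda>p. (\<sigma> g (fst p), \<sigma> g (snd p)))"
        by (rule continuous_on_subset[OF _ pair_orbit_closure_L[OF ab]])
      have "(\<lambda>p. (\<sigma> g (fst p), \<sigma> g (snd p))) ` pair_orbit a b \<subseteq> pair_orbit a b"
      proof
        fix q assume "q \<in> (\<lambda>p. (\<sigma> g (fst p), \<sigma> g (snd p))) ` pair_orbit a b"
        then obtain h where h: "h \<in> carrier G" "q = (\<sigma> g (\<sigma> h a), \<sigma> g (\<sigma> h b))"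
          by (auto simp: pair_orbit_def)
        then have "q = (\<sigma> (g \<otimes>\<^bsub>G\<^esub> h) a, \<sigma> (g \<otimes>\<^bsub>G\<^esub> h) b)"
          using g ab by (simp add: \<sigma>_mult)
        then show "q \<in> pair_orbit a b"
          unfolding pair_orbit_def using group_mult[OF g h(1)] by blast
      qed
      then show "(\<lambda>p. (\<sigma> g (fst p), \<sigma> g (snd p))) ` pair_orbit a b \<subseteq> closure (pair_orbit a b)"
        using closure_subset by blast
    qed simp
    then have "(\<sigma> g (fst (a', b')), \<sigma> g (snd (a', b'))) \<in> closure (pair_orbit a b)"
      using p by blast
    then show "(\<sigma> g a', \<sigma> g b') \<in> closure (pair_orbit a b)" by simp
  qed
qed simp

definition \<phi>_pair :: "'v \<times> 'v \<Rightarrow> (('x \<Rightarrow> real) \<Rightarrow> real) \<times> (('x \<Rightarrow> real) \<Rightarrow> real)" where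
  "\<phi>_pair p = (\<phi> (fst p), \<phi> (snd p))"

lemma closed_\<phi>_pair_orbit:
  assumes ab: "a \<in> L" "b \<in> L"
  shows "closed (\<phi>_pair ` closure (pair_orbit a b))"
proof -
  have "continuous_on (L \<times> L) \<phi>_pair"
    unfolding \<phi>_pair_def
    by (intro continuous_on_Pair continuous_on_compose2[OF \<phi>_continuous] continuous_intros) auto
  then have "compact (\<phi>_pair ` closure (pair_orbit a b))"
    using pair_orbit_closure_L[OF ab] compact_pair_orbit[OF ab]
    by (intro compact_continuous_image) (rule continuous_on_subset)
  then show ?thesis by (rule compact_imp_closed)
qed

lemma dirac_pair_in_\<phi>_pair_orbit:
  assumes g: "g \<in> carrier G" and ab: "a \<in> L" "b \<in> L" "\<phi> a = dirac X x" "\<phi> b = dirac X x'"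
  shows "(dirac X (\<alpha> g x), dirac X (\<alpha> g x')) \<in> \<phi>_pair ` closure (pair_orbit a b)"
proof
  show "(dirac X (\<alpha> g x), dirac X (\<alpha> g x')) = \<phi>_pair (\<sigma> g a, \<sigma> g b)"
    using \<phi>_dirac[OF g] ab by (simp add: \<phi>_pair_def)
  show "(\<sigma> g a, \<sigma> g b) \<in> closure (pair_orbit a b)"
    using g closure_subset by (fastforce simp: pair_orbit_def)
qed

text \<open>The points \<open>x'\<close> of \<open>X\<close> for which the conclusion holds form a closed set, by compactness of the orbit
closure, and this set contains the orbit of \<open>x\<close>, which is dense.\<close>

lemma pair_orbit_meets_fibres:
  assumes ab: "a \<in> L" "b \<in> L" and x: "x \<in> topspace X" "\<phi> a = dirac X x" "\<phi> b = dirac X x"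
    and x': "x' \<in> topspace X"
  shows "\<exists>u v. (u, v) \<in> closure (pair_orbit a b) \<and> \<phi> u = dirac X x' \<and> \<phi> v = dirac X x'"
proof -
  define D where "D = \<phi>_pair ` closure (pair_orbit a b)"
  have D: "closed D" unfolding D_def by (rule closed_\<phi>_pair_orbit[OF ab])
  have "continuous_map X (prod_topology euclidean euclidean) (\<lambda>x. (dirac X x, dirac X x))"
    by (intro continuous_map_pairedI continuous_map_dirac)
  then have c: "continuous_map X euclidean (\<lambda>x. (dirac X x, dirac X x))"
    by simp
  have cl: "closedin X {x \<in> topspace X. (dirac X x, dirac X x) \<in> D}"
    by (rule closedin_continuous_map_preimage[OF c]) (simp add: D)
  have "topspace X \<subseteq> {x \<in> topspace X. (dirac X x, dirac X x) \<in> D}"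
  proof (rule X_orbit_dense[OF x(1) cl])
    fix g assume g: "g \<in> carrier G"
    have "(dirac X (\<alpha> g x), dirac X (\<alpha> g x)) \<in> D"
      unfolding D_def by (rule dirac_pair_in_\<phi>_pair_orbit[OF g ab x(2,3)])
    then show "\<alpha> g x \<in> {x \<in> topspace X. (dirac X x, dirac X x) \<in> D}"
      using flow_action_in[OF topological_group X_flow g x(1)] by simp
  qed
  then have "(dirac X x', dirac X x') \<in> D" using x' by blast
  then show ?thesis unfolding D_def \<phi>_pair_def by fastforce
qed

lemma pair_midpoint_pair_orbit:
  assumes "a \<in> L" "b \<in> L"
  shows "pair_midpoint ` pair_orbit a b = (\<lambda>g. \<sigma> g (pair_midpoint (a, b))) ` carrier G"
proof -
  have "pair_midpoint (\<sigma> g a, \<sigma> g b) = \<sigma> g (pair_midpoint (a, b))" if "g \<in> carrier G" for g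
    using that assms by (simp add: pair_midpoint_def \<sigma>_affine)
  then show ?thesis by (auto simp: pair_orbit_def image_iff)
qed

lemma affine_subflow_generated:
  assumes c: "c \<in> L"
  shows "affine_subflow G \<sigma> L (closure (convex hull ((\<lambda>g. \<sigma> g c) ` carrier G)))"
    (is "affine_subflow _ _ _ (closure (convex hull ?O))")
  unfolding affine_subflow_def
proof (intro conjI ballI)
  have O: "?O \<subseteq> L" using c \<sigma>_in by auto
  show sub: "closure (convex hull ?O) \<subseteq> L"
    using O by (intro closure_minimal hull_minimal closed_L convex_L)
  show "closure (convex hull ?O) \<noteq> {}" using group_one by auto
  show cv: "convex (closure (convex hull ?O))"
    by (intro convex_closure_lctvs convex_convex_hull)
  fix g x assume g: "g \<in> carrier G" and x: "x \<in> closure (convex hull ?O)"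
  define B where "B = {y \<in> L. \<sigma> g y \<in> closure (convex hull ?O)}"
  have "convex B"
  proof (rule convexI)
    fix y z and u v :: real
    assume y: "y \<in> B" and z: "z \<in> B" and uv: "0 \<le> u" "0 \<le> v" "u + v = 1"
    have "u *\<^sub>R y + v *\<^sub>R z \<in> L"
      using convexD[OF convex_L] y z uv by (simp add: B_def)
    moreover have "\<sigma> g (u *\<^sub>R y + v *\<^sub>R z) = u *\<^sub>R \<sigma> g y + v *\<^sub>R \<sigma> g z"
      using y z uv g by (intro \<sigma>_affine) (auto simp: B_def)
    moreover have "u *\<^sub>R \<sigma> g y + v *\<^sub>R \<sigma> g z \<in> closure (convex hull ?O)"
      using convexD[OF cv] y z uv by (simp add: B_def)
    ultimately show "u *\<^sub>R y + v *\<^sub>R z \<in> B" by (simp add: B_def)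
  qed
  moreover have "closed B"
    using continuous_closed_preimage[OF \<sigma>_continuous[OF g] closed_L closed_closure[of "convex hull ?O"]]
    by (simp add: B_def vimage_def Int_def)
  moreover have "?O \<subseteq> B"
  proof clarify
    fix h assume h: "h \<in> carrier G"
    have "\<sigma> g (\<sigma> h c) \<in> ?O"
      using \<sigma>_mult[OF g h c] group_mult[OF g h] by (metis imageI)
    then have "\<sigma> g (\<sigma> h c) \<in> closure (convex hull ?O)"
      by (meson closure_subset hull_inc subsetD)
    then show "\<sigma> h c \<in> B" using h c by (simp add: B_def \<sigma>_in)
  qed
  ultimately have "closure (convex hull ?O) \<subseteq> B"
    by (intro closure_minimal hull_minimal)
  then show "\<sigma> g x \<in> closure (convex hull ?O)" using x by (auto simp: B_def)
qed simp

text \<open>Here irreducibility enters. The closed convex hull of the orbit of the midpoint is an affine subflow.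
Over each \<open>x'\<close> the closure of the orbit of \<open>(a, b)\<close> contains a pair \<open>(u, v)\<close> in the fibre, with
\<open>u\<close> and \<open>v\<close> in the closed extreme boundary; its midpoint lies both in the subflow and in the finite
convex hull that the subflow has to meet.\<close>

lemma L_generated_by_midpoint:
  assumes ab: "a \<in> Y" "b \<in> Y" and x: "x \<in> topspace X" "\<phi> a = dirac X x" "\<phi> b = dirac X x"
  shows "closure (convex hull ((\<lambda>g. \<sigma> g (pair_midpoint (a, b))) ` carrier G)) = L"
    (is "closure (convex hull ?O) = L")
proof (rule L_eq)
  have abL: "a \<in> L" "b \<in> L" using ab Y_subset by auto
  show "affine_subflow G \<sigma> L (closure (convex hull ?O))"
    using abL by (intro affine_subflow_generated pair_midpoint_in convex_L)
  fix x' assume x': "x' \<in> topspace X"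
  obtain u v where uv: "(u, v) \<in> closure (pair_orbit a b)" "\<phi> u = dirac X x'" "\<phi> v = dirac X x'"
    using pair_orbit_meets_fibres[OF abL x x'] by blast
  have uvY: "u \<in> Y" "v \<in> Y" using uv(1) pair_orbit_closure_Y[OF ab] by auto
  have "pair_midpoint ` closure (pair_orbit a b) \<subseteq> closure (convex hull ?O)"
  proof (rule image_closure_subset[OF continuous_on_pair_midpoint closed_closure])
    show "pair_midpoint ` pair_orbit a b \<subseteq> closure (convex hull ?O)"
      unfolding pair_midpoint_pair_orbit[OF abL] using hull_subset closure_subset by (meson order_trans)
  qed
  then have "pair_midpoint (u, v) \<in> closure (convex hull ?O)" using uv(1) by blast
  moreover have "pair_midpoint (u, v) \<in> convex hull (Y \<inter> {l \<in> L. \<phi> l = dirac X x'})"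
    using uv uvY Y_subset by (intro pair_midpoint_in convex_convex_hull hull_inc) auto
  ultimately show "closure (convex hull ?O) \<inter> convex hull (Y \<inter> {l \<in> L. \<phi> l = dirac X x'}) \<noteq> {}"
    by blast
qed

text \<open>The central step. By the previous lemma and Milman's theorem, an extreme point \<open>e\<close> of \<open>L\<close> is a limit
of translates of the midpoint of \<open>a\<close> and \<open>b\<close>, hence the midpoint of some \<open>u\<close> and \<open>v\<close> with \<open>(u, v)\<close> in
the orbit closure of \<open>(a, b)\<close>. By extremality \<open>u = v = e\<close>: the points \<open>a\<close> and \<open>b\<close> are moved
simultaneously to \<open>e\<close>.\<close>

lemma extreme_in_pair_orbit_closure:
  assumes ab: "a \<in> Y" "b \<in> Y" and x: "x \<in> topspace X" "\<phi> a = dirac X x" "\<phi> b = dirac X x"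
    and e: "e extreme_point_of L"
  shows "(e, e) \<in> closure (pair_orbit a b)"
proof -
  have abL: "a \<in> L" "b \<in> L" using ab Y_subset by auto
  define M where "M = pair_midpoint ` closure (pair_orbit a b)"
  have M: "compact M"
    unfolding M_def using compact_pair_orbit[OF abL] by (intro compact_continuous_image continuous_on_pair_midpoint)
  have M_sub: "M \<subseteq> L"
    unfolding M_def using pair_orbit_closure_L[OF abL] pair_midpoint_in[OF convex_L] by auto
  have "L \<subseteq> closure (convex hull M)"
    unfolding L_generated_by_midpoint[OF ab x, symmetric] pair_midpoint_pair_orbit[OF abL, symmetric] M_def
    by (intro closure_mono hull_mono image_mono closure_subset)
  moreover have "closure (convex hull M) \<subseteq> L"
    using M_sub by (intro closure_minimal hull_minimal closed_L convex_L)
  ultimately have "e \<in> M"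
    using extreme_points_of_closed_hull_in_compact[OF M compact_L _ e] by blast
  then obtain u v where uv: "(u, v) \<in> closure (pair_orbit a b)" "e = pair_midpoint (u, v)"
    by (auto simp: M_def)
  have "e \<notin> open_segment u v"
    using e uv(1) pair_orbit_closure_L[OF abL] unfolding extreme_point_of_def by blast
  moreover have "e \<in> open_segment u v" if "u \<noteq> v"
    unfolding in_segment using that uv(2)
    by (intro conjI exI[of _ "1 / 2"]) (simp_all add: pair_midpoint_def)
  ultimately have "u = v" by blast
  then have "e = u" using uv(2) by (simp add: pair_midpoint_def scaleR_add_left[symmetric])
  then show ?thesis using uv(1) \<open>u = v\<close> by simp
qed

text \<open>The fibre over an extreme point is an extremal subset of \<open>L\<close>, so it contains an extreme point
of \<open>L\<close>.\<close>

lemma Y_meets_fibre: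
  assumes x: "x \<in> topspace X"
  shows "\<exists>y\<in>Y. \<phi> y = dirac X x"
proof -
  let ?A = "{l \<in> L. \<phi> l = dirac X x}"
  have "closed ?A"
    by (rule continuous_closed_preimage_constant[OF \<phi>_continuous closed_L])
  then have "compact ?A"
    using closed_Int_compact[of ?A L] compact_L by (simp add: Int_absorb2 Collect_subset)
  moreover have "?A \<noteq> {}"
  proof -
    have "dirac X x \<in> \<phi> ` L" using \<phi>_image dirac_in_states[OF x] by simp
    then obtain l where "l \<in> L" "dirac X x = \<phi> l" by (rule imageE)
    then show ?thesis by auto
  qed
  moreover have "extremal_subset ?A L"
    unfolding extremal_subset_def
  proof (intro conjI ballI impI)
    fix a b z assume ab: "a \<in> L" "b \<in> L" and z: "z \<in> ?A" "z \<in> open_segment a b"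
    obtain u where u: "0 < u" "u < 1" "z = (1 - u) *\<^sub>R a + u *\<^sub>R b"
      using z(2) by (auto simp: in_segment)
    have s: "\<phi> a \<in> states X" "\<phi> b \<in> states X" using ab \<phi>_image by auto
    have eq: "(1 - u) *\<^sub>R \<phi> a + u *\<^sub>R \<phi> b = dirac X x"
      using \<phi>_affine[of a b "1 - u" u] ab u z(1) by simp
    have "\<phi> a = dirac X x"
      by (rule dirac_extreme[OF compact_X Hausdorff_X x s u(1,2) eq])
    moreover have "\<phi> b = dirac X x"
    proof (rule dirac_extreme[OF compact_X Hausdorff_X x s(2,1)])
      show "(1 - (1 - u)) *\<^sub>R \<phi> b + (1 - u) *\<^sub>R \<phi> a = dirac X x"
        using eq by (simp add: add.commute)
    qed (use u in auto)
    ultimately show "a \<in> ?A" "b \<in> ?A" using ab by auto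
  qed auto
  ultimately obtain e where "e \<in> ?A" "e extreme_point_of L"
    using extremal_subset_contains_extreme_point by blast
  moreover have "e \<in> Y"
    by (rule closure_subset[THEN subsetD]) (simp add: \<open>e extreme_point_of L\<close>)
  ultimately show ?thesis by blast
qed

lemma closure_pair_orbit_diag:
  assumes "(u, v) \<in> closure (pair_orbit a a)" shows "u \<in> closure ((\<lambda>g. \<sigma> g a) ` carrier G)"
proof -
  have "fst ` closure (pair_orbit a a) \<subseteq> closure ((\<lambda>g. \<sigma> g a) ` carrier G)"
    by (rule image_closure_subset)
      (auto simp: pair_orbit_def intro!: continuous_intros closure_subset[THEN subsetD])
  then show ?thesis using assms by force
qed

text \<open>The central step for \<open>a = b\<close>.\<close>

lemma orbit_dense_over_dirac:
  assumes y: "y \<in> Y" and x: "x \<in> topspace X" "\<phi> y = dirac X x"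
  shows "Y \<subseteq> closure ((\<lambda>g. \<sigma> g y) ` carrier G)"
proof (rule closure_minimal)
  show "{e. e extreme_point_of L} \<subseteq> closure ((\<lambda>g. \<sigma> g y) ` carrier G)"
    using extreme_in_pair_orbit_closure[OF y y x x(2)] closure_pair_orbit_diag by auto
qed simp

text \<open>Take a point \<open>z\<close> of \<open>Y\<close> over a point mass. Its orbit stays over the closed set of point masses and is
dense in \<open>Y\<close>.\<close>

lemma Y_over_dirac:
  assumes "y \<in> Y" shows "\<exists>x\<in>topspace X. \<phi> y = dirac X x"
proof -
  obtain x z where x: "x \<in> topspace X" and z: "z \<in> Y" "\<phi> z = dirac X x"
    using X_nonempty Y_meets_fibre by blast
  have "compactin euclidean (dirac X ` topspace X)"
    using compact_X continuous_map_dirac image_compactin by (metis compact_space_def)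
  then have "closed (dirac X ` topspace X)"
    by (simp add: compact_imp_closed)
  then have "closed (L \<inter> \<phi> -` (dirac X ` topspace X))"
    by (rule continuous_closed_preimage[OF \<phi>_continuous closed_L])
  moreover have "(\<lambda>g. \<sigma> g z) ` carrier G \<subseteq> L \<inter> \<phi> -` (dirac X ` topspace X)"
    using z x Y_subset \<sigma>_in \<phi>_dirac flow_action_in[OF topological_group X_flow] by blast
  ultimately have "closure ((\<lambda>g. \<sigma> g z) ` carrier G) \<subseteq> L \<inter> \<phi> -` (dirac X ` topspace X)"
    by (intro closure_minimal)
  then show ?thesis
    using orbit_dense_over_dirac[OF z(1) x z(2)] assms by blast
qed

lemma Y_flow: "flow G T (top_of_set Y) \<sigma>"
  unfolding flow_def
proof (intro conjI ballI)
  show "topspace (top_of_set Y) \<noteq> {}"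
    using Y_meets_fibre X_nonempty by force
  show "compact_space (top_of_set Y)"
    using compact_Y by (simp add: compact_space_subtopology)
  show "Hausdorff_space (top_of_set Y)" by (rule Hausdorff_space_top_of_set)
  show "continuous_map (prod_topology T (top_of_set Y)) (top_of_set Y) (\<lambda>(g, x). \<sigma> g x)"
  proof (rule continuous_map_into_subtopology)
    have "continuous_map (prod_topology T (top_of_set L)) (top_of_set L) (\<lambda>(g, x). \<sigma> g x)"
      using L_flow by (simp add: flow_def)
    then have "continuous_map (prod_topology T (top_of_set L)) euclidean (\<lambda>(g, x). \<sigma> g x)"
      by (rule continuous_map_into_fulltopology)
    moreover have "prod_topology T (top_of_set Y) = subtopology (prod_topology T (top_of_set L)) (UNIV \<times> Y)"
      using Y_subset by (simp add: subtopology_Times subtopology_subtopology Int_absorb1 Int_absorb2)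
    ultimately show "continuous_map (prod_topology T (top_of_set Y)) euclidean (\<lambda>(g, x). \<sigma> g x)"
      by (simp add: continuous_map_from_subtopology)
    show "(\<lambda>(g, x). \<sigma> g x) \<in> topspace (prod_topology T (top_of_set Y)) \<rightarrow> Y"
      using \<sigma>_Y topological_group by (auto simp: topological_group_def)
  qed
qed (use Y_subset \<sigma>_one \<sigma>_mult in auto)

lemma Y_minimal: "minimal_flow G T (top_of_set Y) \<sigma>"
  unfolding minimal_flow_def
proof (intro conjI ballI Y_flow)
  fix y assume "y \<in> topspace (top_of_set Y)"
  then have y: "y \<in> Y" by simp
  then obtain x where x: "x \<in> topspace X" "\<phi> y = dirac X x" using Y_over_dirac by blast
  have "(\<lambda>g. \<sigma> g y) ` carrier G \<subseteq> Y" using \<sigma>_Y y by auto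
  then show "top_of_set Y closure_of (\<lambda>g. \<sigma> g y) ` carrier G = topspace (top_of_set Y)"
    using orbit_dense_over_dirac[OF y x] by (simp add: closure_of_subtopology Int_absorb1 Int_absorb2)
qed

lemma exists_extreme: "\<exists>e. e extreme_point_of L"
proof -
  have "extremal_subset L L" by (simp add: extremal_subset_def)
  then show ?thesis
    using extremal_subset_contains_extreme_point[OF _ compact_L L_nonempty] by blast
qed

text \<open>Proximality of \<open>X\<close> leads from \<open>y1\<close> and \<open>y2\<close> to a pair \<open>(a, b)\<close> in the orbit closure whose
components lie in one fibre, and the central step leads from there to the diagonal.\<close>

lemma diagonal_in_pair_orbit_closure:
  assumes y: "y1 \<in> Y" "y2 \<in> Y"
  shows "\<exists>e\<in>Y. (e, e) \<in> closure (pair_orbit y1 y2)"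
proof -
  have yL: "y1 \<in> L" "y2 \<in> L" using y Y_subset by auto
  obtain x1 x2 where x: "x1 \<in> topspace X" "\<phi> y1 = dirac X x1" "x2 \<in> topspace X" "\<phi> y2 = dirac X x2"
    using Y_over_dirac y by metis
  obtain F z where F: "F \<noteq> bot" "F \<le> principal (carrier G)"
      "limitin X (\<lambda>g. \<alpha> g x1) z F" "limitin X (\<lambda>g. \<alpha> g x2) z F"
    using proximal x unfolding proximal_flow_def by meson
  have z: "z \<in> topspace X" using F(3) by (rule limitin_topspace)
  define D where "D = \<phi>_pair ` closure (pair_orbit y1 y2)"
  have D: "closed D" unfolding D_def by (rule closed_\<phi>_pair_orbit[OF yL])
  have lim: "((\<lambda>g. (dirac X (\<alpha> g x1), dirac X (\<alpha> g x2))) \<longlongrightarrow> (dirac X z, dirac X z)) F"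
    by (intro tendsto_Pair tendsto_dirac F)
  have inD: "(dirac X (\<alpha> g x1), dirac X (\<alpha> g x2)) \<in> D" if "g \<in> carrier G" for g
    unfolding D_def by (rule dirac_pair_in_\<phi>_pair_orbit[OF that yL x(2,4)])
  have "eventually (\<lambda>g. g \<in> carrier G) F"
    using F(2) by (simp add: le_principal)
  then have "eventually (\<lambda>g. (dirac X (\<alpha> g x1), dirac X (\<alpha> g x2)) \<in> D) F"
    by (rule eventually_mono) (rule inD)
  then have "(dirac X z, dirac X z) \<in> D"
    by (rule Lim_in_closed_set[OF D _ F(1) lim])
  then obtain a b where ab: "(a, b) \<in> closure (pair_orbit y1 y2)" "\<phi> a = dirac X z" "\<phi> b = dirac X z"
    unfolding D_def \<phi>_pair_def by fastforce
  then have abY: "a \<in> Y" "b \<in> Y" using pair_orbit_closure_Y[OF y] by auto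
  obtain e where e: "e extreme_point_of L" using exists_extreme by blast
  have "(e, e) \<in> closure (pair_orbit a b)"
    by (rule extreme_in_pair_orbit_closure[OF abY z ab(2,3) e])
  then have "(e, e) \<in> closure (pair_orbit y1 y2)"
    using pair_orbit_closure_trans[OF yL ab(1)] by blast
  moreover from this have "e \<in> Y" using pair_orbit_closure_Y[OF y] by blast
  ultimately show ?thesis by blast
qed

text \<open>A point \<open>(e, e)\<close> of the orbit closure is turned into the filter on the group whose members contain
the preimages of the neighbourhoods of \<open>(e, e)\<close>.\<close>

lemma Y_proximal: "proximal_flow G T (top_of_set Y) \<sigma>"
  unfolding proximal_flow_def
proof (intro conjI ballI Y_flow)
  fix y1 y2 assume "y1 \<in> topspace (top_of_set Y)" "y2 \<in> topspace (top_of_set Y)"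
  then have y: "y1 \<in> Y" "y2 \<in> Y" by auto
  then obtain e where e: "e \<in> Y" "(e, e) \<in> closure (pair_orbit y1 y2)"
    using diagonal_in_pair_orbit_closure by blast
  define h where "h = (\<lambda>g. (\<sigma> g y1, \<sigma> g y2))"
  define F where "F = inf (filtercomap h (nhds (e, e))) (principal (carrier G))"
  have "F \<noteq> bot"
  proof
    assume "F = bot"
    then have "eventually (\<lambda>_. False) F" by simp
    then have "eventually (\<lambda>g. g \<notin> carrier G) (filtercomap h (nhds (e, e)))"
      by (simp add: F_def eventually_inf_principal)
    then obtain U where U: "open U" "(e, e) \<in> U" "\<And>g. h g \<in> U \<Longrightarrow> g \<notin> carrier G"
      unfolding eventually_filtercomap eventually_nhds by metis
    have "U \<inter> pair_orbit y1 y2 \<noteq> {}"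
      using e(2) U(1,2) unfolding closure_iff_nhds_not_empty by blast
    then show False using U(3) by (auto simp: pair_orbit_def h_def)
  qed
  moreover have FG: "F \<le> principal (carrier G)" by (simp add: F_def)
  moreover have "filterlim h (nhds (e, e)) F"
    unfolding F_def by (rule filterlim_mono[OF filterlim_filtercomap order_refl inf_le1])
  then have "((\<lambda>g. \<sigma> g y1) \<longlongrightarrow> e) F" "((\<lambda>g. \<sigma> g y2) \<longlongrightarrow> e) F"
    using tendsto_fst[of h "(e, e)" F] tendsto_snd[of h "(e, e)" F] by (simp_all add: h_def)
  moreover have "eventually (\<lambda>g. \<sigma> g y1 \<in> Y) F" "eventually (\<lambda>g. \<sigma> g y2 \<in> Y) F"
    using FG \<sigma>_Y y by (auto simp: le_principal elim!: eventually_mono)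
  ultimately show "\<exists>F z. F \<noteq> bot \<and> F \<le> principal (carrier G) \<and>
      limitin (top_of_set Y) (\<lambda>g. \<sigma> g y1) z F \<and> limitin (top_of_set Y) (\<lambda>g. \<sigma> g y2) z F"
    using e(1) by (intro exI[of _ F] exI[of _ e]) (simp add: limitin_subtopology)
qed

text \<open>The composition with \<open>\<phi>\<close> is an endomorphism of \<open>X\<close>, and a minimal proximal flow has no endomorphism
except the identity: if \<open>g x0\<close> and \<open>g x1\<close>, where \<open>x1\<close> is the image of \<open>x0\<close>, converge to the same \<open>z\<close>
along a filter on the group, then \<open>z\<close> is fixed. The set of fixed points is closed and invariant, so
it is all of \<open>X\<close>.\<close>

lemma factor_is_section:
  assumes f: "factor_map G X \<alpha> (top_of_set Y) \<sigma> f" and x: "x \<in> topspace X"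
  shows "\<phi> (f x) = dirac X x"
proof -
  have fY: "\<And>x. x \<in> topspace X \<Longrightarrow> f x \<in> Y" and cf: "continuous_map X (top_of_set Y) f"
    and fe: "\<And>g x. g \<in> carrier G \<Longrightarrow> x \<in> topspace X \<Longrightarrow> f (\<alpha> g x) = \<sigma> g (f x)"
    using f by (auto simp: factor_map_def)
  have "continuous_map (top_of_set Y) euclidean \<phi>"
    using continuous_on_subset[OF \<phi>_continuous Y_subset] by (simp add: continuous_map_iff_continuous)
  from continuous_map_compose[OF cf this] have c\<phi>f: "continuous_map X euclidean (\<lambda>x. \<phi> (f x))"
    by (simp add: o_def)
  obtain x0 where x0: "x0 \<in> topspace X" using X_nonempty by blast
  then obtain x1 where x1: "x1 \<in> topspace X" "\<phi> (f x0) = dirac X x1"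
    using Y_over_dirac[OF fY] by blast
  obtain F z where F: "F \<noteq> bot" "F \<le> principal (carrier G)"
      "limitin X (\<lambda>g. \<alpha> g x0) z F" "limitin X (\<lambda>g. \<alpha> g x1) z F"
    using proximal x0 x1 unfolding proximal_flow_def by meson
  have z: "z \<in> topspace X" using F(3) by (rule limitin_topspace)
  have eq: "\<phi> (f (\<alpha> g x0)) = dirac X (\<alpha> g x1)" if "g \<in> carrier G" for g
    using that fe[OF that x0] \<phi>_dirac[OF that _ x1(2)] fY[OF x0] Y_subset by auto
  have "((\<lambda>g. \<phi> (f (\<alpha> g x0))) \<longlongrightarrow> \<phi> (f z)) F"
    using continuous_map_limit[OF c\<phi>f F(3)] by (simp add: o_def)
  moreover have "eventually (\<lambda>g. \<phi> (f (\<alpha> g x0)) = dirac X (\<alpha> g x1)) F"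
    using F(2) eq by (auto simp: le_principal elim!: eventually_mono)
  ultimately have "((\<lambda>g. dirac X (\<alpha> g x1)) \<longlongrightarrow> \<phi> (f z)) F"
    by (rule Lim_transform_eventually)
  then have fz: "\<phi> (f z) = dirac X z"
    using tendsto_dirac[OF F(4)] F(1) tendsto_unique by blast
  have "continuous_map X (prod_topology euclidean euclidean) (\<lambda>x. (\<phi> (f x), dirac X x))"
    by (intro continuous_map_pairedI continuous_map_dirac c\<phi>f)
  then have "continuous_map X euclidean (\<lambda>x. (\<phi> (f x), dirac X x))" by simp
  moreover have "closed {p::(('x \<Rightarrow> real) \<Rightarrow> real) \<times> (('x \<Rightarrow> real) \<Rightarrow> real). fst p = snd p}"
    by (intro closed_Collect_eq continuous_intros)
  ultimately have "closedin X {x \<in> topspace X. (\<phi> (f x), dirac X x) \<in> {p. fst p = snd p}}"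
    by (intro closedin_continuous_map_preimage) auto
  then have "topspace X \<subseteq> {x \<in> topspace X. (\<phi> (f x), dirac X x) \<in> {p. fst p = snd p}}"
  proof (rule X_orbit_dense[OF z])
    fix g assume g: "g \<in> carrier G"
    have "\<phi> (f (\<alpha> g z)) = dirac X (\<alpha> g z)"
      using fe[OF g z] \<phi>_dirac[OF g _ fz] fY[OF z] Y_subset by auto
    then show "\<alpha> g z \<in> {x \<in> topspace X. (\<phi> (f x), dirac X x) \<in> {p. fst p = snd p}}"
      using flow_action_in[OF topological_group X_flow g z] by simp
  qed
  then show ?thesis using x by auto
qed

lemma L_eq_closed_hull_Y: "L \<subseteq> closure (convex hull Y)"
proof -
  obtain x z where x: "x \<in> topspace X" and z: "z \<in> Y" "\<phi> z = dirac X x"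
    using X_nonempty Y_meets_fibre by blast
  have "pair_midpoint (z, z) = z" by (simp add: pair_midpoint_def scaleR_add_left[symmetric])
  then show ?thesis
    using L_generated_by_midpoint[OF z(1) z(1) x z(2) z(2)] z(1) \<sigma>_Y
    by (metis (no_types, lifting) closure_mono hull_mono image_subsetI)
qed

text \<open>A point \<open>l\<close> is, up to \<open>closure W\<close>, a combination of finitely many points \<open>f j\<close> whose coefficients
\<open>\<phi> l (g j)\<close> depend only on \<open>\<phi> l\<close>. The \<open>g j\<close> are a partition of unity for a cover of \<open>X\<close> by sets on
which \<open>f\<close> varies within \<open>W\<close>, so the approximation holds at the points \<open>f x\<close> of \<open>Y\<close>, where
\<open>\<phi> (f x)\<close> is the point mass at \<open>x\<close>. As the difference is affine and continuous in \<open>l\<close>, the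
approximation extends to the closed convex hull of \<open>Y\<close>, which is \<open>L\<close>.\<close>

lemma barycenter_approximation:
  assumes f: "factor_map G X \<alpha> (top_of_set Y) \<sigma> f"
    and W: "open W" "convex W" "0 \<in> W"
  shows "\<exists>J g. \<forall>l\<in>L. l - (\<Sum>j\<in>J. \<phi> l (g j) *\<^sub>R f j) \<in> closure W"
proof -
  have fY: "f ` topspace X = Y" and cf: "continuous_map X euclidean f"
    using f by (auto simp: factor_map_def continuous_map_in_subtopology)
  define U where "U = (\<lambda>j. {x \<in> topspace X. f x \<in> (\<lambda>v. v - f j) -` W})"
  have U: "openin X (U j)" for j
    unfolding U_def
    by (rule openin_continuous_map_preimage[OF cf]) (auto intro!: open_vimage W continuous_intros)
  have cover: "topspace X \<subseteq> (\<Union>j\<in>topspace X. U j)"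
    using W(3) by (auto simp: U_def)
  from partition_of_unity[OF compact_X Hausdorff_X closedin_topspace U cover]
  obtain J g where J: "finite J" "J \<subseteq> topspace X"
    and *: "\<forall>j\<in>J. cts X (g j) \<and> (\<forall>x\<in>topspace X. 0 \<le> g j x \<and> (x \<notin> U j \<longrightarrow> g j x = 0))"
       "\<forall>x\<in>topspace X. (\<Sum>j\<in>J. g j x) = 1"
    by blast
  define h where "h = (\<lambda>l. l - (\<Sum>j\<in>J. \<phi> l (g j) *\<^sub>R f j))"
  define B where "B = {l \<in> L. h l \<in> closure W}"
  have ch: "continuous_on L h"
    unfolding h_def
    by (intro continuous_on_diff continuous_on_id continuous_on_sum continuous_on_scaleR_lctvs
        continuous_on_const continuous_on_product_then_coordinatewise[OF \<phi>_continuous])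
  have "closed B"
    using continuous_closed_preimage[OF ch closed_L closed_closure[of W]]
    by (simp add: B_def vimage_def Int_def)
  moreover have "convex B"
  proof (rule convexI)
    fix y z and u v :: real
    assume y: "y \<in> B" and z: "z \<in> B" and uv: "0 \<le> u" "0 \<le> v" "u + v = 1"
    have yz: "y \<in> L" "z \<in> L" using y z by (auto simp: B_def)
    have "u *\<^sub>R y + v *\<^sub>R z \<in> L"
      using convexD[OF convex_L] yz uv by simp
    moreover have "h (u *\<^sub>R y + v *\<^sub>R z) = u *\<^sub>R h y + v *\<^sub>R h z"
      unfolding h_def \<phi>_affine[OF yz uv]
      by (simp add: scaleR_sum_right sum.distrib algebra_simps)
    moreover have "u *\<^sub>R h y + v *\<^sub>R h z \<in> closure W"
      using convexD[OF convex_closure_lctvs[OF W(2)]] y z uv by (simp add: B_def)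
    ultimately show "u *\<^sub>R y + v *\<^sub>R z \<in> B" by (simp add: B_def)
  qed
  moreover have "Y \<subseteq> B"
  proof
    fix y assume y: "y \<in> Y"
    then obtain x where x: "x \<in> topspace X" "y = f x" using fY by blast
    have \<phi>y: "\<phi> y (g j) = g j x" if "j \<in> J" for j
      using factor_is_section[OF f x(1)] x(2) * that by (simp add: dirac_def)
    \<comment> \<open>Only the \<open>j\<close> with nonzero coefficient are known to satisfy \<open>y - f j \<in> W\<close>.\<close>
    let ?J = "{j \<in> J. g j x \<noteq> 0}"
    have one: "(\<Sum>j\<in>?J. g j x) = 1"
      using * x(1) J(1) by (subst sum.mono_neutral_left[of J]) auto
    have "h y = y - (\<Sum>j\<in>J. g j x *\<^sub>R f j)"
      unfolding h_def using \<phi>y by simp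
    also have "(\<Sum>j\<in>J. g j x *\<^sub>R f j) = (\<Sum>j\<in>?J. g j x *\<^sub>R f j)"
      using J(1) by (intro sum.mono_neutral_right) auto
    also have "y - \<dots> = (\<Sum>j\<in>?J. g j x *\<^sub>R (y - f j))"
      using one by (simp add: scaleR_diff_right sum_subtractf scaleR_sum_left[symmetric])
    also have "\<dots> \<in> W"
    proof (rule convex_sum[OF _ W(2) one])
      show "finite ?J" using J by simp
      show "0 \<le> g j x" if "j \<in> ?J" for j using that * x by auto
      show "y - f j \<in> W" if "j \<in> ?J" for j
      proof -
        have "x \<in> U j" using that * x by blast
        then show ?thesis using x(2) by (simp add: U_def)
      qed
    qed
    finally have "h y \<in> closure W" using closure_subset by blast
    then show "y \<in> B" using y Y_subset by (auto simp: B_def)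
  qed
  ultimately have "closure (convex hull Y) \<subseteq> B"
    by (intro closure_minimal[OF hull_minimal])
  then have "\<forall>l\<in>L. h l \<in> closure W"
    using L_eq_closed_hull_Y by (auto simp: B_def)
  then show ?thesis unfolding h_def by blast
qed

lemma \<phi>_inj:
  assumes f: "factor_map G X \<alpha> (top_of_set Y) \<sigma> f"
  shows "inj_on \<phi> L"
proof (rule inj_onI, rule ccontr)
  fix l l' assume l: "l \<in> L" "l' \<in> L" "\<phi> l = \<phi> l'" "l \<noteq> l'"
  then obtain W where W: "open W" "convex W" "0 \<in> W"
     "\<forall>w\<in>closure W. \<forall>w'\<in>closure W. w - w' \<noteq> l - l'"
    using separating_neighbourhood[of "l - l'"] by auto
  obtain J g where "\<forall>l\<in>L. l - (\<Sum>j\<in>J. \<phi> l (g j) *\<^sub>R f j) \<in> closure W"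
    using barycenter_approximation[OF f W(1-3)] by blast
  then have "l - (\<Sum>j\<in>J. \<phi> l (g j) *\<^sub>R f j) \<in> closure W" "l' - (\<Sum>j\<in>J. \<phi> l (g j) *\<^sub>R f j) \<in> closure W"
    using l by auto
  then show False using W(4) by force
qed

lemma isomorphism:
  assumes f: "factor_map G X \<alpha> (top_of_set Y) \<sigma> f"
  shows "affine_flow_isomorphism G L \<sigma> (states X) (push_forward \<alpha>) \<phi>"
  unfolding affine_flow_isomorphism_def
proof
  show "affine_extension G L \<sigma> (states X) (push_forward \<alpha>) \<phi>" by (rule extension)
  show "homeomorphic_map (top_of_set L) (top_of_set (states X)) \<phi>"
  proof (rule continuous_imp_homeomorphic_map)
    show "continuous_map (top_of_set L) (top_of_set (states X)) \<phi>"
      using extension by (simp add: affine_extension_def factor_map_def)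
    show "compact_space (top_of_set L)" using L_flow by (simp add: flow_def)
    show "Hausdorff_space (top_of_set (states X))" by (rule Hausdorff_space_top_of_set)
    show "\<phi> ` topspace (top_of_set L) = topspace (top_of_set (states X))" by (simp add: \<phi>_image)
    show "inj_on \<phi> (topspace (top_of_set L))" using \<phi>_inj[OF f] by simp
  qed
qed

end

theorem proposition5p8:
  fixes G :: "('g, 'm) monoid_scheme" and T :: "'g topology"
    and X :: "'x topology" and \<alpha> :: "'g \<Rightarrow> 'x \<Rightarrow> 'x"
  assumes "polish_group G T"
    and "universal_minimal_proximal_flow G T X \<alpha>"
  shows "proximally_irreducible TYPE('v::hausdorff_lctvs) G T
           (probability_measures X) (push_forward \<alpha>)"
proof -
  have G: "topological_group G T" using assms(1) by (simp add: polish_group_def)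
  have min: "minimal_flow G T X \<alpha>" and prox: "proximal_flow G T X \<alpha>"
    using assms(2) by (auto simp: universal_minimal_proximal_flow_def)
  have X: "flow G T X \<alpha>" "compact_space X" "Hausdorff_space X"
    using min by (auto simp: minimal_flow_def flow_def)
  show ?thesis
    unfolding proximally_irreducible_def probability_measures_eq_states[OF X(2,3)]
  proof (intro conjI allI impI affine_flow_states[OF G X(1)])
    fix L :: "'v set" and \<sigma> \<phi>
    assume L: "affine_flow G T L \<sigma> \<and>
      proximally_irreducible_extension G L \<sigma> (states X) (push_forward \<alpha>) \<phi>"
    interpret irreducible_over_states G T X \<alpha> L \<sigma> \<phi>
      using G min prox L by unfold_locales auto
    obtain f where "factor_map G X \<alpha> (top_of_set (ext_closure L)) \<sigma> f"
      using universal_minimal_proximal_factor[OF G assms(2) Y_minimal Y_proximal] by blast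
    then show "affine_flow_isomorphism G L \<sigma> (states X) (push_forward \<alpha>) \<phi>"
      by (rule isomorphism)
  qed
qed

end
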